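(* Let $G$ be a countably infinite, amenable and residually finite group. Consider a free $G$-odometer $\overleftarrow{G}$ with group structure, equipped with its normalized Haar measure $\nu$. Then, for every $k\ge 2$, there exist an irregular Toeplitz array $x_0\in\{0,1\}^G$ and an almost one-to-one factor map $\beta:\overline{O_G(x_0)}\to\overleftarrow{G}$ such that the subshift $(\overline{O_G(x_0)},G)$ admits exactly $k$ ergodic invariant probability measures, each of which is measure-theoretically isomorphic to the Haar measure $\nu$ on $\overleftarrow{G}$ via the map $\beta$, but which has (countably) infinite maximal rank. Moreover, for $\nu$-almost every $\xi\in\overleftarrow{G}$ the fiber $\beta^{-1}(\{\xi\})$ is countably infinite.
   Context: Let $(\Gamma_n)_{n\in\mathbb{N}}$ be a decreasing sequence of normal finite index subgroups of $G$. The associated $G$-odometer with group structure is $\overleftarrow{G}=\{(g_n\Gamma_n)_{n}\in\prod_n G/\Gamma_n: g_{n+1}\Gamma_n=g_n\Gamma_n\ \forall n\}$, a compact metrizable group, with $G$ acting by coordinatewise left multiplication. It is free if $\bigcap_n\Gamma_n=\{1_G\}$. The space $\{0,1\}^G$ carries the product topology and the shift action $(gx)(h)=x(hg)$; $\overline{O_G(x)}$ is the closure of the orbit of $x$. A factor map $\varphi:X\to Y$ is a continuous, surjective, $G$-equivariant map; it is almost one-to-one if $\{x\in X:\varphi^{-1}(\{\varphi(x)\})=\{x\}\}$ is dense in $X$. An array $x\in\{0,1\}^G$ is Toeplitz if for every $g\in G$ there is a finite index subgroup $\Gamma_g$ of $G$ with $x(g\gamma)=x(g)$ for all $\gamma\in\Gamma_g$.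 For a Toeplitz array $x$, the maximal equicontinuous factor of $(\overline{O_G(x)},G)$ is a $G$-odometer (uniquely ergodic); let $\pi$ be the corresponding factor map, $\nu$ the unique invariant probability measure of that odometer, and $\mathcal{T}$ the set of all Toeplitz arrays in $\overline{O_G(x)}$. Then $x$ is regular if $\nu(\pi(\mathcal{T}))=1$, and irregular otherwise. The maximal rank of the extension $\beta$ is the maximal (supremum) cardinality of the fibers $\beta^{-1}(\{\xi\})$, $\xi\in\overleftarrow{G}$; "countably infinite maximal rank" means that all fibers are at most countable and this maximal cardinality is countably infinite. "Isomorphic via $\beta$" means that for each such ergodic measure $\mu$ the map $\beta$ is a measure-theoretic isomorphism from $(\overline{O_G(x_0)},\mu,G)$ to $(\overleftarrow{G},\nu,G)$ (i.e. it pushes $\mu$ to $\nu$ and is a bi-measurable bijection between invariant sets of full measure). *)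

theory Defs
  imports "HOL-Algebra.Left_Coset" "HOL-Probability.Probability"
begin

section \<open>Groups\<close>

definition finite_index_subgroup :: "('a, 'b) monoid_scheme \<Rightarrow> 'a set \<Rightarrow> bool" where
  "finite_index_subgroup G H \<longleftrightarrow> subgroup H G \<and> finite (rcosets\<^bsub>G\<^esub> H)"

definition residually_finite :: "('a, 'b) monoid_scheme \<Rightarrow> bool" where
  "residually_finite G \<longleftrightarrow>
     (\<forall>g\<in>carrier G. g \<noteq> \<one>\<^bsub>G\<^esub> \<longrightarrow> (\<exists>H. H \<lhd> G \<and> finite_index_subgroup G H \<and> g \<notin> H))"

text \<open>Amenability of a countable discrete group, in the form of a Folner sequence.\<close>

definition amenable :: "('a, 'b) monoid_scheme \<Rightarrow> bool" where
  "amenable G \<longleftrightarrow>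
     (\<exists>F :: nat \<Rightarrow> 'a set.
        (\<forall>n. finite (F n) \<and> F n \<noteq> {} \<and> F n \<subseteq> carrier G) \<and>
        (\<forall>g\<in>carrier G.
           (\<lambda>n. real (card (((g <#\<^bsub>G\<^esub> F n) - F n) \<union> (F n - (g <#\<^bsub>G\<^esub> F n)))) / real (card (F n)))
             \<longlonglongrightarrow> 0))"


section \<open>Topological dynamical systems\<close>

text \<open>A system is a topology on its phase space together with the action
  \<open>a :: 'g \<Rightarrow> 'x \<Rightarrow> 'x\<close>; only values of \<open>a\<close> on \<open>carrier G\<close> and \<open>topspace X\<close> matter.\<close>

definition dynamical_system ::
  "('g, 'b) monoid_scheme \<Rightarrow> 'x topology \<Rightarrow> ('g \<Rightarrow> 'x \<Rightarrow> 'x) \<Rightarrow> bool" where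
  "dynamical_system G X a \<longleftrightarrow>
     compact_space X \<and> metrizable_space X \<and>
     (\<forall>g\<in>carrier G. continuous_map X X (a g)) \<and>
     (\<forall>x\<in>topspace X. a \<one>\<^bsub>G\<^esub> x = x) \<and>
     (\<forall>g\<in>carrier G. \<forall>h\<in>carrier G. \<forall>x\<in>topspace X. a (g \<otimes>\<^bsub>G\<^esub> h) x = a g (a h x))"

definition factor_map ::
  "('g, 'b) monoid_scheme \<Rightarrow> 'x topology \<Rightarrow> ('g \<Rightarrow> 'x \<Rightarrow> 'x) \<Rightarrow>
     'y topology \<Rightarrow> ('g \<Rightarrow> 'y \<Rightarrow> 'y) \<Rightarrow> ('x \<Rightarrow> 'y) \<Rightarrow> bool" where
  "factor_map G X a Y b f \<longleftrightarrow>
     continuous_map X Y f \<and> f ` topspace X = topspace Y \<and>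
     (\<forall>g\<in>carrier G. \<forall>x\<in>topspace X. f (a g x) = b g (f x))"

definition fiber :: "'x topology \<Rightarrow> ('x \<Rightarrow> 'y) \<Rightarrow> 'y \<Rightarrow> 'x set" where
  "fiber X f y = {x \<in> topspace X. f x = y}"

definition almost_one_to_one :: "'x topology \<Rightarrow> ('x \<Rightarrow> 'y) \<Rightarrow> bool" where
  "almost_one_to_one X f \<longleftrightarrow>
     X closure_of {x \<in> topspace X. fiber X f (f x) = {x}} = topspace X"

text \<open>In a compact metrizable space equicontinuity does not depend on the choice of the
  compatible metric \<open>d\<close>.\<close>

definition equicontinuous_system ::
  "('g, 'b) monoid_scheme \<Rightarrow> 'x topology \<Rightarrow> ('g \<Rightarrow> 'x \<Rightarrow> 'x) \<Rightarrow> bool" where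
  "equicontinuous_system G X a \<longleftrightarrow>
     dynamical_system G X a \<and>
     (\<exists>d. Metric_space (topspace X) d \<and> Metric_space.mtopology (topspace X) d = X \<and>
        (\<forall>\<epsilon>>0. \<exists>\<delta>>0. \<forall>x\<in>topspace X. \<forall>y\<in>topspace X.
           d x y < \<delta> \<longrightarrow> (\<forall>g\<in>carrier G. d (a g x) (a g y) < \<epsilon>)))"

text \<open>The competing equicontinuous factors \<open>W\<close> have phase spaces of type \<open>'x set\<close>. This is no
  restriction: a factor \<open>f\<close> of a compact system on a Hausdorff space is isomorphic to the quotient
  of \<open>X\<close> whose points are the fibers of \<open>f\<close>, and these are sets of points of \<open>X\<close>.\<close>

definition max_equicontinuous_factor ::
  "('g, 'b) monoid_scheme \<Rightarrow> 'x topology \<Rightarrow> ('g \<Rightarrow> 'x \<Rightarrow> 'x) \<Rightarrow>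
     'y topology \<Rightarrow> ('g \<Rightarrow> 'y \<Rightarrow> 'y) \<Rightarrow> ('x \<Rightarrow> 'y) \<Rightarrow> bool" where
  "max_equicontinuous_factor G X a Y b f \<longleftrightarrow>
     equicontinuous_system G Y b \<and> factor_map G X a Y b f \<and>
     (\<forall>(W :: 'x set topology) c h.
        equicontinuous_system G W c \<and> factor_map G X a W c h \<longrightarrow>
        (\<exists>k. factor_map G Y b W c k \<and> (\<forall>x\<in>topspace X. h x = k (f x))))"

text \<open>The value \<open>\<infinity>\<close> stands for any infinite cardinality; under the countability clause of
  \<open>countably_infinite_maximal_rank\<close> it can only be that of the natural numbers.\<close>

definition maximal_rank :: "'x topology \<Rightarrow> 'y topology \<Rightarrow> ('x \<Rightarrow> 'y) \<Rightarrow> enat" where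
  "maximal_rank X Y f =
     (SUP y\<in>topspace Y. if finite (fiber X f y) then enat (card (fiber X f y)) else \<infinity>)"

definition countably_infinite_maximal_rank ::
  "'x topology \<Rightarrow> 'y topology \<Rightarrow> ('x \<Rightarrow> 'y) \<Rightarrow> bool" where
  "countably_infinite_maximal_rank X Y f \<longleftrightarrow>
     (\<forall>y\<in>topspace Y. countable (fiber X f y)) \<and> maximal_rank X Y f = \<infinity>"


section \<open>Invariant measures\<close>

definition borel_sets :: "'x topology \<Rightarrow> 'x set set" where
  "borel_sets X = sigma_sets (topspace X) {U. openin X U}"

definition borel_probability :: "'x topology \<Rightarrow> 'x measure \<Rightarrow> bool" where
  "borel_probability X \<mu> \<longleftrightarrow> prob_space \<mu> \<and> sets \<mu> = borel_sets X"

definition invariant_probability ::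
  "('g, 'b) monoid_scheme \<Rightarrow> 'x topology \<Rightarrow> ('g \<Rightarrow> 'x \<Rightarrow> 'x) \<Rightarrow> 'x measure \<Rightarrow> bool" where
  "invariant_probability G X a \<mu> \<longleftrightarrow>
     borel_probability X \<mu> \<and> (\<forall>g\<in>carrier G. distr \<mu> \<mu> (a g) = \<mu>)"

definition ergodic_probability ::
  "('g, 'b) monoid_scheme \<Rightarrow> 'x topology \<Rightarrow> ('g \<Rightarrow> 'x \<Rightarrow> 'x) \<Rightarrow> 'x measure \<Rightarrow> bool" where
  "ergodic_probability G X a \<mu> \<longleftrightarrow>
     invariant_probability G X a \<mu> \<and>
     (\<forall>A\<in>sets \<mu>. (\<forall>g\<in>carrier G. {x \<in> space \<mu>. a g x \<in> A} = A) \<longrightarrow>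
        emeasure \<mu> A = 0 \<or> emeasure \<mu> A = 1)"

definition isomorphic_via ::
  "('g, 'b) monoid_scheme \<Rightarrow> 'x measure \<Rightarrow> ('g \<Rightarrow> 'x \<Rightarrow> 'x) \<Rightarrow>
     'y measure \<Rightarrow> ('g \<Rightarrow> 'y \<Rightarrow> 'y) \<Rightarrow> ('x \<Rightarrow> 'y) \<Rightarrow> bool" where
  "isomorphic_via G \<mu> a \<nu> b f \<longleftrightarrow>
     f \<in> measurable \<mu> \<nu> \<and> distr \<mu> \<nu> f = \<nu> \<and>
     (\<exists>X0\<in>sets \<mu>. \<exists>Y0\<in>sets \<nu>.
        emeasure \<mu> X0 = 1 \<and> emeasure \<nu> Y0 = 1 \<and>
        (\<forall>g\<in>carrier G. a g ` X0 = X0 \<and> b g ` Y0 = Y0) \<and>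
        bij_betw f X0 Y0 \<and>
        f \<in> measurable (restrict_space \<mu> X0) (restrict_space \<nu> Y0) \<and>
        the_inv_into X0 f \<in> measurable (restrict_space \<nu> Y0) (restrict_space \<mu> X0) \<and>
        (\<forall>g\<in>carrier G. \<forall>x\<in>X0. f (a g x) = b g (f x)))"

text \<open>For a compact metrizable group; \<open>K\<close> carries the group structure, \<open>T\<close> the topology.\<close>

definition normalized_haar :: "('k, 'b) monoid_scheme \<Rightarrow> 'k topology \<Rightarrow> 'k measure \<Rightarrow> bool" where
  "normalized_haar K T \<nu> \<longleftrightarrow>
     borel_probability T \<nu> \<and> (\<forall>\<xi>\<in>carrier K. distr \<nu> \<nu> (\<lambda>\<eta>. \<xi> \<otimes>\<^bsub>K\<^esub> \<eta>) = \<nu>)"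


section \<open>Odometers\<close>

definition odometer_sequence :: "('a, 'b) monoid_scheme \<Rightarrow> (nat \<Rightarrow> 'a set) \<Rightarrow> bool" where
  "odometer_sequence G \<Gamma> \<longleftrightarrow>
     (\<forall>n. finite_index_subgroup G (\<Gamma> n)) \<and> (\<forall>n. \<Gamma> (Suc n) \<subseteq> \<Gamma> n)"

definition odometer :: "('a, 'b) monoid_scheme \<Rightarrow> (nat \<Rightarrow> 'a set) \<Rightarrow> (nat \<Rightarrow> 'a set) set" where
  "odometer G \<Gamma> =
     {(\<lambda>n. g n <#\<^bsub>G\<^esub> \<Gamma> n) | g.
        (\<forall>n. g n \<in> carrier G) \<and> (\<forall>n. g (Suc n) <#\<^bsub>G\<^esub> \<Gamma> n = g n <#\<^bsub>G\<^esub> \<Gamma> n)}"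

definition odometer_top ::
  "('a, 'b) monoid_scheme \<Rightarrow> (nat \<Rightarrow> 'a set) \<Rightarrow> (nat \<Rightarrow> 'a set) topology" where
  "odometer_top G \<Gamma> =
     subtopology (product_topology (\<lambda>n. discrete_topology (lcosets\<^bsub>G\<^esub> (\<Gamma> n))) UNIV) (odometer G \<Gamma>)"

definition odometer_action ::
  "('a, 'b) monoid_scheme \<Rightarrow> 'a \<Rightarrow> (nat \<Rightarrow> 'a set) \<Rightarrow> (nat \<Rightarrow> 'a set)" where
  "odometer_action G g \<xi> = (\<lambda>n. g <#\<^bsub>G\<^esub> \<xi> n)"

text \<open>A group when all \<open>\<Gamma> n\<close> are normal; then it is a subgroup of the product of the quotients
  \<open>G Mod \<Gamma> n\<close>, whose multiplication is the product of cosets.\<close>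

definition odometer_group ::
  "('a, 'b) monoid_scheme \<Rightarrow> (nat \<Rightarrow> 'a set) \<Rightarrow> (nat \<Rightarrow> 'a set) monoid" where
  "odometer_group G \<Gamma> =
     \<lparr>carrier = odometer G \<Gamma>, monoid.mult = (\<lambda>\<xi> \<eta> n. \<xi> n <#>\<^bsub>G\<^esub> \<eta> n), one = \<Gamma>\<rparr>"


section \<open>Toeplitz arrays\<close>

definition full_shift :: "('a, 'b) monoid_scheme \<Rightarrow> ('a \<Rightarrow> nat) topology" where
  "full_shift G = product_topology (\<lambda>_. discrete_topology {0, 1}) (carrier G)"

definition shift_action :: "('a, 'b) monoid_scheme \<Rightarrow> 'a \<Rightarrow> ('a \<Rightarrow> nat) \<Rightarrow> ('a \<Rightarrow> nat)" where
  "shift_action G g x = (\<lambda>h\<in>carrier G. x (h \<otimes>\<^bsub>G\<^esub> g))"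

definition orbit_closure :: "('a, 'b) monoid_scheme \<Rightarrow> ('a \<Rightarrow> nat) \<Rightarrow> ('a \<Rightarrow> nat) set" where
  "orbit_closure G x = full_shift G closure_of ((\<lambda>g. shift_action G g x) ` carrier G)"

definition orbit_closure_top :: "('a, 'b) monoid_scheme \<Rightarrow> ('a \<Rightarrow> nat) \<Rightarrow> ('a \<Rightarrow> nat) topology" where
  "orbit_closure_top G x = subtopology (full_shift G) (orbit_closure G x)"

definition toeplitz :: "('a, 'b) monoid_scheme \<Rightarrow> ('a \<Rightarrow> nat) \<Rightarrow> bool" where
  "toeplitz G x \<longleftrightarrow>
     x \<in> topspace (full_shift G) \<and>
     (\<forall>g\<in>carrier G. \<exists>H. finite_index_subgroup G H \<and> (\<forall>\<gamma>\<in>H. x (g \<otimes>\<^bsub>G\<^esub> \<gamma>) = x g))"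

text \<open>The maximal equicontinuous factor of a Toeplitz subshift is an odometer whose subgroups
  \<open>\<Gamma> n\<close> need not be normal. It is unique up to isomorphism and uniquely ergodic, so the universal
  quantifier over its realizations \<open>\<Gamma>\<close>, \<open>\<pi>\<close>, \<open>\<nu>\<close> could be replaced by an existential one.\<close>

definition regular_toeplitz :: "('a, 'b) monoid_scheme \<Rightarrow> ('a \<Rightarrow> nat) \<Rightarrow> bool" where
  "regular_toeplitz G x \<longleftrightarrow>
     toeplitz G x \<and>
     (\<forall>\<Gamma> \<pi> \<nu>.
        odometer_sequence G \<Gamma> \<and>
        max_equicontinuous_factor G (orbit_closure_top G x) (shift_action G)
          (odometer_top G \<Gamma>) (odometer_action G) \<pi> \<and>
        invariant_probability G (odometer_top G \<Gamma>) (odometer_action G) \<nu> \<longrightarrow>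
        emeasure \<nu> (\<pi> ` {y \<in> orbit_closure G x. toeplitz G y}) = 1)"

definition irregular_toeplitz :: "('a, 'b) monoid_scheme \<Rightarrow> ('a \<Rightarrow> nat) \<Rightarrow> bool" where
  "irregular_toeplitz G x \<longleftrightarrow> toeplitz G x \<and> \<not> regular_toeplitz G x"

end

theory Submission
  imports Defs
begin

text \<open>The array is built over the odometer. Above a point \<open>\<xi>\<close> of the odometer the positions of the
group split into those whose symbol is dictated by \<open>\<xi>\<close> and the free ones. A position \<open>h\<close> is free
when \<open>h \<xi>\<close> lies in a closed set \<open>D\<close> of positive Haar measure and empty interior, the intersection of
the closures of a decreasing sequence of periodic subsets \<open>U n\<close> of the group: the holes that are
left open after \<open>n\<close> steps of the construction. The holes are filled in such a way that only the
following patterns survive on the free positions above \<open>\<xi>\<close> (\<open>X_cases\<close>, \<open>fiber_eq\<close>): \<open>k\<close> patterns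
that record the visits of \<open>\<xi>\<close> to \<open>D \<inter> W j\<close>, where \<open>W 0\<close> is empty and the other \<open>W j\<close> are different
cosets; and the patterns that have a single \<open>1\<close>, at an arbitrary free position. So all fibers are
countable, and a fiber is infinite as soon as there are infinitely many free positions, which
happens almost surely because the number of free positions is invariant and has infinite mean
(\<open>AE_infinite_aper\<close>).

The patterns of the first kind are \<open>k\<close> equivariant Borel sections of the factor map. They transport
the Haar measure to \<open>k\<close> different ergodic measures, each isomorphic to it. The patterns
of the second kind are negligible for every invariant probability: the position of the
single \<open>1\<close> would be an equivariant random choice of one element of an infinite group
(\<open>null_if_disjoint_translates\<close>). Hence there are no other ergodic measures
(\<open>ergodic_is_filling_measure\<close>).

Amenability is what makes such a filling possible. After each step the holes are divided
into cells of bounded size, and two holes whose quotient lies in a prescribed finite set share a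
cell. A step closes some entire cells, each with one of the admissible patterns, and the surviving
cells are only ever merged. A fixed finite window therefore meets a single cell at every late step, and
shows one of the admissible patterns (\<open>patterns\<close>); conversely every pattern is eventually used on
a translate of each cell (\<open>realized\<close>). To separate the cells from each other one closes all cells that meet a
cut set of small density. Tilings are not needed for the cut: in a finite quotient, averaging over all
translates of a Folner set gives, for every nonempty set \<open>A\<close>, a translate whose trace on
\<open>A\<close> has a small boundary; remove this trace and repeat (\<open>finite_group_cut\<close>, \<open>folner_cut\<close>).

A step that writes a single \<open>1\<close> writes it on exactly one coset, and this makes the point
of the odometer readable from finite windows (\<open>recognizable\<close>), so that the odometer is a factor of
the orbit closure. Two points of a fiber become arbitrarily close near the base point, which has no
free position; therefore every equicontinuous factor collapses the fibers, and the odometer is the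
maximal one. A Toeplitz point cannot lie above a point with free positions
(\<open>toeplitz_aper_empty\<close>), and the points without free positions form a null set; this is the
irregularity.\<close>

section \<open>Cutting finite groups into small pieces\<close>

lemma (in group) mult_inv_cancel:
  assumes "g \<in> carrier G" "x \<in> carrier G"
  shows "g \<otimes> (inv g \<otimes> x) = x" "inv g \<otimes> (g \<otimes> x) = x"
  using assms by (simp_all flip: m_assoc)

lemma (in group) inv_eq_imp_eq: "x \<in> carrier G \<Longrightarrow> y \<in> carrier G \<Longrightarrow> inv x = inv y \<Longrightarrow> x = y"
  by (metis inv_inv)

lemma (in group) sum_card_translates_Int:
  assumes fin: "finite (carrier G)" and F: "F \<subseteq> carrier G" and A: "A \<subseteq> carrier G"
  shows "(\<Sum>c\<in>carrier G. card ((F #> c) \<inter> A)) = card F * card A"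
proof -
  have finA: "finite A" and finF: "finite F"
    using finite_subset[OF A fin] finite_subset[OF F fin] by simp_all
  have centres: "card {c \<in> carrier G. a \<in> F #> c} = card F" if a: "a \<in> A" for a
  proof -
    have aG: "a \<in> carrier G" using a A by auto
    have "{c \<in> carrier G. a \<in> F #> c} = (\<lambda>f. inv f \<otimes> a) ` F"
    proof (intro equalityI subsetI)
      fix c assume "c \<in> {c \<in> carrier G. a \<in> F #> c}"
      then obtain f where f: "f \<in> F" "a = f \<otimes> c" and c: "c \<in> carrier G"
        unfolding r_coset_def by blast
      have "f \<in> carrier G" using f F by blast
      then have "c = inv f \<otimes> a" unfolding f(2) using c by (simp add: mult_inv_cancel)
      then show "c \<in> (\<lambda>f. inv f \<otimes> a) ` F" using f(1) by (rule image_eqI)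
    next
      fix c assume "c \<in> (\<lambda>f. inv f \<otimes> a) ` F"
      then obtain f where f: "f \<in> F" "c = inv f \<otimes> a" by auto
      then have fG: "f \<in> carrier G" using F by auto
      have c: "c \<in> carrier G" unfolding f(2) using fG aG by simp
      have a: "a = f \<otimes> c" unfolding f(2) using fG aG by (simp add: mult_inv_cancel)
      have "a \<in> F #> c" unfolding a r_coset_def using f(1) by blast
      with c show "c \<in> {c \<in> carrier G. a \<in> F #> c}" by blast
    qed
    moreover have "inj_on (\<lambda>f. inv f \<otimes> a) F"
    proof (rule inj_onI)
      fix x y assume xy: "x \<in> F" "y \<in> F" "inv x \<otimes> a = inv y \<otimes> a"
      then have G: "x \<in> carrier G" "y \<in> carrier G" using F by blast+
      then have "inv x = inv y" using xy(3) aG right_cancel by simp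
      then show "x = y" using G inv_eq_imp_eq by blast
    qed
    ultimately show ?thesis
      by (simp add: card_image)
  qed
  have "(\<Sum>c\<in>carrier G. card ((F #> c) \<inter> A))
      = (\<Sum>c\<in>carrier G. \<Sum>a\<in>A. of_bool (a \<in> F #> c))"
    using finA by (intro sum.cong refl) (simp add: Int_def conj_commute)
  also have "\<dots> = (\<Sum>a\<in>A. \<Sum>c\<in>carrier G. of_bool (a \<in> F #> c))"
    by (rule sum.swap)
  also have "\<dots> = (\<Sum>a\<in>A. card {c \<in> carrier G. a \<in> F #> c})"
    using fin by (intro sum.cong refl) (simp add: Int_def)
  also have "\<dots> = card F * card A"
    using centres by simp
  finally show ?thesis .
qed

text \<open>The cut is found greedily. By double counting, the translates of the boundary \<open>B\<close> meet \<open>A\<close> on average in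
at most \<open>e\<close> times as many points as the translates of \<open>F\<close>; so one of the translates of \<open>F\<close> that meet \<open>A\<close>
does no worse than that. Its trace on \<open>A\<close> becomes a piece, the boundary of the piece goes to \<open>Z\<close>, and
the argument continues with the rest of \<open>A\<close>. The function
\<open>c\<close> gives the centre of the piece of a point. The last clause holds because the
centre of a point \<open>g\<close> is the first chosen one whose translate contains \<open>g\<close>.\<close>

lemma (in group) finite_group_cut:
  fixes e :: real
  assumes fin: "finite (carrier G)" and F: "F \<subseteq> carrier G" and BF: "B \<subseteq> F" and ne: "F \<noteq> {}"
    and small: "real (card B) \<le> e * real (card F)" and A: "A \<subseteq> carrier G"
  shows "\<exists>Z c. Z \<subseteq> A \<and> real (card Z) \<le> e * real (card A) \<and>
     (\<forall>g\<in>A - Z. c g \<in> carrier G \<and> g \<in> (F - B) #> c g) \<and>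
     (\<forall>g\<in>A - Z. \<forall>g'\<in>A - Z. g' \<in> F #> c g \<and> g \<in> F #> c g' \<longrightarrow> c g = c g')"
proof -
  have "finite A" using A fin finite_subset by blast
  then show ?thesis using A
  proof (induction A rule: finite_psubset_induct)
    case (psubset A)
    have finA: "finite A" by fact
    show ?case
    proof (cases "A = {}")
      case True
      then show ?thesis by auto
    next
      case False
      have B: "B \<subseteq> carrier G" using BF F by auto
      have finF: "finite F" using F fin finite_subset by blast
      have "\<exists>c\<in>carrier G. (F #> c) \<inter> A \<noteq> {} \<and>
              real (card ((B #> c) \<inter> A)) \<le> e * real (card ((F #> c) \<inter> A))"
      proof (rule ccontr)
        assume neg0: "\<not> ?thesis"
        have neg: "e * real (card ((F #> c) \<inter> A)) < real (card ((B #> c) \<inter> A))"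
          if "c \<in> carrier G" "(F #> c) \<inter> A \<noteq> {}" for c
          using neg0 that not_le by blast
        have BsubF: "(B #> c) \<subseteq> (F #> c)" for c
          using BF by (auto simp: r_coset_def)
        have le: "e * real (card ((F #> c) \<inter> A)) \<le> real (card ((B #> c) \<inter> A))"
          if "c \<in> carrier G" for c
          using neg[OF that] by (cases "(F #> c) \<inter> A = {}") (auto simp: less_imp_le)
        obtain a f where a: "a \<in> A" and f: "f \<in> F" using False ne by auto
        let ?c = "inv f \<otimes> a"
        have c: "?c \<in> carrier G" using a f psubset.prems F by auto
        have "f \<otimes> ?c = a" using a f psubset.prems F by (auto simp: mult_inv_cancel subset_iff)
        moreover have "f \<otimes> ?c \<in> F #> ?c" using f by (auto simp: r_coset_def)
        ultimately have "a \<in> (F #> ?c) \<inter> A" using a by simp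
        then have lt: "e * real (card ((F #> ?c) \<inter> A)) < real (card ((B #> ?c) \<inter> A))"
          using neg[OF c] by blast
        have "(\<Sum>c\<in>carrier G. e * real (card ((F #> c) \<inter> A)))
            < (\<Sum>c\<in>carrier G. real (card ((B #> c) \<inter> A)))"
          using fin le lt c by (intro sum_strict_mono_ex1) auto
        also have "\<dots> = real (card B * card A)"
          unfolding sum_card_translates_Int[OF fin B psubset.prems, symmetric] by simp
        also have "(\<Sum>c\<in>carrier G. e * real (card ((F #> c) \<inter> A))) = e * real (card F * card A)"
          unfolding sum_card_translates_Int[OF fin F psubset.prems, symmetric]
          by (simp add: sum_distrib_left)
        finally have "(e * real (card F)) * real (card A) < real (card B) * real (card A)"
          by (simp add: mult.assoc)
        then show False using small by (simp add: mult_less_cancel_right)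
      qed
      then obtain d where d: "d \<in> carrier G" "(F #> d) \<inter> A \<noteq> {}"
        and d_le: "real (card ((B #> d) \<inter> A)) \<le> e * real (card ((F #> d) \<inter> A))" by auto
      define A' where "A' = A - (F #> d)"
      have "A' \<subset> A" and A'G: "A' \<subseteq> carrier G"
        using d psubset.prems by (auto simp: A'_def)
      from psubset.IH[OF this] obtain Z' c' where IH: "Z' \<subseteq> A' \<and>
          real (card Z') \<le> e * real (card A') \<and>
          (\<forall>g\<in>A' - Z'. c' g \<in> carrier G \<and> g \<in> (F - B) #> c' g) \<and>
          (\<forall>g\<in>A' - Z'. \<forall>g'\<in>A' - Z'. g' \<in> F #> c' g \<and> g \<in> F #> c' g' \<longrightarrow> c' g = c' g')"
        by (elim exE)
      then have Z': "Z' \<subseteq> A'" and Z'_le: "real (card Z') \<le> e * real (card A')"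
        and c': "\<And>g. g \<in> A' - Z' \<Longrightarrow> c' g \<in> carrier G \<and> g \<in> (F - B) #> c' g"
        and sep: "\<And>g g'. \<lbrakk>g \<in> A' - Z'; g' \<in> A' - Z'; g' \<in> F #> c' g; g \<in> F #> c' g'\<rbrakk>
            \<Longrightarrow> c' g = c' g'"
        by blast+
      define Z where "Z = Z' \<union> ((B #> d) \<inter> A)"
      define c where "c = (\<lambda>g. if g \<in> F #> d then d else c' g)"
      have "Z \<subseteq> A" using Z' by (auto simp: Z_def A'_def)
      moreover have "real (card Z) \<le> e * real (card A)"
      proof -
        have "real (card Z) \<le> real (card Z') + real (card ((B #> d) \<inter> A))"
          unfolding Z_def using card_Un_le[of Z' "(B #> d) \<inter> A"] by linarith
        also have "\<dots> \<le> e * (real (card A') + real (card ((F #> d) \<inter> A)))"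
          using Z'_le d_le by (simp add: distrib_left)
        also have "real (card A') + real (card ((F #> d) \<inter> A)) = real (card A)"
        proof -
          have "card A = card (A' \<union> ((F #> d) \<inter> A))"
            by (rule arg_cong[of _ _ card]) (auto simp: A'_def)
          also have "\<dots> = card A' + card ((F #> d) \<inter> A)"
            using finA by (intro card_Un_disjoint) (auto simp: A'_def)
          finally show ?thesis by simp
        qed
        finally show ?thesis .
      qed
      moreover have "\<forall>g\<in>A - Z. c g \<in> carrier G \<and> g \<in> (F - B) #> c g"
      proof
        fix g assume that: "g \<in> A - Z"
        show "c g \<in> carrier G \<and> g \<in> (F - B) #> c g"
        proof (cases "g \<in> F #> d")
          case True
          then show ?thesis using that d by (auto simp: c_def Z_def r_coset_def)
        next
          case False
          then show ?thesis using that c'[of g] by (auto simp: c_def Z_def A'_def)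
        qed
      qed
      moreover have "\<forall>g\<in>A - Z. \<forall>g'\<in>A - Z. g' \<in> F #> c g \<and> g \<in> F #> c g' \<longrightarrow> c g = c g'"
      proof (intro ballI impI, elim conjE)
        fix g g' assume that: "g \<in> A - Z" "g' \<in> A - Z" "g' \<in> F #> c g" "g \<in> F #> c g'"
        have "g \<in> A' - Z'" if "g \<notin> F #> d" "g \<in> A - Z" for g
          using that by (auto simp: Z_def A'_def)
        then show "c g = c g'"
          using that sep[of g g'] unfolding c_def by (cases "g \<in> F #> d"; cases "g' \<in> F #> d") simp_all
      qed
      ultimately show ?thesis by (intro exI[of _ Z] exI[of _ c] conjI)
    qed
  qed
qed

section \<open>Cosets and periodic sets\<close>

locale free_odometer = group G for G :: "('a, 'b) monoid_scheme" (structure) +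
  fixes \<Gamma> :: "nat \<Rightarrow> 'a set"
  assumes countable_carrier: "countable (carrier G)"
    and infinite_carrier: "infinite (carrier G)"
    and amenable_G: "amenable G"
    and odometer_seq: "odometer_sequence G \<Gamma>"
    and normal_G: "\<And>n. \<Gamma> n \<lhd> G"
    and free_G: "(\<Inter>n. \<Gamma> n) = {\<one>}"
begin

lemma subgroup_Gam: "subgroup (\<Gamma> n) G"
  using normal_G normal_imp_subgroup by blast

lemma Gam_carrier: "g \<in> \<Gamma> n \<Longrightarrow> g \<in> carrier G"
  using subgroup.mem_carrier[OF subgroup_Gam] .

lemma Gam_one [simp]: "\<one> \<in> \<Gamma> n"
  using subgroup.one_closed[OF subgroup_Gam] .

lemma Gam_mult: "g \<in> \<Gamma> n \<Longrightarrow> h \<in> \<Gamma> n \<Longrightarrow> g \<otimes> h \<in> \<Gamma> n"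
  using subgroup.m_closed[OF subgroup_Gam] .

lemma Gam_inv: "g \<in> \<Gamma> n \<Longrightarrow> inv g \<in> \<Gamma> n"
  using subgroup.m_inv_closed[OF subgroup_Gam] .

lemma Gam_antimono: "m \<le> n \<Longrightarrow> \<Gamma> n \<subseteq> \<Gamma> m"
  by (rule lift_Suc_antimono_le[of \<Gamma>]) (use odometer_seq in \<open>auto simp: odometer_sequence_def\<close>)

lemma Gam_conj: "g \<in> \<Gamma> n \<Longrightarrow> h \<in> carrier G \<Longrightarrow> h \<otimes> g \<otimes> inv h \<in> \<Gamma> n"
  using normal.inv_op_closed2[OF normal_G] by blast

lemma Gam_conj': "g \<in> \<Gamma> n \<Longrightarrow> h \<in> carrier G \<Longrightarrow> inv h \<otimes> g \<otimes> h \<in> \<Gamma> n"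
  using normal.inv_op_closed1[OF normal_G] by blast

abbreviation coset :: "nat \<Rightarrow> 'a \<Rightarrow> 'a set" where
  "coset n g \<equiv> g <# \<Gamma> n"

lemma mem_coset_iff: "g \<in> carrier G \<Longrightarrow> h \<in> coset n g \<longleftrightarrow> h \<in> carrier G \<and> inv g \<otimes> h \<in> \<Gamma> n"
proof
  assume g: "g \<in> carrier G"
  { assume "h \<in> coset n g"
    then obtain c where c: "c \<in> \<Gamma> n" "h = g \<otimes> c" unfolding l_coset_def by blast
    then show "h \<in> carrier G \<and> inv g \<otimes> h \<in> \<Gamma> n"
      using g Gam_carrier[OF c(1)] by (simp add: mult_inv_cancel) }
  { assume h: "h \<in> carrier G \<and> inv g \<otimes> h \<in> \<Gamma> n"
    then have "g \<otimes> (inv g \<otimes> h) = h" using g by (simp add: mult_inv_cancel)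
    then show "h \<in> coset n g" using h unfolding l_coset_def by blast }
qed

lemma coset_carrier: "g \<in> carrier G \<Longrightarrow> h \<in> coset n g \<Longrightarrow> h \<in> carrier G"
  by (simp add: mem_coset_iff)

lemma self_in_coset [simp]: "g \<in> carrier G \<Longrightarrow> g \<in> coset n g"
  by (simp add: mem_coset_iff)

lemma coset_mult: "g \<in> carrier G \<Longrightarrow> c \<in> \<Gamma> n \<Longrightarrow> g \<otimes> c \<in> coset n g"
  by (auto simp: l_coset_def)

lemma coset_eq_iff: "g \<in> carrier G \<Longrightarrow> h \<in> carrier G \<Longrightarrow> coset n g = coset n h \<longleftrightarrow> h \<in> coset n g"
proof
  assume G: "g \<in> carrier G" "h \<in> carrier G"
  show "coset n g = coset n h \<Longrightarrow> h \<in> coset n g" using G(2) self_in_coset by blast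
  show "h \<in> coset n g \<Longrightarrow> coset n g = coset n h"
    using l_repr_independence[OF _ G(1) subgroup_Gam] .
qed

lemma coset_eqI: "g \<in> carrier G \<Longrightarrow> h \<in> coset n g \<Longrightarrow> coset n h = coset n g"
  using coset_eq_iff[of g h n] coset_carrier[of g h n] by blast

lemma coset_sym: "g \<in> carrier G \<Longrightarrow> h \<in> coset n g \<Longrightarrow> g \<in> coset n h"
  using coset_eqI[of g h n] self_in_coset[of g n] by simp

lemma coset_antimono: "m \<le> n \<Longrightarrow> coset n g \<subseteq> coset m g"
  using Gam_antimono by (auto simp: l_coset_def)

lemma coset_left_mult: "h \<in> carrier G \<Longrightarrow> g \<in> carrier G \<Longrightarrow> h <# coset n g = coset n (h \<otimes> g)"
  using lcos_m_assoc[OF subgroup.subset[OF subgroup_Gam]] .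

text \<open>Because \<open>\<Gamma> n\<close> is normal, changing a factor in the middle of a product by an element of
  \<open>\<Gamma> n\<close> does not change the coset of the product.\<close>

lemma coset_right_mem:
  assumes "h \<in> carrier G" "g \<in> carrier G" "c \<in> \<Gamma> n"
  shows "h \<otimes> c \<otimes> g \<in> coset n (h \<otimes> g)"
proof -
  have "h \<otimes> c \<otimes> g = h \<otimes> g \<otimes> (inv g \<otimes> c \<otimes> g)"
    using assms Gam_carrier by (simp add: m_assoc mult_inv_cancel)
  then show ?thesis
    using assms Gam_conj' coset_mult by auto
qed

lemma finite_lcosets: "finite (lcosets (\<Gamma> n))"
proof -
  have "lcosets (\<Gamma> n) = rcosets (\<Gamma> n)"
    using normal.coset_eq[OF normal_G] by (auto simp: LCOSETS_def RCOSETS_def)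
  then show ?thesis
    using odometer_seq by (auto simp: odometer_sequence_def finite_index_subgroup_def)
qed

lemma lcosets_eq: "lcosets (\<Gamma> n) = coset n ` carrier G"
  unfolding LCOSETS_def by blast

definition q :: "nat \<Rightarrow> nat" where "q n = card (lcosets (\<Gamma> n))"

lemma q_pos: "q n > 0"
  unfolding q_def card_gt_0_iff using finite_lcosets[of n] lcosets_eq[of n] carrier_not_empty by simp

lemma finite_avoids_Gam:
  assumes "finite S" "S \<subseteq> carrier G"
  shows "\<exists>n. \<forall>m\<ge>n. S \<inter> \<Gamma> m \<subseteq> {\<one>}"
proof -
  have "\<exists>f. \<forall>s\<in>S - {\<one>}. s \<notin> \<Gamma> (f s)"
  proof -
    have "\<forall>s\<in>S - {\<one>}. \<exists>n. s \<notin> \<Gamma> n" using free_G by blast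
    then show ?thesis by (rule bchoice)
  qed
  then obtain f where f: "\<And>s. s \<in> S \<Longrightarrow> s \<noteq> \<one> \<Longrightarrow> s \<notin> \<Gamma> (f s)" by auto
  define n where "n = Max (insert 0 (f ` S))"
  have "f s \<le> n" if "s \<in> S" for s using that assms by (auto simp: n_def)
  then have "\<forall>m\<ge>n. S \<inter> \<Gamma> m \<subseteq> {\<one>}"
    using f Gam_antimono by (blast intro: order_trans)
  then show ?thesis by blast
qed

text \<open>Finite sets of representatives turn statements about cosets into statements about finite windows.\<close>

lemma finite_transversal:
  "\<exists>T. finite T \<and> T \<subseteq> carrier G \<and> (\<forall>g\<in>carrier G. \<exists>t\<in>T. t \<in> coset n g)"
proof -
  have "\<forall>c\<in>lcosets (\<Gamma> n). \<exists>t. t \<in> c \<and> t \<in> carrier G"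
    by (auto simp: lcosets_eq intro: self_in_coset)
  then obtain r where r: "\<And>c. c \<in> lcosets (\<Gamma> n) \<Longrightarrow> r c \<in> c \<and> r c \<in> carrier G" by metis
  then show ?thesis
    using finite_lcosets[of n]
    by (intro exI[of _ "r ` (lcosets (\<Gamma> n))"]) (auto simp: lcosets_eq)
qed

lemma q_unbounded: "\<exists>n. \<forall>m\<ge>n. q m \<ge> N"
proof -
  obtain S where S: "finite S" "card S = N" "S \<subseteq> carrier G"
    using infinite_arbitrarily_large[OF infinite_carrier] by blast
  define D where "D = (\<lambda>(a,b). inv a \<otimes> b) ` (S \<times> S)"
  have "finite D" "D \<subseteq> carrier G" using S by (auto simp: D_def)
  then obtain n where n: "\<And>m. m \<ge> n \<Longrightarrow> D \<inter> \<Gamma> m \<subseteq> {\<one>}" using finite_avoids_Gam by metis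
  have "N \<le> q m" if "m \<ge> n" for m
  proof -
    have "inj_on (coset m) S"
    proof (rule inj_onI)
      fix a b assume ab: "a \<in> S" "b \<in> S" "coset m a = coset m b"
      then have G: "a \<in> carrier G" "b \<in> carrier G" using S by auto
      then have "inv a \<otimes> b \<in> \<Gamma> m" using ab by (metis mem_coset_iff self_in_coset)
      then have "inv a \<otimes> b = \<one>" using n[OF that] ab by (auto simp: D_def)
      then show "a = b" using G by (metis inv_equality inv_closed inv_inv)
    qed
    then have "card S = card (coset m ` S)" by (simp add: card_image)
    also have "\<dots> \<le> q m"
      unfolding q_def lcosets_eq using S finite_lcosets[of m] by (intro card_mono) (auto simp: lcosets_eq)
    finally show ?thesis using S by simp
  qed
  then show ?thesis by blast
qed

definition periodic :: "nat \<Rightarrow> 'a set \<Rightarrow> bool" where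
  "periodic n A \<longleftrightarrow> A \<subseteq> carrier G \<and> (\<forall>g\<in>A. \<forall>c\<in>\<Gamma> n. g \<otimes> c \<in> A)"

lemma periodicI:
  "\<lbrakk>A \<subseteq> carrier G; \<And>g c. g \<in> A \<Longrightarrow> c \<in> \<Gamma> n \<Longrightarrow> g \<otimes> c \<in> A\<rbrakk> \<Longrightarrow> periodic n A"
  unfolding periodic_def by simp

lemma periodic_carrier: "periodic n A \<Longrightarrow> g \<in> A \<Longrightarrow> g \<in> carrier G"
  unfolding periodic_def by auto

lemma periodic_mult: "periodic n A \<Longrightarrow> g \<in> A \<Longrightarrow> c \<in> \<Gamma> n \<Longrightarrow> g \<otimes> c \<in> A"
  unfolding periodic_def by simp

lemma periodic_coset_subset: "periodic n A \<Longrightarrow> g \<in> A \<Longrightarrow> coset n g \<subseteq> A"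
  unfolding periodic_def l_coset_def by auto

lemma periodic_mem_iff:
  assumes "periodic n A" "g \<in> carrier G" "h \<in> coset n g"
  shows "h \<in> A \<longleftrightarrow> g \<in> A"
proof
  show "g \<in> A \<Longrightarrow> h \<in> A" using periodic_coset_subset[OF assms(1)] assms(3) by auto
  show "h \<in> A \<Longrightarrow> g \<in> A"
    using periodic_coset_subset[OF assms(1), of h] coset_sym[OF assms(2,3)] by auto
qed

lemma periodic_mult_iff:
  "periodic n A \<Longrightarrow> g \<in> carrier G \<Longrightarrow> c \<in> \<Gamma> n \<Longrightarrow> g \<otimes> c \<in> A \<longleftrightarrow> g \<in> A"
  by (rule periodic_mem_iff[OF _ _ coset_mult])

lemma periodic_antimono: "periodic m A \<Longrightarrow> m \<le> n \<Longrightarrow> periodic n A"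
  using Gam_antimono[of m n] by (intro periodicI) (auto dest: periodic_carrier subsetD intro: periodic_mult)

lemma periodic_Diff: "periodic n A \<Longrightarrow> periodic n B \<Longrightarrow> periodic n (A - B)"
  by (intro periodicI) (metis DiffE periodic_carrier subsetI, metis DiffE DiffI periodic_mult periodic_mult_iff periodic_carrier)

lemma periodic_Int: "periodic n A \<Longrightarrow> periodic n B \<Longrightarrow> periodic n (A \<inter> B)"
  by (intro periodicI) (auto dest: periodic_carrier intro: periodic_mult)

lemma periodic_Un: "periodic n A \<Longrightarrow> periodic n B \<Longrightarrow> periodic n (A \<union> B)"
  by (intro periodicI) (auto dest: periodic_carrier intro: periodic_mult)

lemma periodic_coset:
  assumes g: "g \<in> carrier G"
  shows "periodic n (coset n g)"
proof (rule periodicI)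
  show "coset n g \<subseteq> carrier G" using coset_carrier[OF g] by auto
  fix h c assume h: "h \<in> coset n g" and c: "c \<in> \<Gamma> n"
  then have "h \<otimes> c \<in> coset n h" using coset_carrier[OF g h] by (intro coset_mult)
  then show "h \<otimes> c \<in> coset n g" using coset_eqI[OF g h] by simp
qed

end

context free_odometer
begin

lemma coset_cancel_left:
  assumes "s \<in> carrier G" "x \<in> carrier G" "coset m (s \<otimes> x) = coset m x"
  shows "s \<in> \<Gamma> m"
proof -
  have "s \<otimes> x \<in> coset m x" using assms self_in_coset[of "s \<otimes> x" m] by simp
  then have "inv x \<otimes> (s \<otimes> x) \<in> \<Gamma> m" using assms mem_coset_iff[of x "s \<otimes> x" m] by simp
  then have "x \<otimes> (inv x \<otimes> (s \<otimes> x)) \<otimes> inv x \<in> \<Gamma> m" using assms Gam_conj by blast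
  then show ?thesis using assms by (simp add: mult_inv_cancel m_assoc)
qed

lemma folner_set:
  fixes e :: real
  assumes K: "finite K" "K \<subseteq> carrier G" and e: "e > 0"
  obtains F where "finite F" "F \<noteq> {}" "F \<subseteq> carrier G"
    "real (card {f \<in> F. \<exists>b\<in>K. b \<otimes> f \<notin> F}) \<le> e * real (card F)"
proof -
  obtain \<Phi> :: "nat \<Rightarrow> 'a set" where \<Phi>: "\<And>n. finite (\<Phi> n) \<and> \<Phi> n \<noteq> {} \<and> \<Phi> n \<subseteq> carrier G"
    and lim: "\<And>g. g \<in> carrier G \<Longrightarrow> (\<lambda>n. real (card (((g <# \<Phi> n) - \<Phi> n) \<union> (\<Phi> n - (g <# \<Phi> n))))
        / real (card (\<Phi> n))) \<longlonglongrightarrow> 0"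
    using amenable_G unfolding amenable_def by blast
  define d where "d = e / (real (card K) + 1)"
  have d: "d > 0" using e by (simp add: d_def)
  have "\<forall>\<^sub>F n in sequentially. \<forall>b\<in>K. real (card (((b <# \<Phi> n) - \<Phi> n) \<union> (\<Phi> n - (b <# \<Phi> n))))
        / real (card (\<Phi> n)) < d"
    using K d lim by (intro eventually_ball_finite ballI order_tendstoD(2)[OF lim]) auto
  then obtain n where n: "\<And>b. b \<in> K \<Longrightarrow> real (card (((b <# \<Phi> n) - \<Phi> n) \<union> (\<Phi> n - (b <# \<Phi> n))))
        / real (card (\<Phi> n)) < d"
    by (auto simp: eventually_sequentially)
  define F where "F = \<Phi> n"
  have F: "finite F" "F \<noteq> {}" "F \<subseteq> carrier G" using \<Phi>[of n] by (simp_all add: F_def)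
  then have cF: "real (card F) > 0" by (simp add: card_gt_0_iff)
  have one: "real (card {f \<in> F. b \<otimes> f \<notin> F}) \<le> d * real (card F)" if b: "b \<in> K" for b
  proof -
    have bG: "b \<in> carrier G" using b K by auto
    have fin: "finite (((b <# F) - F) \<union> (F - (b <# F)))"
      using F by (simp add: l_coset_def)
    have "inj_on (\<lambda>f. b \<otimes> f) {f \<in> F. b \<otimes> f \<notin> F}"
      by (rule inj_on_subset[OF inj_on_cmult[OF bG]]) (use F in auto)
    then have "card {f \<in> F. b \<otimes> f \<notin> F} = card ((\<lambda>f. b \<otimes> f) ` {f \<in> F. b \<otimes> f \<notin> F})"
      by (simp add: card_image)
    also have "\<dots> \<le> card (((b <# F) - F) \<union> (F - (b <# F)))"
      using fin by (intro card_mono) (auto simp: l_coset_def)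
    finally have "real (card {f \<in> F. b \<otimes> f \<notin> F}) \<le> real (card (((b <# F) - F) \<union> (F - (b <# F))))"
      by simp
    also have "\<dots> \<le> d * real (card F)"
      using n[OF b] cF by (simp add: F_def[symmetric] pos_divide_less_eq)
    finally show ?thesis .
  qed
  have "{f \<in> F. \<exists>b\<in>K. b \<otimes> f \<notin> F} = (\<Union>b\<in>K. {f \<in> F. b \<otimes> f \<notin> F})" by blast
  then have "real (card {f \<in> F. \<exists>b\<in>K. b \<otimes> f \<notin> F}) \<le> (\<Sum>b\<in>K. real (card {f \<in> F. b \<otimes> f \<notin> F}))"
    using card_UN_le[OF K(1), of "\<lambda>b. {f \<in> F. b \<otimes> f \<notin> F}"] by (simp flip: of_nat_sum)
  also have "\<dots> \<le> (\<Sum>b\<in>K. d * real (card F))" using one by (rule sum_mono)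
  also have "\<dots> = (real (card K) * d) * real (card F)" by simp
  also have "\<dots> \<le> e * real (card F)"
    using e cF by (intro mult_right_mono) (simp_all add: d_def field_simps)
  finally show thesis using that F by blast
qed

text \<open>The cut of the quotient is lifted to the group. A piece of the quotient is covered by \<open>F\<close>, and for large
\<open>m\<close> neither \<open>F\<close> nor its \<open>K\<close>-neighbourhood is folded by the quotient map; hence the preimage of a
piece is a disjoint union of finite cells that are not joined by \<open>K\<close>. The cell of \<open>g\<close> is labelled by its
centre \<open>\<kappa> g\<close>, an element of the group itself and not only a coset.\<close>

lemma folner_cut:
  fixes e :: real
  assumes K: "finite K" "K \<subseteq> carrier G" and e: "e > 0"
  shows "\<exists>F n. finite F \<and> F \<subseteq> carrier G \<and>
    (\<forall>m\<ge>n. \<exists>Z \<kappa>. periodic m Z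
      \<and> real (card {c \<in> lcosets (\<Gamma> m). c \<inter> Z \<noteq> {}}) \<le> e * real (q m)
      \<and> (\<forall>g\<in>carrier G - Z. \<kappa> g \<in> carrier G \<and> (\<exists>f\<in>F. g = f \<otimes> \<kappa> g))
      \<and> (\<forall>g\<in>carrier G - Z. \<forall>c\<in>\<Gamma> m. \<kappa> (g \<otimes> c) = \<kappa> g \<otimes> c)
      \<and> (\<forall>b\<in>K. \<forall>g\<in>carrier G - Z. b \<otimes> g \<notin> Z \<longrightarrow> \<kappa> (b \<otimes> g) = \<kappa> g))"
proof -
  define K' where "K' = K \<union> (\<lambda>b. inv b) ` K"
  have K': "finite K'" "K' \<subseteq> carrier G" using K by (auto simp: K'_def)
  have K'inv: "b \<in> K \<Longrightarrow> inv b \<in> K'" "b \<in> K \<Longrightarrow> b \<in> K'" for b by (auto simp: K'_def)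
  obtain F where F: "finite F" "F \<noteq> {}" "F \<subseteq> carrier G"
    and bd: "real (card {f \<in> F. \<exists>b\<in>K'. b \<otimes> f \<notin> F}) \<le> e * real (card F)"
    using folner_set[OF K' e] .
  have FG: "f \<in> F \<Longrightarrow> f \<in> carrier G" for f using F by blast
  define B where "B = {f \<in> F. \<exists>b\<in>K'. b \<otimes> f \<notin> F}"
  define S where "S = (\<lambda>(f, f'). inv f \<otimes> f') ` (F \<times> F) \<union> (\<lambda>(f, b, f'). inv f' \<otimes> (b \<otimes> f)) ` (F \<times> K' \<times> F)"
  have "finite S" "S \<subseteq> carrier G" using F K' by (auto simp: S_def)
  then obtain n where n: "\<And>m. m \<ge> n \<Longrightarrow> S \<inter> \<Gamma> m \<subseteq> {\<one>}" using finite_avoids_Gam by meson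
  have "\<exists>Z \<kappa>. periodic m Z
      \<and> real (card {c \<in> lcosets (\<Gamma> m). c \<inter> Z \<noteq> {}}) \<le> e * real (q m)
      \<and> (\<forall>g\<in>carrier G - Z. \<kappa> g \<in> carrier G \<and> (\<exists>f\<in>F. g = f \<otimes> \<kappa> g))
      \<and> (\<forall>g\<in>carrier G - Z. \<forall>c\<in>\<Gamma> m. \<kappa> (g \<otimes> c) = \<kappa> g \<otimes> c)
      \<and> (\<forall>b\<in>K. \<forall>g\<in>carrier G - Z. b \<otimes> g \<notin> Z \<longrightarrow> \<kappa> (b \<otimes> g) = \<kappa> g)" if m: "m \<ge> n" for m
  proof -
    define Q where "Q = G Mod \<Gamma> m"
    interpret N: normal "\<Gamma> m" G by (rule normal_G)
    interpret Q: group Q unfolding Q_def by (rule N.factorgroup_is_group)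
    have r_l: "\<Gamma> m #> g = coset m g" if "g \<in> carrier G" for g
      using N.coset_eq that by blast
    have carQ: "carrier Q = lcosets (\<Gamma> m)"
      unfolding Q_def carrier_FactGroup lcosets_eq using r_l by (intro image_cong) simp_all
    have finQ: "finite (carrier Q)" using finite_lcosets carQ by simp
    have piQ: "coset m g \<in> carrier Q" if "g \<in> carrier G" for g using that carQ lcosets_eq by blast
    have multQ: "coset m g \<otimes>\<^bsub>Q\<^esub> coset m h = coset m (g \<otimes> h)"
      if "g \<in> carrier G" "h \<in> carrier G" for g h
      using N.rcos_sum[OF that] that r_l unfolding Q_def by simp
    have injF: "inj_on (coset m) F"
    proof (rule inj_onI)
      fix f f' assume f: "f \<in> F" "f' \<in> F" "coset m f = coset m f'"
      then have "f' \<in> coset m f" using self_in_coset[OF FG[OF f(2)]] by simp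
      then have "inv f \<otimes> f' \<in> \<Gamma> m" using mem_coset_iff[OF FG[OF f(1)]] by simp
      moreover have "inv f \<otimes> f' \<in> S" using f by (auto simp: S_def)
      ultimately have "inv f \<otimes> f' = \<one>" using n[OF m] by blast
      then have "f \<otimes> (inv f \<otimes> f') = f \<otimes> \<one>" by simp
      then show "f = f'" using FG f by (simp add: mult_inv_cancel)
    qed
    have "real (card (coset m ` B)) \<le> real (card B)"
      using F by (auto intro: card_image_le simp: B_def)
    also have "\<dots> \<le> e * real (card F)" using bd by (simp add: B_def)
    also have "card F = card (coset m ` F)" using injF by (simp add: card_image)
    finally have small: "real (card (coset m ` B)) \<le> e * real (card (coset m ` F))" .
    have sub: "coset m ` F \<subseteq> carrier Q" "coset m ` B \<subseteq> coset m ` F" "coset m ` F \<noteq> {}"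
      using F piQ by (auto simp: B_def)
    obtain ZQ cQ where cut: "ZQ \<subseteq> carrier Q \<and> real (card ZQ) \<le> e * real (card (carrier Q)) \<and>
     (\<forall>g\<in>carrier Q - ZQ. cQ g \<in> carrier Q \<and> g \<in> (coset m ` F - coset m ` B) #>\<^bsub>Q\<^esub> cQ g) \<and>
     (\<forall>g\<in>carrier Q - ZQ. \<forall>g'\<in>carrier Q - ZQ. g' \<in> (coset m ` F) #>\<^bsub>Q\<^esub> cQ g \<and> g \<in> (coset m ` F) #>\<^bsub>Q\<^esub> cQ g' \<longrightarrow> cQ g = cQ g')"
      using Q.finite_group_cut[OF finQ sub small subset_refl] by (elim exE)
    define Z where "Z = {g \<in> carrier G. coset m g \<in> ZQ}"
    define good where "good = (\<lambda>g f. f \<in> F \<and> f \<notin> B \<and> coset m (inv f \<otimes> g) = cQ (coset m g))"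
    \<comment> \<open>The choice depends only on the coset of \<open>g\<close>; this makes \<open>\<kappa>\<close> equivariant.\<close>
    define rep where "rep = (\<lambda>g. SOME f. good g f)"
    define \<kappa> where "\<kappa> = (\<lambda>g. inv (rep g) \<otimes> g)"
    have good: "good g (rep g)" if g: "g \<in> carrier G - Z" for g
    proof -
      have "coset m g \<in> carrier Q - ZQ" using g piQ by (auto simp: Z_def)
      then have cc: "cQ (coset m g) \<in> carrier Q"
        and "coset m g \<in> (coset m ` F - coset m ` B) #>\<^bsub>Q\<^esub> cQ (coset m g)"
        using cut by blast+
      then obtain f where f: "f \<in> F" "f \<notin> B" "coset m g = coset m f \<otimes>\<^bsub>Q\<^esub> cQ (coset m g)"
        unfolding r_coset_def by blast
      obtain x where x: "x \<in> carrier G" "cQ (coset m g) = coset m x"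
        using cc carQ lcosets_eq by blast
      have "coset m g = coset m (f \<otimes> x)" using f x multQ FG by simp
      then have "coset m (inv f) \<otimes>\<^bsub>Q\<^esub> coset m g = coset m (inv f) \<otimes>\<^bsub>Q\<^esub> coset m (f \<otimes> x)" by simp
      then have "coset m (inv f \<otimes> g) = coset m x"
        using g x FG[OF f(1)] by (simp add: multQ mult_inv_cancel)
      then have "good g f" using f x by (simp add: good_def)
      then show ?thesis unfolding rep_def by (rule someI)
    qed
    have perZ: "periodic m Z"
    proof (rule periodicI)
      show "Z \<subseteq> carrier G" by (auto simp: Z_def)
      fix g c assume g: "g \<in> Z" and c: "c \<in> \<Gamma> m"
      then have gG: "g \<in> carrier G" by (simp add: Z_def)
      have "coset m (g \<otimes> c) = coset m g" using coset_eqI[OF gG coset_mult[OF gG c]] .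
      then show "g \<otimes> c \<in> Z" using g c Gam_carrier by (simp add: Z_def)
    qed
    have "{c \<in> lcosets (\<Gamma> m). c \<inter> Z \<noteq> {}} \<subseteq> ZQ"
    proof
      fix c assume "c \<in> {c \<in> lcosets (\<Gamma> m). c \<inter> Z \<noteq> {}}"
      then obtain g h where gh: "g \<in> carrier G" "c = coset m g" "h \<in> c" "h \<in> Z"
        unfolding lcosets_eq by blast
      then have "c = coset m h" using coset_eqI[of g h m] by simp
      then show "c \<in> ZQ" using gh by (simp add: Z_def)
    qed
    then have "card {c \<in> lcosets (\<Gamma> m). c \<inter> Z \<noteq> {}} \<le> card ZQ"
      using cut finQ by (meson card_mono finite_subset)
    then have cardZ: "real (card {c \<in> lcosets (\<Gamma> m). c \<inter> Z \<noteq> {}}) \<le> e * real (q m)"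
      unfolding q_def carQ[symmetric] using cut by linarith
    have rG: "rep g \<in> F" "rep g \<in> carrier G" if "g \<in> carrier G - Z" for g
      using good[OF that] FG by (simp_all add: good_def)
    have cell: "\<kappa> g \<in> carrier G \<and> (\<exists>f\<in>F. g = f \<otimes> \<kappa> g)" if g: "g \<in> carrier G - Z" for g
    proof -
      have "rep g \<otimes> \<kappa> g = g" unfolding \<kappa>_def using rG[OF g] g by (simp add: mult_inv_cancel)
      moreover have "\<kappa> g \<in> carrier G" unfolding \<kappa>_def using rG[OF g] g by simp
      ultimately show ?thesis using rG(1)[OF g] by (metis (no_types))
    qed
    have equiv: "\<kappa> (g \<otimes> c) = \<kappa> g \<otimes> c" if g: "g \<in> carrier G - Z" and c: "c \<in> \<Gamma> m" for g c
    proof -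
      have gG: "g \<in> carrier G" using g by simp
      have cG: "c \<in> carrier G" using c Gam_carrier by simp
      have "coset m (g \<otimes> c) = coset m g" using coset_eqI[OF gG coset_mult[OF gG c]] .
      moreover have "coset m (inv f \<otimes> (g \<otimes> c)) = coset m (inv f \<otimes> g)" if "f \<in> F" for f
      proof -
        have i: "inv f \<otimes> g \<in> carrier G" using gG FG[OF that] by simp
        show ?thesis using coset_eqI[OF i coset_mult[OF i c]] gG cG FG[OF that] by (simp add: m_assoc)
      qed
      ultimately have "good (g \<otimes> c) = good g"
        unfolding good_def by (intro ext conj_cong) simp_all
      then show ?thesis using g cG rG[OF g] by (simp add: \<kappa>_def rep_def m_assoc)
    qed
    \<comment> \<open>Two neighbours have the same centre in the quotient, and since \<open>S\<close> avoids \<open>\<Gamma> m\<close> the same centre in the group.\<close>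
    have adj: "\<kappa> (b \<otimes> g) = \<kappa> g" if b: "b \<in> K" and g: "g \<in> carrier G - Z" and bg: "b \<otimes> g \<notin> Z" for b g
    proof -
      have bG: "b \<in> carrier G" using b K by auto
      have gG: "g \<in> carrier G" using g by simp
      have bg': "b \<otimes> g \<in> carrier G - Z" using bg bG gG by simp
      define f where "f = rep g" define f' where "f' = rep (b \<otimes> g)"
      have f: "f \<in> F" "f \<notin> B" "coset m (inv f \<otimes> g) = cQ (coset m g)"
        using good[OF g] by (simp_all add: good_def f_def)
      have f': "f' \<in> F" "f' \<notin> B" "coset m (inv f' \<otimes> (b \<otimes> g)) = cQ (coset m (b \<otimes> g))"
        using good[OF bg'] by (simp_all add: good_def f'_def)
      have fG: "f \<in> carrier G" "f' \<in> carrier G" using f f' FG by auto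
      have bf: "b \<otimes> f \<in> F" using f b K'inv by (auto simp: B_def)
      have bf': "inv b \<otimes> f' \<in> F" using f' b K'inv by (auto simp: B_def)
      have "coset m (b \<otimes> g) = coset m (b \<otimes> f) \<otimes>\<^bsub>Q\<^esub> cQ (coset m g)"
        unfolding f(3)[symmetric] using bG fG gG by (simp add: multQ m_assoc mult_inv_cancel)
      then have 1: "coset m (b \<otimes> g) \<in> (coset m ` F) #>\<^bsub>Q\<^esub> cQ (coset m g)"
        unfolding r_coset_def using bf by blast
      have "coset m g = coset m (inv b \<otimes> f') \<otimes>\<^bsub>Q\<^esub> cQ (coset m (b \<otimes> g))"
        unfolding f'(3)[symmetric] using bG fG gG by (simp add: multQ m_assoc mult_inv_cancel)
      then have 2: "coset m g \<in> (coset m ` F) #>\<^bsub>Q\<^esub> cQ (coset m (b \<otimes> g))"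
        unfolding r_coset_def using bf' by blast
      have "coset m g \<in> carrier Q - ZQ" "coset m (b \<otimes> g) \<in> carrier Q - ZQ"
        using g bg' piQ by (auto simp: Z_def)
      then have same: "cQ (coset m g) = cQ (coset m (b \<otimes> g))" using cut 1 2 by blast
      let ?s = "inv f' \<otimes> (b \<otimes> f)"
      have s: "?s \<otimes> (inv f \<otimes> g) = inv f' \<otimes> (b \<otimes> g)"
        using bG fG gG by (simp add: m_assoc mult_inv_cancel)
      have "?s \<in> \<Gamma> m"
        using bG fG gG same f(3) f'(3) s by (intro coset_cancel_left[of _ "inv f \<otimes> g"]) simp_all
      moreover have "?s \<in> S" unfolding S_def
        using f(1) f'(1) K'inv(2)[OF b] by (intro UnI2 rev_image_eqI[of "(f, b, f')"]) simp_all
      ultimately have "?s = \<one>" using n[OF m] by blast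
      then have "inv f \<otimes> g = inv f' \<otimes> (b \<otimes> g)" using s fG gG by simp
      then show ?thesis by (simp add: \<kappa>_def f_def f'_def)
    qed
    show ?thesis using perZ cardZ cell equiv adj by (intro exI[of _ Z] exI[of _ \<kappa>] conjI ballI impI) blast+
  qed
  then show ?thesis using F by (intro exI[of _ F] exI[of _ n]) simp
qed

end

section \<open>The odometer as a topological system\<close>

context free_odometer
begin

abbreviation Y where "Y \<equiv> odometer G \<Gamma>"
abbreviation YT where "YT \<equiv> odometer_top G \<Gamma>"
abbreviation act where "act \<equiv> odometer_action G"

lemma odometerI:
  assumes "\<And>n. \<xi> n \<in> lcosets (\<Gamma> n)" "\<And>n. \<xi> (Suc n) \<subseteq> \<xi> n"
  shows "\<xi> \<in> Y"
proof -
  have "\<exists>g. \<forall>n. g n \<in> carrier G \<and> \<xi> n = coset n (g n)"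
    using assms(1) unfolding lcosets_eq by (intro choice) blast
  then obtain g where g: "\<And>n. g n \<in> carrier G" "\<And>n. \<xi> n = coset n (g n)" by blast
  have "coset n (g (Suc n)) = coset n (g n)" for n
  proof -
    have "g (Suc n) \<in> coset n (g n)"
      using assms(2)[of n] self_in_coset[OF g(1), of "Suc n"] g(2) by auto
    then show ?thesis using coset_eqI[OF g(1)] by simp
  qed
  then show ?thesis unfolding odometer_def using g by blast
qed

lemma odometer_lcosets: "\<xi> \<in> Y \<Longrightarrow> \<xi> n \<in> lcosets (\<Gamma> n)"
  unfolding odometer_def lcosets_eq by auto

lemma odometer_Suc_subset: "\<xi> \<in> Y \<Longrightarrow> \<xi> (Suc n) \<subseteq> \<xi> n"
proof -
  assume "\<xi> \<in> Y"
  then obtain g where "\<xi> = (\<lambda>n. coset n (g n))" "coset n (g (Suc n)) = coset n (g n)"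
    unfolding odometer_def by blast
  then show ?thesis using coset_antimono[of n "Suc n" "g (Suc n)"] by auto
qed

lemma odometer_antimono: "\<xi> \<in> Y \<Longrightarrow> m \<le> n \<Longrightarrow> \<xi> n \<subseteq> \<xi> m"
  using lift_Suc_antimono_le[of \<xi> m n] odometer_Suc_subset by simp

lemma odometer_mem:
  assumes "\<xi> \<in> Y" "g \<in> \<xi> n"
  shows "g \<in> carrier G" "\<xi> n = coset n g"
proof -
  obtain h where h: "h \<in> carrier G" "\<xi> n = coset n h"
    using odometer_lcosets[OF assms(1), of n] unfolding lcosets_eq by blast
  with assms(2) show "g \<in> carrier G" "\<xi> n = coset n g"
    using coset_carrier[of h g n] coset_eqI[of h g n] by simp_all
qed

lemma odometer_ex: "\<xi> \<in> Y \<Longrightarrow> \<exists>g\<in>carrier G. g \<in> \<xi> n"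
  using odometer_lcosets[of \<xi> n] self_in_coset unfolding lcosets_eq by blast

lemma odometer_eq_antimono:
  assumes "\<xi> \<in> Y" "\<eta> \<in> Y" "\<xi> n = \<eta> n" "m \<le> n"
  shows "\<xi> m = \<eta> m"
proof -
  obtain g where g: "g \<in> \<xi> n" using odometer_ex[OF assms(1)] by blast
  then have "g \<in> \<xi> m" "g \<in> \<eta> m" using odometer_antimono assms by blast+
  then show ?thesis using odometer_mem(2) assms by metis
qed

definition point :: "'a \<Rightarrow> nat \<Rightarrow> 'a set" where "point g = (\<lambda>n. coset n g)"

lemma point_in: "g \<in> carrier G \<Longrightarrow> point g \<in> Y"
  unfolding point_def using coset_antimono by (intro odometerI) (auto simp: lcosets_eq)

lemma act_mem: "g \<in> carrier G \<Longrightarrow> \<xi> \<in> Y \<Longrightarrow> r \<in> \<xi> n \<Longrightarrow> act g \<xi> n = coset n (g \<otimes> r)"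
  unfolding odometer_action_def using odometer_mem[of \<xi> r n] coset_left_mult[of g r n] by simp

lemma act_memI: "g \<in> carrier G \<Longrightarrow> \<xi> \<in> Y \<Longrightarrow> r \<in> \<xi> n \<Longrightarrow> g \<otimes> r \<in> act g \<xi> n"
  unfolding odometer_action_def l_coset_def by blast

lemma act_in: "g \<in> carrier G \<Longrightarrow> \<xi> \<in> Y \<Longrightarrow> act g \<xi> \<in> Y"
proof (rule odometerI)
  assume g: "g \<in> carrier G" and \<xi>: "\<xi> \<in> Y"
  fix n
  obtain r where r: "r \<in> carrier G" "r \<in> \<xi> n" using odometer_ex[OF \<xi>] by blast
  show "act g \<xi> n \<in> lcosets (\<Gamma> n)" unfolding act_mem[OF g \<xi> r(2)] lcosets_eq using g r by blast
  show "act g \<xi> (Suc n) \<subseteq> act g \<xi> n"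
    unfolding odometer_action_def l_coset_def using odometer_Suc_subset[OF \<xi>, of n] by blast
qed

lemma act_one: "\<xi> \<in> Y \<Longrightarrow> act \<one> \<xi> = \<xi>"
  using act_mem[of \<one> \<xi>] odometer_ex[of \<xi>] odometer_mem[of \<xi>] by (intro ext) (metis l_one one_closed)

lemma act_act:
  assumes "g \<in> carrier G" "h \<in> carrier G" "\<xi> \<in> Y"
  shows "act (g \<otimes> h) \<xi> = act g (act h \<xi>)"
proof
  fix n
  obtain r where r: "r \<in> carrier G" "r \<in> \<xi> n" using odometer_ex[OF assms(3)] by blast
  show "act (g \<otimes> h) \<xi> n = act g (act h \<xi>) n"
    using act_mem[OF _ assms(3) r(2), of "g \<otimes> h"] act_mem[OF assms(1) act_in[OF assms(2,3)] act_memI[OF assms(2,3) r(2)]]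
      assms r by (simp add: m_assoc)
qed

lemma act_inv: "g \<in> carrier G \<Longrightarrow> \<xi> \<in> Y \<Longrightarrow> act (inv g) (act g \<xi>) = \<xi>"
  "g \<in> carrier G \<Longrightarrow> \<xi> \<in> Y \<Longrightarrow> act g (act (inv g) \<xi>) = \<xi>"
  using act_act[of "inv g" g \<xi>] act_act[of g "inv g" \<xi>] act_one[of \<xi>] by simp_all

lemma act_eq_iff:
  assumes "g \<in> carrier G" "\<xi> \<in> Y" "\<eta> \<in> Y"
  shows "act g \<xi> n = act g \<eta> n \<longleftrightarrow> \<xi> n = \<eta> n"
proof
  show "\<xi> n = \<eta> n \<Longrightarrow> act g \<xi> n = act g \<eta> n" by (simp add: odometer_action_def)
  assume "act g \<xi> n = act g \<eta> n"
  then have "act (inv g) (act g \<xi>) n = act (inv g) (act g \<eta>) n" by (simp add: odometer_action_def)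
  then show "\<xi> n = \<eta> n" using act_inv assms by simp
qed

definition cyl :: "nat \<Rightarrow> 'a set \<Rightarrow> (nat \<Rightarrow> 'a set) set" where
  "cyl n c = {\<eta> \<in> Y. \<eta> n = c}"

lemma Y_subset_prod: "Y \<subseteq> topspace (product_topology (\<lambda>n. discrete_topology (lcosets (\<Gamma> n))) UNIV)"
  using odometer_lcosets by (auto simp: PiE_def extensional_def)

lemma topspace_YT: "topspace YT = Y"
  unfolding odometer_top_def using Y_subset_prod by auto

lemma openin_cyl: "openin YT (cyl n c)"
proof -
  let ?P = "product_topology (\<lambda>n. discrete_topology (lcosets (\<Gamma> n))) UNIV"
  have "openin ?P {\<eta> \<in> topspace ?P. \<eta> n \<in> {c} \<inter> lcosets (\<Gamma> n)}"
    by (rule openin_continuous_map_preimage[OF continuous_map_product_projection]) auto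
  moreover have "cyl n c = {\<eta> \<in> topspace ?P. \<eta> n \<in> {c} \<inter> lcosets (\<Gamma> n)} \<inter> Y"
    unfolding cyl_def using Y_subset_prod odometer_lcosets by auto
  ultimately show ?thesis
    unfolding odometer_top_def openin_subtopology by blast
qed

text \<open>Since a coset determines its ancestors, the cylinders of one coordinate already form a basis.\<close>

lemma openin_YT_iff:
  "openin YT U \<longleftrightarrow> U \<subseteq> Y \<and> (\<forall>\<xi>\<in>U. \<exists>n. cyl n (\<xi> n) \<subseteq> U)" (is "?L \<longleftrightarrow> ?R")
proof
  let ?P = "product_topology (\<lambda>n. discrete_topology (lcosets (\<Gamma> n))) UNIV"
  assume L: ?L
  then obtain V where V: "openin ?P V" "U = V \<inter> Y"
    unfolding odometer_top_def openin_subtopology by blast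
  show ?R
  proof (intro conjI ballI)
    show "U \<subseteq> Y" using V by blast
    fix \<xi> assume \<xi>: "\<xi> \<in> U"
    then have "\<exists>W. finite {i \<in> UNIV. W i \<noteq> topspace (discrete_topology (lcosets (\<Gamma> i)))} \<and>
        (\<forall>i\<in>UNIV. openin (discrete_topology (lcosets (\<Gamma> i))) (W i)) \<and> \<xi> \<in> PiE UNIV W \<and> PiE UNIV W \<subseteq> V"
      using V unfolding openin_product_topology_alt by blast
    then obtain W where fin: "finite {i. W i \<noteq> lcosets (\<Gamma> i)}" and W: "\<xi> \<in> PiE UNIV W" "PiE UNIV W \<subseteq> V"
      by auto
    obtain n where n: "\<And>i. W i \<noteq> lcosets (\<Gamma> i) \<Longrightarrow> i \<le> n"
      using finite_nat_set_iff_bounded_le[THEN iffD1, OF fin] by auto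
    have "cyl n (\<xi> n) \<subseteq> U"
    proof
      fix \<eta> assume "\<eta> \<in> cyl n (\<xi> n)"
      then have \<eta>: "\<eta> \<in> Y" "\<eta> n = \<xi> n" by (simp_all add: cyl_def)
      have "\<xi> \<in> Y" using \<xi> V by simp
      have "\<eta> i \<in> W i" for i
      proof (cases "W i = lcosets (\<Gamma> i)")
        case True then show ?thesis using odometer_lcosets \<eta> by simp
      next
        case False
        then have "\<eta> i = \<xi> i" using odometer_eq_antimono[OF \<eta>(1) \<open>\<xi> \<in> Y\<close> \<eta>(2)] n by simp
        then show ?thesis using W by auto
      qed
      then have "\<eta> \<in> PiE UNIV W" by (auto simp: PiE_def)
      then show "\<eta> \<in> U" using W V \<eta> by blast
    qed
    then show "\<exists>n. cyl n (\<xi> n) \<subseteq> U" by blast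
  qed
next
  assume R: ?R
  then have "\<forall>\<xi>\<in>U. \<exists>T. openin YT T \<and> \<xi> \<in> T \<and> T \<subseteq> U"
    using openin_cyl by (fastforce simp: cyl_def)
  then show ?L using openin_subopen by metis
qed

lemma compact_YT: "compact_space YT"
proof -
  let ?P = "product_topology (\<lambda>n. discrete_topology (lcosets (\<Gamma> n))) UNIV"
  have compP: "compact_space ?P"
    unfolding compact_space_product_topology compact_space_discrete_topology using finite_lcosets by blast
  have coord: "closedin ?P {\<xi> \<in> topspace ?P. \<xi> n = c}" for n c
  proof -
    have "closedin ?P {\<xi> \<in> topspace ?P. \<xi> n \<in> {c} \<inter> lcosets (\<Gamma> n)}"
      by (rule closedin_continuous_map_preimage[OF continuous_map_product_projection]) auto
    moreover have "{\<xi> \<in> topspace ?P. \<xi> n \<in> {c} \<inter> lcosets (\<Gamma> n)} = {\<xi> \<in> topspace ?P. \<xi> n = c}"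
      by (auto simp: PiE_def)
    ultimately show ?thesis by simp
  qed
  define E where "E = (\<lambda>n. {p \<in> (lcosets (\<Gamma> (Suc n))) \<times> (lcosets (\<Gamma> n)). fst p \<subseteq> snd p})"
  have "finite (E n)" for n unfolding E_def using finite_lcosets by simp
  then have "closedin ?P (\<Union>p\<in>E n. {\<xi> \<in> topspace ?P. \<xi> (Suc n) = fst p} \<inter> {\<xi> \<in> topspace ?P. \<xi> n = snd p})" for n
    using coord by (intro closedin_Union closedin_Int) auto
  then have "closedin ?P (\<Inter>n. \<Union>p\<in>E n. {\<xi> \<in> topspace ?P. \<xi> (Suc n) = fst p} \<inter> {\<xi> \<in> topspace ?P. \<xi> n = snd p})"
    by (intro closedin_Inter) auto
  moreover have "(\<Inter>n. \<Union>p\<in>E n. {\<xi> \<in> topspace ?P. \<xi> (Suc n) = fst p} \<inter> {\<xi> \<in> topspace ?P. \<xi> n = snd p}) = Y"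
    (is "?I = Y")
  proof (intro equalityI subsetI)
    fix \<xi> assume \<xi>: "\<xi> \<in> ?I"
    show "\<xi> \<in> Y"
    proof (rule odometerI)
      fix n
      have "\<xi> \<in> (\<Union>p\<in>E n. {\<xi> \<in> topspace ?P. \<xi> (Suc n) = fst p} \<inter> {\<xi> \<in> topspace ?P. \<xi> n = snd p})"
        using \<xi> by blast
      then obtain p where "p \<in> E n" "\<xi> (Suc n) = fst p" "\<xi> n = snd p" by blast
      then show "\<xi> n \<in> lcosets (\<Gamma> n)" "\<xi> (Suc n) \<subseteq> \<xi> n" by (auto simp: E_def)
    qed
  next
    fix \<xi> assume \<xi>: "\<xi> \<in> Y"
    show "\<xi> \<in> ?I"
    proof (rule INT_I)
      fix n
      have "(\<xi> (Suc n), \<xi> n) \<in> E n"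
        using odometer_lcosets[OF \<xi>] odometer_Suc_subset[OF \<xi>] by (simp add: E_def)
      then show "\<xi> \<in> (\<Union>p\<in>E n. {\<xi> \<in> topspace ?P. \<xi> (Suc n) = fst p} \<inter> {\<xi> \<in> topspace ?P. \<xi> n = snd p})"
        using \<xi> Y_subset_prod by (intro UN_I[of "(\<xi> (Suc n), \<xi> n)"]) auto
    qed
  qed
  ultimately have "closedin ?P Y" by simp
  then have "compactin ?P Y" using compP closedin_compact_space by blast
  then show ?thesis unfolding odometer_top_def by (rule compact_space_subtopology)
qed

text \<open>An ultrametric: the distance is the inverse of the first level at which the points differ. The group
acts by isometries, which gives equicontinuity at once.\<close>

definition dY :: "(nat \<Rightarrow> 'a set) \<Rightarrow> (nat \<Rightarrow> 'a set) \<Rightarrow> real" where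
  "dY \<xi> \<eta> = (if \<xi> = \<eta> then 0 else inverse (real (Suc (LEAST n. \<xi> n \<noteq> \<eta> n))))"

lemma dY_less_iff:
  assumes "\<xi> \<in> Y" "\<eta> \<in> Y"
  shows "dY \<xi> \<eta> < inverse (real (Suc n)) \<longleftrightarrow> \<xi> n = \<eta> n"
proof (cases "\<xi> = \<eta>")
  case True then show ?thesis by (simp add: dY_def)
next
  case False
  then have ex: "\<exists>n. \<xi> n \<noteq> \<eta> n" by auto
  define l where "l = (LEAST n. \<xi> n \<noteq> \<eta> n)"
  have l: "\<xi> l \<noteq> \<eta> l" unfolding l_def using ex by (rule LeastI_ex)
  have "\<xi> i = \<eta> i" if "i < l" for i using not_less_Least[of i "\<lambda>n. \<xi> n \<noteq> \<eta> n"] that by (auto simp: l_def)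
  moreover have "\<xi> i \<noteq> \<eta> i" if "l \<le> i" for i using odometer_eq_antimono[OF assms _ that] l by blast
  ultimately have "\<xi> n = \<eta> n \<longleftrightarrow> n < l" using not_le by blast
  moreover have "dY \<xi> \<eta> = inverse (real (Suc l))" using False by (simp add: dY_def l_def)
  moreover have "inverse (real (Suc l)) < inverse (real (Suc n)) \<longleftrightarrow> n < l" by simp
  ultimately show ?thesis by simp
qed

lemma metric_Y: "Metric_space Y dY"
proof (rule Metric_space.intro)
  show "0 \<le> dY x y" for x y by (simp add: dY_def)
  show "dY x y = dY y x" for x y
  proof -
    have "(\<lambda>n. x n \<noteq> y n) = (\<lambda>n. y n \<noteq> x n)" by auto
    then show ?thesis by (simp add: dY_def eq_commute[of x y])
  qed
  show "dY x y = 0 \<longleftrightarrow> x = y" for x y by (simp add: dY_def)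
next
  fix x y z assume Y: "x \<in> Y" "y \<in> Y" "z \<in> Y"
  have nonneg: "0 \<le> dY x y" for x y by (simp add: dY_def)
  show "dY x z \<le> dY x y + dY y z"
  proof (cases "x = z")
    case True then show ?thesis using nonneg[of x y] nonneg[of y z] by (simp add: dY_def)
  next
    case False
    then have ex: "\<exists>n. x n \<noteq> z n" by auto
    define l where "l = (LEAST n. x n \<noteq> z n)"
    have l: "x l \<noteq> z l" unfolding l_def using ex by (rule LeastI_ex)
    have d: "dY x z = inverse (real (Suc l))" using False by (simp add: dY_def l_def)
    have "x l \<noteq> y l \<or> y l \<noteq> z l" using l by auto
    then have "dY x y \<ge> inverse (real (Suc l)) \<or> dY y z \<ge> inverse (real (Suc l))"
      using dY_less_iff[OF Y(1,2), of l] dY_less_iff[OF Y(2,3), of l] by linarith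
    then show ?thesis unfolding d using nonneg[of x y] nonneg[of y z] by linarith
  qed
qed

lemma mtopology_Y: "Metric_space.mtopology Y dY = YT"
proof -
  interpret M: Metric_space Y dY by (rule metric_Y)
  have ball: "M.mball \<xi> (inverse (real (Suc n))) = cyl n (\<xi> n)" if "\<xi> \<in> Y" for \<xi> n
    unfolding M.mball_def cyl_def using that dY_less_iff[OF that] by (auto simp: eq_commute)
  have nbhd: "(\<exists>r>0. M.mball \<xi> r \<subseteq> U) \<longleftrightarrow> (\<exists>n. cyl n (\<xi> n) \<subseteq> U)" if \<xi>: "\<xi> \<in> Y" for \<xi> U
  proof
      assume "\<exists>r>0. M.mball \<xi> r \<subseteq> U"
      then obtain r where r: "r > 0" "M.mball \<xi> r \<subseteq> U" by blast
      obtain n where "inverse (real (Suc n)) < r" using reals_Archimedean[OF r(1)] by blast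
      then have "M.mball \<xi> (inverse (real (Suc n))) \<subseteq> M.mball \<xi> r" by (intro M.mball_subset_concentric) simp
      then show "\<exists>n. cyl n (\<xi> n) \<subseteq> U" using ball[OF \<xi>] r by blast
    next
      assume "\<exists>n. cyl n (\<xi> n) \<subseteq> U"
      then obtain n where "M.mball \<xi> (inverse (real (Suc n))) \<subseteq> U" using ball[OF \<xi>] by blast
      moreover have "inverse (real (Suc n)) > 0" by simp
      ultimately show "\<exists>r>0. M.mball \<xi> r \<subseteq> U" by blast
  qed
  have "openin M.mtopology U \<longleftrightarrow> openin YT U" for U
    unfolding M.openin_mtopology openin_YT_iff using nbhd by blast
  then show ?thesis by (simp add: topology_eq)
qed

lemma continuous_act: "g \<in> carrier G \<Longrightarrow> continuous_map YT YT (act g)"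
  unfolding continuous_map_def topspace_YT
proof (intro conjI allI impI)
  assume g: "g \<in> carrier G"
  show "act g \<in> Y \<rightarrow> Y" using act_in[OF g] by blast
  fix U assume U: "openin YT U"
  show "openin YT {x \<in> Y. act g x \<in> U}"
    unfolding openin_YT_iff
  proof (intro conjI ballI)
    fix \<xi> assume "\<xi> \<in> {x \<in> Y. act g x \<in> U}"
    then have \<xi>: "\<xi> \<in> Y" "act g \<xi> \<in> U" by simp_all
    then obtain n where n: "cyl n (act g \<xi> n) \<subseteq> U" using U unfolding openin_YT_iff by blast
    have "cyl n (\<xi> n) \<subseteq> {x \<in> Y. act g x \<in> U}"
    proof
      fix \<eta> assume "\<eta> \<in> cyl n (\<xi> n)"
      then have \<eta>: "\<eta> \<in> Y" "\<eta> n = \<xi> n" by (simp_all add: cyl_def)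
      then have "act g \<eta> \<in> cyl n (act g \<xi> n)" using act_in[OF g] by (simp add: cyl_def odometer_action_def)
      then show "\<eta> \<in> {x \<in> Y. act g x \<in> U}" using n \<eta> by blast
    qed
    then show "\<exists>n. cyl n (\<xi> n) \<subseteq> {x \<in> Y. act g x \<in> U}" by blast
  qed blast
qed

lemma equicontinuous_odometer: "equicontinuous_system G YT act"
  unfolding equicontinuous_system_def dynamical_system_def topspace_YT
proof (intro conjI exI[of _ dY] ballI allI impI)
  interpret M: Metric_space Y dY by (rule metric_Y)
  show "compact_space YT" by (rule compact_YT)
  show "metrizable_space YT" using M.metrizable_space_mtopology mtopology_Y by simp
  show "Metric_space Y dY" by (rule metric_Y)
  show "M.mtopology = YT" by (rule mtopology_Y)
  fix e :: real assume "e > 0"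
  then obtain n where n: "inverse (real (Suc n)) < e" using reals_Archimedean by blast
  have "dY (act g x) (act g y) < e" if "x \<in> Y" "y \<in> Y" "dY x y < inverse (real (Suc n))" "g \<in> carrier G" for x y g
  proof -
    have "act g x n = act g y n" using that dY_less_iff[OF that(1,2)] act_eq_iff[OF that(4,1,2)] by blast
    then have "dY (act g x) (act g y) < inverse (real (Suc n))"
      using dY_less_iff[OF act_in[OF that(4,1)] act_in[OF that(4,2)]] by blast
    then show ?thesis using n by linarith
  qed
  moreover have "inverse (real (Suc n)) > 0" by simp
  ultimately show "\<exists>\<delta>>0. \<forall>x\<in>Y. \<forall>y\<in>Y. dY x y < \<delta> \<longrightarrow> (\<forall>g\<in>carrier G. dY (act g x) (act g y) < e)"
    by blast
qed (simp_all add: continuous_act act_one act_act)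

section \<open>Haar measure and ergodicity\<close>

lemma cyl_sets: "cyl n c \<in> borel_sets YT"
  unfolding borel_sets_def using openin_cyl by (intro sigma_sets.Basic) simp

lemma coord_sets: "{\<xi> \<in> Y. P (\<xi> n)} \<in> borel_sets YT"
proof -
  interpret sigma_algebra Y "borel_sets YT"
    unfolding borel_sets_def topspace_YT
    by (rule sigma_algebra_sigma_sets) (use openin_YT_iff in auto)
  have "{\<xi> \<in> Y. P (\<xi> n)} = (\<Union>c\<in>{c \<in> lcosets (\<Gamma> n). P c}. cyl n c)"
    using odometer_lcosets by (auto simp: cyl_def)
  moreover have "(\<Union>c\<in>{c \<in> lcosets (\<Gamma> n). P c}. cyl n c) \<in> borel_sets YT"
    using finite_lcosets by (intro finite_UN) (simp_all add: cyl_sets)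
  ultimately show ?thesis by simp
qed

definition cyls :: "(nat \<Rightarrow> 'a set) set set" where
  "cyls = insert {} (insert Y (\<Union>n. cyl n ` (lcosets (\<Gamma> n))))"

lemma borel_YT: "borel_sets YT = sigma_sets Y cyls"
proof (rule antisym)
  have countable: "countable (\<Union>n. cyl n ` (lcosets (\<Gamma> n)))"
    using finite_lcosets by (intro countable_UN countable_image) (simp_all add: countable_finite)
  show "borel_sets YT \<subseteq> sigma_sets Y cyls"
    unfolding borel_sets_def topspace_YT
  proof (rule sigma_sets_mono, rule subsetI)
    fix U assume "U \<in> {U. openin YT U}"
    then have U: "U \<subseteq> Y" "\<And>\<xi>. \<xi> \<in> U \<Longrightarrow> \<exists>n. cyl n (\<xi> n) \<subseteq> U" by (auto simp: openin_YT_iff)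
    define D where "D = {C \<in> (\<Union>n. cyl n ` (lcosets (\<Gamma> n))). C \<subseteq> U}"
    have "U = \<Union>D"
    proof (intro equalityI subsetI)
      fix \<xi> assume "\<xi> \<in> U"
      then obtain n where n: "cyl n (\<xi> n) \<subseteq> U" "\<xi> \<in> Y" using U by blast
      then have "cyl n (\<xi> n) \<in> D" "\<xi> \<in> cyl n (\<xi> n)"
        unfolding D_def using odometer_lcosets by (blast, simp add: cyl_def)
      then show "\<xi> \<in> \<Union>D" by blast
    qed (auto simp: D_def)
    moreover have "countable D" unfolding D_def using countable by (rule countable_subset[rotated]) blast
    moreover have "D \<subseteq> sigma_sets Y cyls" by (auto simp: D_def cyls_def intro: sigma_sets.Basic)
    ultimately show "U \<in> sigma_sets Y cyls" using sigma_sets_UNION[of D Y cyls] by blast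
  qed
  have "Y \<in> borel_sets YT" using coord_sets[of "\<lambda>_. True"] by simp
  moreover have "{} \<in> borel_sets YT" unfolding borel_sets_def by (rule sigma_sets.Empty)
  ultimately have "cyls \<subseteq> borel_sets YT" using cyl_sets by (auto simp: cyls_def)
  then show "sigma_sets Y cyls \<subseteq> borel_sets YT"
    unfolding borel_sets_def topspace_YT by (rule sigma_sets_mono)
qed

lemma space_of_sets: "sets M = borel_sets YT \<Longrightarrow> space M = Y"
proof -
  assume "sets M = borel_sets YT"
  moreover have "{U. openin YT U} \<subseteq> Pow Y" using openin_YT_iff by blast
  ultimately have "sets M = sets (sigma Y {U. openin YT U})"
    by (simp add: borel_sets_def topspace_YT)
  then show "space M = Y" by (metis sets_eq_imp_space_eq space_measure_of_conv)
qed

lemma Int_stable_cyls: "Int_stable cyls"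
proof -
  have aux: "cyl m c \<inter> cyl n d \<in> cyls" if mn: "m \<le> n" and d: "d \<in> lcosets (\<Gamma> n)" for m n c d
  proof (cases "cyl m c \<inter> cyl n d = {}")
    case False
    then obtain \<xi> where \<xi>: "\<xi> \<in> Y" "\<xi> m = c" "\<xi> n = d" by (auto simp: cyl_def)
    have "cyl n d \<subseteq> cyl m c"
    proof
      fix \<eta> assume "\<eta> \<in> cyl n d"
      then have \<eta>: "\<eta> \<in> Y" "\<eta> n = \<xi> n" using \<xi> by (simp_all add: cyl_def)
      then show "\<eta> \<in> cyl m c" using odometer_eq_antimono[OF \<eta>(1) \<xi>(1) \<eta>(2) mn] \<xi> by (simp add: cyl_def)
    qed
    then have "cyl m c \<inter> cyl n d = cyl n d" by blast
    then show ?thesis using d by (auto simp: cyls_def)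
  qed (simp add: cyls_def)
  have sub: "cyl m c \<subseteq> Y" for m c by (auto simp: cyl_def)
  show ?thesis
  proof (rule Int_stableI)
    fix a b assume ab: "a \<in> cyls" "b \<in> cyls"
    consider "a = {} \<or> b = {}" | "a = Y" | "b = Y" |
      m c n d where "a = cyl m c" "b = cyl n d" "c \<in> lcosets (\<Gamma> m)" "d \<in> lcosets (\<Gamma> n)"
      using ab unfolding cyls_def by blast
    then show "a \<inter> b \<in> cyls"
    proof cases
      case 1 then show ?thesis by (auto simp: cyls_def)
    next
      case 2 then have "a \<inter> b = b" using ab sub by (auto simp: cyls_def)
      then show ?thesis using ab by simp
    next
      case 3 then have "a \<inter> b = a" using ab sub by (auto simp: cyls_def)
      then show ?thesis using ab by simp
    next
      case (4 m c n d)
      then show ?thesis using aux[of m n d c] aux[of n m c d] by (cases "m \<le> n") (simp_all add: Int_commute)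
    qed
  qed
qed

lemma uniform_cylinders:
  assumes S: "sets M = borel_sets YT"
    and u: "\<And>n g h. g \<in> carrier G \<Longrightarrow> h \<in> carrier G \<Longrightarrow>
      emeasure M (cyl n (coset n (g \<otimes> h))) = emeasure M (cyl n (coset n h))"
    and c: "c \<in> lcosets (\<Gamma> n)"
  shows "of_nat (q n) * emeasure M (cyl n c) = emeasure M Y"
proof -
  obtain h where h: "h \<in> carrier G" "c = coset n h" using c unfolding lcosets_eq by blast
  have same: "emeasure M (cyl n d) = emeasure M (cyl n c)" if d: "d \<in> lcosets (\<Gamma> n)" for d
  proof -
    obtain k where k: "k \<in> carrier G" "d = coset n k" using d unfolding lcosets_eq by blast
    have "(k \<otimes> inv h) \<otimes> h = k" using h k by (simp add: m_assoc)
    then show ?thesis using u[of "k \<otimes> inv h" h n] h k by simp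
  qed
  have "emeasure M Y = emeasure M (\<Union>d\<in>lcosets (\<Gamma> n). cyl n d)"
    by (rule arg_cong[of _ _ "emeasure M"]) (use odometer_lcosets in \<open>auto simp: cyl_def\<close>)
  also have "\<dots> = (\<Sum>d\<in>lcosets (\<Gamma> n). emeasure M (cyl n d))"
    using finite_lcosets cyl_sets S
    by (intro sum_emeasure[symmetric]) (auto simp: disjoint_family_on_def cyl_def)
  also have "\<dots> = (\<Sum>d\<in>lcosets (\<Gamma> n). emeasure M (cyl n c))" using same by (rule sum.cong[OF refl])
  also have "\<dots> = of_nat (q n) * emeasure M (cyl n c)" by (simp add: q_def)
  finally show ?thesis by simp
qed

text \<open>The cylinders of one level are translates of each other, so a measure that is invariant on
  cylinders is determined by its total mass. Besides unique ergodicity this yields ergodicity, by way of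
  the measures \<open>B \<mapsto> \<nu> (A \<inter> B)\<close>.\<close>

lemma uniform_unique:
  assumes SM: "sets M = borel_sets YT" and SN: "sets N = borel_sets YT"
    and uM: "\<And>n g h. g \<in> carrier G \<Longrightarrow> h \<in> carrier G \<Longrightarrow>
      emeasure M (cyl n (coset n (g \<otimes> h))) = emeasure M (cyl n (coset n h))"
    and uN: "\<And>n g h. g \<in> carrier G \<Longrightarrow> h \<in> carrier G \<Longrightarrow>
      emeasure N (cyl n (coset n (g \<otimes> h))) = emeasure N (cyl n (coset n h))"
    and total: "emeasure M Y = emeasure N Y" "emeasure M Y \<noteq> \<infinity>"
  shows "M = N"
proof (rule measure_eqI_generator_eq[OF Int_stable_cyls, where \<Omega>=Y and A="\<lambda>_. Y"])
  show "cyls \<subseteq> Pow Y" by (auto simp: cyls_def cyl_def)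
  show "sets M = sigma_sets Y cyls" "sets N = sigma_sets Y cyls" using SM SN borel_YT by simp_all
  show "range (\<lambda>_::nat. Y) \<subseteq> cyls" by (auto simp: cyls_def)
  show "(\<Union>i::nat. Y) = Y" by simp
  show "emeasure M Y \<noteq> \<infinity>" for i :: nat by (rule total(2))
  fix A assume A: "A \<in> cyls"
  consider "A = {}" | "A = Y" | n c where "A = cyl n c" "c \<in> lcosets (\<Gamma> n)"
    using A unfolding cyls_def by blast
  then show "emeasure M A = emeasure N A"
  proof cases
    case (3 n c)
    have "of_nat (q n) * emeasure M (cyl n c) = of_nat (q n) * emeasure N (cyl n c)"
      using uniform_cylinders[OF SM uM 3(2)] uniform_cylinders[OF SN uN 3(2)] total by simp
    then show ?thesis using 3 q_pos[of n] by (simp add: ennreal_mult_cancel_left)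
  qed (use total in simp_all)
qed

lemma cyl_translate:
  assumes "g \<in> carrier G" "h \<in> carrier G"
  shows "{\<xi> \<in> Y. act g \<xi> \<in> cyl n (coset n (g \<otimes> h))} = cyl n (coset n h)"
proof -
  have p: "point h \<in> Y" using assms point_in by simp
  have "act g (point h) n = coset n (g \<otimes> h)" using act_mem[OF assms(1) p, of h n] assms by (simp add: point_def)
  then have "act g \<xi> n = coset n (g \<otimes> h) \<longleftrightarrow> \<xi> n = coset n h" if "\<xi> \<in> Y" for \<xi>
    unfolding \<open>act g (point h) n = coset n (g \<otimes> h)\<close>[symmetric] act_eq_iff[OF assms(1) that p]
    by (simp add: point_def)
  then show ?thesis using act_in[OF assms(1)] unfolding cyl_def by blast
qed

lemma measurable_act:
  assumes "sets M = borel_sets YT" "g \<in> carrier G"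
  shows "act g \<in> measurable M M"
proof (rule measurable_sigma_sets[where \<Omega>=Y and A="{U. openin YT U}"])
  show "sets M = sigma_sets Y {U. openin YT U}" using assms(1) by (simp add: borel_sets_def topspace_YT)
  show "{U. openin YT U} \<subseteq> Pow Y" using openin_YT_iff by auto
  show "act g \<in> space M \<rightarrow> Y" using act_in[OF assms(2)] space_of_sets[OF assms(1)] by simp
  fix U assume "U \<in> {U. openin YT U}"
  then have "openin YT {x \<in> topspace YT. act g x \<in> U}"
    using continuous_act[OF assms(2)] openin_continuous_map_preimage by blast
  moreover have "act g -` U \<inter> space M = {x \<in> topspace YT. act g x \<in> U}"
    using space_of_sets[OF assms(1)] by (auto simp: topspace_YT)
  ultimately show "act g -` U \<inter> space M \<in> sets M"
    using assms(1) by (simp add: borel_sets_def sigma_sets.Basic)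
qed

lemma invariant_uniform:
  assumes "invariant_probability G YT act M" "g \<in> carrier G" "h \<in> carrier G"
  shows "emeasure M (cyl n (coset n (g \<otimes> h))) = emeasure M (cyl n (coset n h))"
proof -
  have S: "sets M = borel_sets YT" and d: "distr M M (act g) = M"
    using assms by (auto simp: invariant_probability_def borel_probability_def)
  have "emeasure M (cyl n (coset n (g \<otimes> h))) = emeasure (distr M M (act g)) (cyl n (coset n (g \<otimes> h)))"
    using d by simp
  also have "\<dots> = emeasure M (act g -` cyl n (coset n (g \<otimes> h)) \<inter> space M)"
    using S cyl_sets measurable_act[OF S assms(2)] by (intro emeasure_distr) simp_all
  also have "act g -` cyl n (coset n (g \<otimes> h)) \<inter> space M = cyl n (coset n h)"
    using cyl_translate[OF assms(2,3), of n] space_of_sets[OF S] by auto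
  finally show ?thesis .
qed

lemma invariant_unique:
  assumes M: "invariant_probability G YT act M" and N: "invariant_probability G YT act N"
  shows "M = N"
proof -
  have S: "sets M = borel_sets YT" "sets N = borel_sets YT" and P: "prob_space M" "prob_space N"
    using assms by (auto simp: invariant_probability_def borel_probability_def)
  show ?thesis
    using prob_space.emeasure_space_1[OF P(1)] prob_space.emeasure_space_1[OF P(2)]
      space_of_sets[OF S(1)] space_of_sets[OF S(2)]
    by (intro uniform_unique[OF S invariant_uniform[OF M] invariant_uniform[OF N]]) simp_all
qed

lemma haar_invariant:
  assumes "normalized_haar (odometer_group G \<Gamma>) YT M"
  shows "invariant_probability G YT act M"
  unfolding invariant_probability_def
proof (intro conjI ballI)
  show bp: "borel_probability YT M" using assms by (simp add: normalized_haar_def)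
  then have sp: "space M = Y" using space_of_sets by (simp add: borel_probability_def)
  fix g assume g: "g \<in> carrier G"
  have "point g \<otimes>\<^bsub>odometer_group G \<Gamma>\<^esub> \<xi> = act g \<xi>" if \<xi>: "\<xi> \<in> Y" for \<xi>
  proof
    fix n
    obtain r where r: "r \<in> carrier G" "r \<in> \<xi> n" using odometer_ex[OF \<xi>] by blast
    have rl: "\<Gamma> n #> x = coset n x" if "x \<in> carrier G" for x
      using normal.coset_eq[OF normal_G] that by blast
    have "(point g \<otimes>\<^bsub>odometer_group G \<Gamma>\<^esub> \<xi>) n = coset n g <#> coset n r"
      using odometer_mem[OF \<xi> r(2)] by (simp add: odometer_group_def point_def)
    also have "\<dots> = coset n (g \<otimes> r)"
      using normal.rcos_sum[OF normal_G, of g r n] rl g r by simp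
    finally show "(point g \<otimes>\<^bsub>odometer_group G \<Gamma>\<^esub> \<xi>) n = act g \<xi> n" using act_mem[OF g \<xi> r(2)] by simp
  qed
  then have "distr M M (act g) = distr M M (\<lambda>\<xi>. point g \<otimes>\<^bsub>odometer_group G \<Gamma>\<^esub> \<xi>)"
    using sp by (intro distr_cong) simp_all
  also have "\<dots> = M"
    using assms point_in[OF g] by (simp add: normalized_haar_def odometer_group_def)
  finally show "distr M M (act g) = M" .
qed

end

locale haar_odometer = free_odometer +
  fixes \<nu> :: "(nat \<Rightarrow> 'a set) measure"
  assumes inv_nu: "invariant_probability G (odometer_top G \<Gamma>) (odometer_action G) \<nu>"
begin

lemma sets_nu: "sets \<nu> = borel_sets YT"
  using inv_nu by (simp add: invariant_probability_def borel_probability_def)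

lemma space_nu: "space \<nu> = Y"
  using space_of_sets[OF sets_nu] .

sublocale prob_space \<nu>
  using inv_nu by (simp add: invariant_probability_def borel_probability_def)

lemma distr_act: "g \<in> carrier G \<Longrightarrow> distr \<nu> \<nu> (act g) = \<nu>"
  using inv_nu by (simp add: invariant_probability_def)

lemma emeasure_translate:
  assumes "g \<in> carrier G" "A \<in> sets \<nu>"
  shows "emeasure \<nu> {\<xi> \<in> Y. act g \<xi> \<in> A} = emeasure \<nu> A"
proof -
  have "emeasure \<nu> A = emeasure (distr \<nu> \<nu> (act g)) A" using distr_act[OF assms(1)] by simp
  also have "\<dots> = emeasure \<nu> (act g -` A \<inter> space \<nu>)"
    using measurable_act[OF sets_nu assms(1)] assms(2) by (rule emeasure_distr)
  also have "act g -` A \<inter> space \<nu> = {\<xi> \<in> Y. act g \<xi> \<in> A}" using space_nu by auto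
  finally show ?thesis by simp
qed

lemma translate_sets: "g \<in> carrier G \<Longrightarrow> A \<in> sets \<nu> \<Longrightarrow> {\<xi> \<in> Y. act g \<xi> \<in> A} \<in> sets \<nu>"
  using measurable_sets[OF measurable_act[OF sets_nu], of g A] space_nu by (simp add: vimage_def Int_def conj_commute)

lemma measure_cyl:
  assumes c: "c \<in> lcosets (\<Gamma> n)"
  shows "measure \<nu> (cyl n c) = 1 / real (q n)"
proof -
  have "of_nat (q n) * emeasure \<nu> (cyl n c) = 1"
    using uniform_cylinders[OF sets_nu invariant_uniform[OF inv_nu] c] emeasure_space_1 space_nu by simp
  then have "ennreal (real (q n) * measure \<nu> (cyl n c)) = ennreal 1"
    by (simp add: emeasure_eq_measure ennreal_of_nat_eq_real_of_nat ennreal_mult)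
  then have "real (q n) * measure \<nu> (cyl n c) = 1" by (subst (asm) ennreal_inj) simp_all
  then show ?thesis using q_pos[of n] by (simp add: field_simps)
qed

text \<open>An invariant set \<open>A\<close> meets all cylinders of a level in the same measure. So \<open>\<nu> (A \<inter> B)\<close> and
\<open>\<nu> A \<cdot> \<nu> B\<close> agree for all \<open>B\<close>, and \<open>B = A\<close> shows that \<open>A\<close> is independent of itself.\<close>

lemma ergodic_nu:
  assumes A: "A \<in> sets \<nu>" and inv: "\<And>g. g \<in> carrier G \<Longrightarrow> {\<xi> \<in> Y. act g \<xi> \<in> A} = A"
  shows "emeasure \<nu> A = 0 \<or> emeasure \<nu> A = 1"
proof -
  define M where "M = density \<nu> (indicator A)"
  define N where "N = scale_measure (emeasure \<nu> A) \<nu>"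
  have SM: "sets M = borel_sets YT" and SN: "sets N = borel_sets YT" by (simp_all add: M_def N_def sets_nu)
  have M: "emeasure M B = emeasure \<nu> (A \<inter> B)" if "B \<in> sets \<nu>" for B
    unfolding M_def using A that
    by (subst emeasure_density) (simp_all flip: indicator_inter_arith)
  have AY: "A \<subseteq> Y" using sets.sets_into_space[OF A] space_nu by simp
  have cs: "cyl n c \<in> sets \<nu>" for n c using cyl_sets sets_nu by simp
  have "M = N"
  proof (rule uniform_unique[OF SM SN])
    fix n g h assume g: "g \<in> carrier G" and h: "h \<in> carrier G"
    have "{\<xi> \<in> Y. act g \<xi> \<in> A \<inter> cyl n (coset n (g \<otimes> h))}
        = {\<xi> \<in> Y. act g \<xi> \<in> A} \<inter> {\<xi> \<in> Y. act g \<xi> \<in> cyl n (coset n (g \<otimes> h))}" by blast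
    also have "\<dots> = A \<inter> cyl n (coset n h)" using inv[OF g] cyl_translate[OF g h] by simp
    finally have "emeasure \<nu> (A \<inter> cyl n (coset n (g \<otimes> h))) = emeasure \<nu> (A \<inter> cyl n (coset n h))"
      using emeasure_translate[OF g, of "A \<inter> cyl n (coset n (g \<otimes> h))"] A cs by simp
    then show "emeasure M (cyl n (coset n (g \<otimes> h))) = emeasure M (cyl n (coset n h))" using M cs by simp
    show "emeasure N (cyl n (coset n (g \<otimes> h))) = emeasure N (cyl n (coset n h))"
      unfolding N_def using invariant_uniform[OF inv_nu g h] by simp
  next
    have Ys: "Y \<in> sets \<nu>" using sets.top[of \<nu>] space_nu by simp
    have "A \<inter> Y = A" using AY by blast
    then show "emeasure M Y = emeasure N Y" "emeasure M Y \<noteq> \<infinity>"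
      using M[OF Ys] emeasure_space_1 space_nu by (simp_all add: N_def)
  qed
  then have "emeasure \<nu> A = emeasure \<nu> A * emeasure \<nu> A"
    using M[OF A] by (simp add: N_def)
  then have "ennreal (prob A) = ennreal (prob A * prob A)"
    by (simp add: emeasure_eq_measure ennreal_mult)
  then have "prob A = prob A * prob A" by (subst (asm) ennreal_inj) simp_all
  then have "prob A = 0 \<or> prob A = 1" by simp
  then show ?thesis by (auto simp: emeasure_eq_measure)
qed

text \<open>The closure of \<open>A\<close> under the embedding of the group into the odometer. On periodic sets the Haar
measure of this closure is the density of the set.\<close>

definition clo :: "'a set \<Rightarrow> (nat \<Rightarrow> 'a set) set" where
  "clo A = {\<xi> \<in> Y. \<forall>n. \<xi> n \<inter> A \<noteq> {}}"

lemma clo_periodic: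
  assumes "periodic m A"
  shows "clo A = {\<xi> \<in> Y. \<xi> m \<inter> A \<noteq> {}}" "clo A = {\<xi> \<in> Y. \<xi> m \<subseteq> A}"
proof -
  have 1: "\<xi> m \<inter> A \<noteq> {} \<Longrightarrow> \<xi> m \<subseteq> A" if \<xi>: "\<xi> \<in> Y" for \<xi>
  proof -
    assume "\<xi> m \<inter> A \<noteq> {}"
    then obtain g where g: "g \<in> \<xi> m" "g \<in> A" by blast
    then show "\<xi> m \<subseteq> A" using odometer_mem[OF \<xi> g(1)] periodic_coset_subset[OF assms g(2)] by simp
  qed
  have 2: "\<xi> m \<subseteq> A \<Longrightarrow> \<xi> n \<inter> A \<noteq> {}" if \<xi>: "\<xi> \<in> Y" for \<xi> n
  proof -
    assume sub: "\<xi> m \<subseteq> A"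
    obtain g where "g \<in> \<xi> (max m n)" using odometer_ex[OF \<xi>] by blast
    then have "g \<in> \<xi> m" "g \<in> \<xi> n"
      using odometer_antimono[OF \<xi>, of m "max m n"] odometer_antimono[OF \<xi>, of n "max m n"] by auto
    then show ?thesis using sub by blast
  qed
  have 3: "(\<forall>n. \<xi> n \<inter> A \<noteq> {}) \<longleftrightarrow> \<xi> m \<inter> A \<noteq> {}" if "\<xi> \<in> Y" for \<xi>
    using 1[OF that] 2[OF that] by (intro iffI allI) simp_all
  have 4: "\<xi> m \<inter> A \<noteq> {} \<longleftrightarrow> \<xi> m \<subseteq> A" if "\<xi> \<in> Y" for \<xi>
    using 1[OF that] 2[OF that, of m] by (intro iffI) simp_all
  show "clo A = {\<xi> \<in> Y. \<xi> m \<inter> A \<noteq> {}}"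
    unfolding clo_def by (rule Collect_cong, rule conj_cong[OF refl], rule 3)
  then show "clo A = {\<xi> \<in> Y. \<xi> m \<subseteq> A}"
    by (simp only:) (rule Collect_cong, rule conj_cong[OF refl], rule 4)
qed

lemma clo_sets: "clo A \<in> sets \<nu>"
proof -
  have "clo A = (\<Inter>n. {\<xi> \<in> Y. \<xi> n \<inter> A \<noteq> {}})" by (auto simp: clo_def)
  moreover have "(\<Inter>n. {\<xi> \<in> Y. \<xi> n \<inter> A \<noteq> {}}) \<in> sets \<nu>"
    using coord_sets[of "\<lambda>c. c \<inter> A \<noteq> {}"] sets_nu by (intro sets.countable_INT) auto
  ultimately show ?thesis by simp
qed

definition coset_count :: "nat \<Rightarrow> 'a set \<Rightarrow> nat" where
  "coset_count m A = card {c \<in> lcosets (\<Gamma> m). c \<inter> A \<noteq> {}}"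

lemma measure_clo:
  assumes "periodic m A"
  shows "prob (clo A) = real (coset_count m A) / real (q m)"
proof -
  have "clo A = (\<Union>c\<in>{c \<in> lcosets (\<Gamma> m). c \<inter> A \<noteq> {}}. cyl m c)"
    unfolding clo_periodic(1)[OF assms] using odometer_lcosets by (auto simp: cyl_def)
  also have "prob \<dots> = (\<Sum>c\<in>{c \<in> lcosets (\<Gamma> m). c \<inter> A \<noteq> {}}. prob (cyl m c))"
    using finite_lcosets cyl_sets sets_nu
    by (intro finite_measure_finite_Union) (auto simp: disjoint_family_on_def cyl_def)
  also have "\<dots> = (\<Sum>c\<in>{c \<in> lcosets (\<Gamma> m). c \<inter> A \<noteq> {}}. 1 / real (q m))"
    using measure_cyl by (intro sum.cong) simp_all
  finally show ?thesis by (simp add: coset_count_def)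
qed

end

section \<open>A tower of cell decompositions\<close>

context haar_odometer
begin

text \<open>\<open>U\<close> is a set of holes and \<open>\<kappa>\<close> maps each hole to the centre of its cell; the cells are finite because they
lie in translates of \<open>F\<close>. Equivariance of \<open>\<kappa>\<close> implies that a cell contains at most one
element of each coset of \<open>\<Gamma> m\<close>.\<close>

definition cells :: "nat \<Rightarrow> 'a set \<Rightarrow> ('a \<Rightarrow> 'a) \<Rightarrow> 'a set \<Rightarrow> bool" where
  "cells m U \<kappa> F \<longleftrightarrow> periodic m U \<and> U \<noteq> {} \<and> finite F \<and> F \<subseteq> carrier G \<and>
     (\<forall>g\<in>U. \<kappa> g \<in> carrier G \<and> (\<exists>f\<in>F. g = f \<otimes> \<kappa> g)) \<and>
     (\<forall>g\<in>U. \<forall>c\<in>\<Gamma> m. \<kappa> (g \<otimes> c) = \<kappa> g \<otimes> c)"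

text \<open>One step of the construction. The cells of \<open>U\<close> are closed or kept as a whole. Among the closed ones are the
cell of \<open>e\<close>, so that every position is closed eventually, and, periodically, the cell of \<open>p\<close>. No
coset of \<open>\<Gamma> m\<close> in \<open>U\<close> is closed completely, and the closed part has density at most \<open>\<delta>\<close>. The
new cells are unions of old ones and contain with \<open>g\<close> also those of its neighbours \<open>b \<otimes> g\<close>,
\<open>b \<in> E\<close>, that are still open.\<close>

definition refines ::
  "'a set \<Rightarrow> 'a \<Rightarrow> 'a \<Rightarrow> real \<Rightarrow> nat \<Rightarrow> 'a set \<Rightarrow> ('a \<Rightarrow> 'a) \<Rightarrow> nat \<Rightarrow> 'a set \<Rightarrow> ('a \<Rightarrow> 'a) \<Rightarrow> bool" where
  "refines E e p \<delta> m U \<kappa> m' U' \<kappa>' \<longleftrightarrow> m < m' \<and> U' \<subseteq> U \<and> e \<notin> U' \<and>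
     (\<forall>g\<in>U. \<forall>h\<in>U. \<kappa> g = \<kappa> h \<longrightarrow> (g \<in> U' \<longleftrightarrow> h \<in> U')) \<and>
     (\<forall>g\<in>U. \<kappa> g \<in> coset m' (\<kappa> p) \<longrightarrow> g \<notin> U') \<and>
     (\<forall>g\<in>U. \<exists>c\<in>\<Gamma> m. g \<otimes> c \<in> U') \<and>
     prob (clo (U - U')) \<le> \<delta> \<and>
     (\<forall>g\<in>U'. \<forall>h\<in>U'. \<kappa> g = \<kappa> h \<longrightarrow> \<kappa>' g = \<kappa>' h) \<and>
     (\<forall>b\<in>E. \<forall>g\<in>U'. b \<otimes> g \<in> U' \<longrightarrow> \<kappa>' (b \<otimes> g) = \<kappa>' g)"

lemma coset_count_Un: "coset_count m (A \<union> B) \<le> coset_count m A + coset_count m B"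
proof -
  have "{c \<in> lcosets (\<Gamma> m). c \<inter> (A \<union> B) \<noteq> {}}
      = {c \<in> lcosets (\<Gamma> m). c \<inter> A \<noteq> {}} \<union> {c \<in> lcosets (\<Gamma> m). c \<inter> B \<noteq> {}}" by blast
  then show ?thesis unfolding coset_count_def by (simp add: card_Un_le)
qed

lemma coset_count_coset:
  assumes g: "g \<in> carrier G"
  shows "coset_count m (coset m g) \<le> 1"
proof -
  have "{c \<in> lcosets (\<Gamma> m). c \<inter> coset m g \<noteq> {}} \<subseteq> {coset m g}"
  proof
    fix c assume "c \<in> {c \<in> lcosets (\<Gamma> m). c \<inter> coset m g \<noteq> {}}"
    then obtain h x where "h \<in> carrier G" "c = coset m h" "x \<in> coset m h" "x \<in> coset m g"
      unfolding lcosets_eq by blast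
    then show "c \<in> {coset m g}" using coset_eqI[of h x m] coset_eqI[OF g, of x m] by simp
  qed
  then have "card {c \<in> lcosets (\<Gamma> m). c \<inter> coset m g \<noteq> {}} \<le> card {coset m g}" by (intro card_mono) simp_all
  then show ?thesis by (simp add: coset_count_def)
qed

lemma coset_count_translates:
  assumes S: "finite S" "S \<subseteq> carrier G" and B: "B \<subseteq> carrier G"
    and A: "\<And>g. g \<in> A \<Longrightarrow> \<exists>s\<in>S. \<exists>z\<in>B. g = s \<otimes> z"
  shows "coset_count m A \<le> card S * coset_count m B"
proof -
  let ?B = "{c \<in> lcosets (\<Gamma> m). c \<inter> B \<noteq> {}}"
  have fin: "finite ?B" using finite_lcosets by simp
  have "{c \<in> lcosets (\<Gamma> m). c \<inter> A \<noteq> {}} \<subseteq> (\<lambda>(s, d). s <# d) ` (S \<times> ?B)"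
  proof
    fix c assume "c \<in> {c \<in> lcosets (\<Gamma> m). c \<inter> A \<noteq> {}}"
    then obtain h g where h: "h \<in> carrier G" "c = coset m h" "g \<in> coset m h" "g \<in> A"
      unfolding lcosets_eq by blast
    then obtain s z where sz: "s \<in> S" "z \<in> B" "g = s \<otimes> z" using A by blast
    have G: "s \<in> carrier G" "z \<in> carrier G" using sz S B by blast+
    have "c = s <# coset m z"
      using coset_eqI[OF h(1,3)] h(2) sz(3) coset_left_mult[OF G, of m] by simp
    moreover have "coset m z \<in> ?B" using G sz self_in_coset[OF G(2), of m] unfolding lcosets_eq by blast
    ultimately show "c \<in> (\<lambda>(s, d). s <# d) ` (S \<times> ?B)" using sz(1) by blast
  qed
  then have "coset_count m A \<le> card ((\<lambda>(s, d). s <# d) ` (S \<times> ?B))"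
    unfolding coset_count_def using fin S by (intro card_mono) simp_all
  also have "\<dots> \<le> card (S \<times> ?B)" using fin S by (intro card_image_le) simp
  finally show ?thesis by (simp add: coset_count_def card_cartesian_product)
qed

text \<open>Close all cells that meet the cut set or the cosets of \<open>e\<close> and \<open>p\<close>. Two elements of a cell differ by
a factor in the finite set \<open>S\<close>, so this multiplies the density of the cut set by at most the size of \<open>S\<close>;
and a cut with respect to \<open>E \<union> S\<close> keeps the surviving old cells in one piece.\<close>

lemma refinement_exists:
  assumes st: "cells m U \<kappa> F" and E: "finite E" "E \<subseteq> carrier G" and e: "e \<in> carrier G"
    and p: "p \<in> U" and \<delta>: "\<delta> > 0"
  shows "\<exists>m' U' \<kappa>' F'. cells m' U' \<kappa>' F' \<and> refines E e p \<delta> m U \<kappa> m' U' \<kappa>'"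
proof -
  have perU: "periodic m U" and finF: "finite F" and FG: "F \<subseteq> carrier G"
    and cell: "\<And>g. g \<in> U \<Longrightarrow> \<kappa> g \<in> carrier G \<and> (\<exists>f\<in>F. g = f \<otimes> \<kappa> g)"
    and equi: "\<And>g c. g \<in> U \<Longrightarrow> c \<in> \<Gamma> m \<Longrightarrow> \<kappa> (g \<otimes> c) = \<kappa> g \<otimes> c" and neU: "U \<noteq> {}"
    using st unfolding cells_def by simp_all
  have UG: "g \<in> carrier G" if "g \<in> U" for g using periodic_carrier[OF perU that] .
  define S where "S = (\<lambda>(f, f'). f \<otimes> inv f') ` (F \<times> F)"
  have S: "finite S" "S \<subseteq> carrier G" using finF FG by (auto simp: S_def)
  have same_cell: "\<exists>s\<in>S. g = s \<otimes> h" if gh: "g \<in> U" "h \<in> U" "\<kappa> g = \<kappa> h" for g h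
  proof -
    obtain f f' where f: "f \<in> F" "g = f \<otimes> \<kappa> g" "f' \<in> F" "h = f' \<otimes> \<kappa> h"
      using cell[OF gh(1)] cell[OF gh(2)] by blast
    have G: "f \<in> carrier G" "f' \<in> carrier G" "\<kappa> h \<in> carrier G" using f FG cell[OF gh(2)] by blast+
    have "f \<otimes> inv f' \<otimes> h = f \<otimes> inv f' \<otimes> (f' \<otimes> \<kappa> h)" using f(4) by simp
    also have "\<dots> = f \<otimes> \<kappa> h" using G by (simp add: m_assoc mult_inv_cancel)
    also have "\<dots> = g" using f(2) gh(3) by simp
    finally have "g = f \<otimes> inv f' \<otimes> h" by simp
    moreover have "f \<otimes> inv f' \<in> S" using f unfolding S_def by force
    ultimately show ?thesis by blast
  qed
  \<comment> \<open>A set of density below \<open>1 / q m\<close> cannot contain a coset of \<open>\<Gamma> m\<close>.\<close>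
  define d where "d = min \<delta> (1 / (2 * real (q m)))"
  have d: "d > 0" "d \<le> \<delta>" "d < 1 / real (q m)"
    using \<delta> q_pos[of m] by (auto simp: d_def min_def field_simps)
  \<comment> \<open>The factor \<open>3\<close> accounts for the cut set and the two extra cosets.\<close>
  define \<epsilon> where "\<epsilon> = d / (3 * (real (card S) + 1))"
  have \<epsilon>: "\<epsilon> > 0" "real (card S) * (3 * \<epsilon>) \<le> d"
    using d by (simp_all add: \<epsilon>_def field_simps)
  have ES: "finite (E \<union> S)" "E \<union> S \<subseteq> carrier G" using E S by simp_all
  obtain F' n0 where F': "finite F'" "F' \<subseteq> carrier G"
    and cut: "\<forall>m\<ge>n0. \<exists>Z \<kappa>. periodic m Z
      \<and> real (card {c \<in> lcosets (\<Gamma> m). c \<inter> Z \<noteq> {}}) \<le> \<epsilon> * real (q m)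
      \<and> (\<forall>g\<in>carrier G - Z. \<kappa> g \<in> carrier G \<and> (\<exists>f\<in>F'. g = f \<otimes> \<kappa> g))
      \<and> (\<forall>g\<in>carrier G - Z. \<forall>c\<in>\<Gamma> m. \<kappa> (g \<otimes> c) = \<kappa> g \<otimes> c)
      \<and> (\<forall>b\<in>E \<union> S. \<forall>g\<in>carrier G - Z. b \<otimes> g \<notin> Z \<longrightarrow> \<kappa> (b \<otimes> g) = \<kappa> g)"
    using folner_cut[OF ES \<epsilon>(1)] by (elim exE conjE)
  obtain n1 where n1: "\<And>m. m \<ge> n1 \<Longrightarrow> nat \<lceil>1 / \<epsilon>\<rceil> \<le> q m" using q_unbounded by blast
  define m' where "m' = max (Suc m) (max n0 n1)"
  have m': "m < m'" "m \<le> m'" "n0 \<le> m'" "n1 \<le> m'" by (simp_all add: m'_def)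
  have big: "1 \<le> \<epsilon> * real (q m')"
  proof -
    have "1 / \<epsilon> \<le> real (q m')" using n1[OF m'(4)] by linarith
    then show ?thesis using \<epsilon>(1) by (simp add: field_simps)
  qed
  obtain Z \<kappa>' where Z: "periodic m' Z
      \<and> real (card {c \<in> lcosets (\<Gamma> m'). c \<inter> Z \<noteq> {}}) \<le> \<epsilon> * real (q m')
      \<and> (\<forall>g\<in>carrier G - Z. \<kappa>' g \<in> carrier G \<and> (\<exists>f\<in>F'. g = f \<otimes> \<kappa>' g))
      \<and> (\<forall>g\<in>carrier G - Z. \<forall>c\<in>\<Gamma> m'. \<kappa>' (g \<otimes> c) = \<kappa>' g \<otimes> c)
      \<and> (\<forall>b\<in>E \<union> S. \<forall>g\<in>carrier G - Z. b \<otimes> g \<notin> Z \<longrightarrow> \<kappa>' (b \<otimes> g) = \<kappa>' g)"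
    using cut[rule_format, OF m'(3)] by (elim exE)
  then have perZ: "periodic m' Z" and cntZ: "real (coset_count m' Z) \<le> \<epsilon> * real (q m')"
    and cell': "\<And>g. g \<in> carrier G - Z \<Longrightarrow> \<kappa>' g \<in> carrier G \<and> (\<exists>f\<in>F'. g = f \<otimes> \<kappa>' g)"
    and equi': "\<And>g c. g \<in> carrier G - Z \<Longrightarrow> c \<in> \<Gamma> m' \<Longrightarrow> \<kappa>' (g \<otimes> c) = \<kappa>' g \<otimes> c"
    and adj': "\<And>b g. b \<in> E \<union> S \<Longrightarrow> g \<in> carrier G - Z \<Longrightarrow> b \<otimes> g \<notin> Z \<Longrightarrow> \<kappa>' (b \<otimes> g) = \<kappa>' g"
    unfolding coset_count_def by simp_all
  define Z' where "Z' = Z \<union> coset m' e \<union> coset m' p"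
  have perZ': "periodic m' Z'"
    unfolding Z'_def using perZ periodic_coset e UG[OF p] by (intro periodic_Un) simp_all
  have "real (coset_count m' Z') \<le> real (coset_count m' Z) + real (coset_count m' (coset m' e)) + real (coset_count m' (coset m' p))"
    unfolding Z'_def using coset_count_Un[of m' "Z \<union> coset m' e" "coset m' p"] coset_count_Un[of m' Z "coset m' e"] by linarith
  also have "\<dots> \<le> \<epsilon> * real (q m') + 1 + 1"
    using cntZ coset_count_coset[OF e, of m'] coset_count_coset[OF UG[OF p], of m'] by linarith
  also have "\<dots> \<le> 3 * \<epsilon> * real (q m')" using big by linarith
  finally have cntZ': "real (coset_count m' Z') \<le> 3 * \<epsilon> * real (q m')" .
  define R where "R = {g \<in> U. \<exists>h\<in>U. \<kappa> h = \<kappa> g \<and> h \<in> Z'}"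
  define U' where "U' = U - R"
  have perU': "periodic m' U" using periodic_antimono[OF perU m'(2)] .
  have Gm: "c \<in> \<Gamma> m' \<Longrightarrow> c \<in> \<Gamma> m" for c using Gam_antimono[OF m'(2)] by blast
  have perR: "periodic m' R"
  proof (rule periodicI)
    show "R \<subseteq> carrier G" using UG by (auto simp: R_def)
    fix g c assume g: "g \<in> R" and c: "c \<in> \<Gamma> m'"
    then obtain h where h: "h \<in> U" "\<kappa> h = \<kappa> g" "h \<in> Z'" "g \<in> U" by (auto simp: R_def)
    then have "h \<otimes> c \<in> U" "h \<otimes> c \<in> Z'" "g \<otimes> c \<in> U" "\<kappa> (h \<otimes> c) = \<kappa> (g \<otimes> c)"
      using periodic_mult[OF perU' _ c] periodic_mult[OF perZ' _ c] equi[OF _ Gm[OF c]] by simp_all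
    then show "g \<otimes> c \<in> R" unfolding R_def by blast
  qed
  have "coset_count m' R \<le> card S * coset_count m' Z'"
  proof (rule coset_count_translates[OF S])
    show "Z' \<subseteq> carrier G" using perZ' by (simp add: periodic_def)
    fix g assume "g \<in> R"
    then show "\<exists>s\<in>S. \<exists>z\<in>Z'. g = s \<otimes> z" using same_cell unfolding R_def by force
  qed
  then have "real (coset_count m' R) \<le> real (card S) * real (coset_count m' Z')" by (simp flip: of_nat_mult)
  also have "\<dots> \<le> real (card S) * (3 * \<epsilon> * real (q m'))" using cntZ' by (intro mult_left_mono) simp_all
  also have "\<dots> = (real (card S) * (3 * \<epsilon>)) * real (q m')" by simp
  also have "\<dots> \<le> d * real (q m')" using \<epsilon>(2) by (intro mult_right_mono) simp_all
  finally have probR: "prob (clo R) \<le> d"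
    unfolding measure_clo[OF perR] using q_pos[of m'] by (simp add: field_simps)
  have meets: "\<exists>c\<in>\<Gamma> m. g \<otimes> c \<in> U'" if g: "g \<in> U" for g
  proof (rule ccontr)
    assume no: "\<not> ?thesis"
    have sub: "coset m g \<subseteq> R"
      using no periodic_coset_subset[OF perU g] by (auto simp: U'_def l_coset_def)
    have "cyl m (coset m g) \<subseteq> clo R"
    proof
      fix \<xi> assume "\<xi> \<in> cyl m (coset m g)"
      then have \<xi>: "\<xi> \<in> Y" "\<xi> m = coset m g" by (simp_all add: cyl_def)
      then have "\<xi> m' \<subseteq> R" using odometer_antimono[OF \<xi>(1) m'(2)] sub by simp
      then show "\<xi> \<in> clo R" unfolding clo_periodic(2)[OF perR] using \<xi> by simp
    qed
    then have "prob (cyl m (coset m g)) \<le> prob (clo R)" using clo_sets by (rule finite_measure_mono)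
    then have "1 / real (q m) \<le> d"
      using probR measure_cyl[of "coset m g" m] UG[OF g] by (auto simp: lcosets_eq)
    then show False using d by simp
  qed
  have U'Z: "g \<in> carrier G - Z" if "g \<in> U'" for g
    using that UG by (auto simp: U'_def R_def Z'_def)
  have cells': "cells m' U' \<kappa>' F'"
    unfolding cells_def
  proof (intro conjI ballI)
    show "periodic m' U'" unfolding U'_def using perU' perR by (rule periodic_Diff)
    show "U' \<noteq> {}" using meets neU by blast
  qed (use F' cell'[OF U'Z] equi'[OF U'Z] in simp_all)
  have "refines E e p \<delta> m U \<kappa> m' U' \<kappa>'"
    unfolding refines_def
  proof (intro conjI ballI impI)
    show "m < m'" by (rule m'(1))
    show "U' \<subseteq> U" by (auto simp: U'_def)
    show "e \<notin> U'" using e by (auto simp: U'_def R_def Z'_def)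
    show "g \<in> U' \<longleftrightarrow> h \<in> U'" if "g \<in> U" "h \<in> U" "\<kappa> g = \<kappa> h" for g h
      using that by (simp add: U'_def R_def)
    show "\<exists>c\<in>\<Gamma> m. g \<otimes> c \<in> U'" if "g \<in> U" for g using meets[OF that] .
    show "g \<notin> U'" if g: "g \<in> U" "\<kappa> g \<in> coset m' (\<kappa> p)" for g
    proof -
      obtain c where c: "c \<in> \<Gamma> m'" "\<kappa> g = \<kappa> p \<otimes> c" using g(2) unfolding l_coset_def by blast
      then have "\<kappa> (p \<otimes> c) = \<kappa> g" using equi[OF p Gm[OF c(1)]] by simp
      moreover have "p \<otimes> c \<in> U" using periodic_mult[OF perU' p c(1)] .
      moreover have "p \<otimes> c \<in> Z'" using coset_mult[OF UG[OF p] c(1)] by (simp add: Z'_def)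
      ultimately show ?thesis using g(1) unfolding U'_def R_def by blast
    qed
    have "U - U' = R" by (auto simp: U'_def R_def)
    then show "prob (clo (U - U')) \<le> \<delta>" using probR d by simp
    show "\<kappa>' g = \<kappa>' h" if gh: "g \<in> U'" "h \<in> U'" "\<kappa> g = \<kappa> h" for g h
    proof -
      obtain s where s: "s \<in> S" "g = s \<otimes> h" using same_cell[of g h] gh by (auto simp: U'_def)
      then show ?thesis using adj'[of s h] U'Z[OF gh(2)] U'Z[OF gh(1)] by simp
    qed
    show "\<kappa>' (b \<otimes> g) = \<kappa>' g" if "b \<in> E" "g \<in> U'" "b \<otimes> g \<in> U'" for b g
      using adj'[of b g] U'Z that by blast
  qed
  then show ?thesis using cells' by blast
qed

text \<open>The task \<open>\<tau> N = (h, l)\<close> asks to work on some hole of the coset of \<open>h\<close> modulo \<open>\<Gamma> l\<close>, if one is left.\<close>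

definition target :: "(nat \<Rightarrow> 'a \<times> nat) \<Rightarrow> nat \<Rightarrow> 'a set \<Rightarrow> 'a" where
  "target \<tau> N U = (SOME p. p \<in> U \<and> (U \<inter> coset (snd (\<tau> N)) (fst (\<tau> N)) \<noteq> {} \<longrightarrow>
      p \<in> coset (snd (\<tau> N)) (fst (\<tau> N))))"

lemma target:
  assumes "U \<noteq> {}"
  shows "target \<tau> N U \<in> U"
    "U \<inter> coset (snd (\<tau> N)) (fst (\<tau> N)) \<noteq> {} \<Longrightarrow> target \<tau> N U \<in> coset (snd (\<tau> N)) (fst (\<tau> N))"
proof -
  have "\<exists>p. p \<in> U \<and> (U \<inter> coset (snd (\<tau> N)) (fst (\<tau> N)) \<noteq> {} \<longrightarrow> p \<in> coset (snd (\<tau> N)) (fst (\<tau> N)))"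
    using assms by blast
  from someI_ex[OF this]
  show "target \<tau> N U \<in> U"
    "U \<inter> coset (snd (\<tau> N)) (fst (\<tau> N)) \<noteq> {} \<Longrightarrow> target \<tau> N U \<in> coset (snd (\<tau> N)) (fst (\<tau> N))"
    unfolding target_def by blast+
qed

text \<open>The steps are iterated, with a set of neighbours that grows along the enumeration \<open>en\<close>.\<close>

lemma tower_exists:
  assumes en: "\<And>n. en n \<in> carrier G" and \<delta>: "\<And>n. \<delta> n > (0::real)"
  shows "\<exists>m U \<kappa> F. m 0 = m0 \<and> U 0 = carrier G \<and> (\<forall>n. cells (m n) (U n) (\<kappa> n) (F n)) \<and>
    (\<forall>n. refines (en ` {..n}) (en n) (target \<tau> n (U n)) (\<delta> n)
      (m n) (U n) (\<kappa> n) (m (Suc n)) (U (Suc n)) (\<kappa> (Suc n)))"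
proof -
  let ?C = "\<lambda>s. case s of (m, U, \<kappa>, F) \<Rightarrow> cells m U \<kappa> F"
  let ?R = "\<lambda>(n::nat) s s'. case s of (m, U, \<kappa>, F) \<Rightarrow> case s' of (m', U', \<kappa>', F') \<Rightarrow>
      refines (en ` {..n}) (en n) (target \<tau> n U) (\<delta> n) m U \<kappa> m' U' \<kappa>'"
  have init: "cells m0 (carrier G) (\<lambda>g. g) {\<one>}"
    unfolding cells_def by (auto intro: periodicI simp: Gam_carrier)
  have "\<exists>f. \<forall>n. (?C (f n) \<and> (n = 0 \<longrightarrow> f n = (m0, carrier G, \<lambda>g. g, {\<one>}))) \<and> ?R n (f n) (f (Suc n))"
  proof (rule dependent_nat_choice)
    show "\<exists>s. ?C s \<and> (0 = (0::nat) \<longrightarrow> s = (m0, carrier G, \<lambda>g. g, {\<one>}))"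
      using init by (intro exI[of _ "(m0, carrier G, \<lambda>g. g, {\<one>})"]) simp
    fix s and n :: nat assume s: "?C s \<and> (n = 0 \<longrightarrow> s = (m0, carrier G, \<lambda>g. g, {\<one>}))"
    obtain m U \<kappa> F where s_eq: "s = (m, U, \<kappa>, F)" by (cases s)
    have C: "cells m U \<kappa> F" using s s_eq by simp
    then have "target \<tau> n U \<in> U" using target(1) by (simp add: cells_def)
    then obtain m' U' \<kappa>' F' where "cells m' U' \<kappa>' F'"
      "refines (en ` {..n}) (en n) (target \<tau> n U) (\<delta> n) m U \<kappa> m' U' \<kappa>'"
      using refinement_exists[OF C _ _ en _ \<delta>, of "en ` {..n}" "target \<tau> n U" n n] en by blast
    then show "\<exists>s'. (?C s' \<and> (Suc n = 0 \<longrightarrow> s' = (m0, carrier G, \<lambda>g. g, {\<one>}))) \<and> ?R n s s'"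
      using s_eq by (intro exI[of _ "(m', U', \<kappa>', F')"]) simp
  qed
  then obtain f where f0: "\<forall>n. (?C (f n) \<and> (n = 0 \<longrightarrow> f n = (m0, carrier G, \<lambda>g. g, {\<one>}))) \<and> ?R n (f n) (f (Suc n))"
    by (rule exE)
  have f: "?C (f n)" "f 0 = (m0, carrier G, \<lambda>g. g, {\<one>})" "?R n (f n) (f (Suc n))" for n
    using spec[OF f0, of n] spec[OF f0, of 0] by simp_all
  show ?thesis
  proof (intro exI conjI allI)
    show "fst (f 0) = m0" "fst (snd (f 0)) = carrier G" using f(2) by simp_all
    show "cells (fst (f n)) (fst (snd (f n))) (fst (snd (snd (f n)))) (snd (snd (snd (f n))))" for n
      using f(1)[of n] by (simp add: case_prod_beta)
    show "refines (en ` {..n}) (en n) (target \<tau> n (fst (snd (f n)))) (\<delta> n)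
      (fst (f n)) (fst (snd (f n))) (fst (snd (snd (f n)))) (fst (f (Suc n))) (fst (snd (f (Suc n)))) (fst (snd (snd (f (Suc n)))))" for n
      using f(3)[of n] by (simp add: case_prod_beta)
  qed
qed

end

section \<open>Filling the holes of the tower\<close>

text \<open>What is used of the construction afterwards. \<open>P\<close> is the set of positions of the symbol \<open>1\<close>. Outside \<open>U n\<close>
it is periodic modulo \<open>\<Gamma> (m n)\<close>. A window \<open>K g\<close> shows on the holes of a late level one of the admissible
patterns (\<open>patterns\<close>), and all of these occur near \<open>g\<close>, in the sense of the odometer
(\<open>realized\<close>). The symbols in a suitable window around a position determine its coset modulo \<open>\<Gamma> n\<close>
(\<open>recognizable\<close>). Finally, the holes keep a positive density in each nonempty \<open>W j\<close> (\<open>U_dense\<close>).\<close>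

locale layered_array = haar_odometer +
  fixes P :: "'a set" and m :: "nat \<Rightarrow> nat" and U :: "nat \<Rightarrow> 'a set"
    and W :: "nat \<Rightarrow> 'a set" and k :: nat
  assumes k_ge_2: "2 \<le> k"
    and m_mono: "strict_mono m"
    and P_carrier: "P \<subseteq> carrier G"
    and U_periodic: "\<And>n. periodic (m n) (U n)"
    and U_Suc: "\<And>n. U (Suc n) \<subseteq> U n"
    and U_vanish: "\<And>g. g \<in> carrier G \<Longrightarrow> \<exists>n. g \<notin> U n"
    and P_const: "\<And>g n c. \<lbrakk>g \<in> carrier G; g \<notin> U n; c \<in> \<Gamma> (m n)\<rbrakk> \<Longrightarrow> g \<otimes> c \<in> P \<longleftrightarrow> g \<in> P"
    and W_0: "W 0 = {}"
    and W_periodic: "\<And>j. j < k \<Longrightarrow> periodic (m 0) (W j)"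
    and W_disjoint: "\<And>i j. \<lbrakk>i < k; j < k; i \<noteq> j\<rbrakk> \<Longrightarrow> W i \<inter> W j = {}"
    and patterns: "\<And>K. \<lbrakk>finite K; K \<subseteq> carrier G\<rbrakk> \<Longrightarrow> \<exists>n. \<forall>g\<in>carrier G.
        (\<exists>j<k. \<forall>b\<in>K. b \<otimes> g \<in> U n \<longrightarrow> (b \<otimes> g \<in> P \<longleftrightarrow> b \<otimes> g \<in> W j)) \<or>
        (\<exists>p\<in>K. \<forall>b\<in>K. b \<otimes> g \<in> U n \<longrightarrow> (b \<otimes> g \<in> P \<longleftrightarrow> b = p))"
    and realized: "\<And>K n0. \<lbrakk>finite K; K \<subseteq> carrier G\<rbrakk> \<Longrightarrow> \<exists>n\<ge>n0. \<forall>g\<in>carrier G.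
        (\<forall>j<k. \<exists>c\<in>\<Gamma> (m n). \<forall>b\<in>K. b \<otimes> g \<in> U n \<longrightarrow> (b \<otimes> g \<otimes> c \<in> P \<longleftrightarrow> b \<otimes> g \<in> W j)) \<and>
        (\<forall>p\<in>K. p \<otimes> g \<in> U n \<longrightarrow>
          (\<exists>c\<in>\<Gamma> (m n). \<forall>b\<in>K. b \<otimes> g \<in> U n \<longrightarrow> (b \<otimes> g \<otimes> c \<in> P \<longleftrightarrow> b = p)))"
    and recognizable: "\<And>n. \<exists>K. finite K \<and> K \<subseteq> carrier G \<and> (\<forall>g\<in>carrier G. \<forall>h\<in>carrier G.
        (\<forall>b\<in>K. b \<otimes> g \<in> P \<longleftrightarrow> b \<otimes> h \<in> P) \<longrightarrow> h \<in> coset n g)"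
    and U_dense: "\<exists>\<delta>>0. \<forall>n j. 0 < j \<longrightarrow> j < k \<longrightarrow> \<delta> \<le> prob (clo (U n \<inter> W j))"

text \<open>Step \<open>N\<close> performs the task \<open>\<tau> N\<close> with the pattern \<open>kind N\<close>: a number below \<open>k\<close> stands for the set
\<open>W (kind N)\<close>, any other number for a single \<open>1\<close>. The densities that the steps remove add up to at
most half of the density of a coset of \<open>\<Gamma> (m 0)\<close>.\<close>

locale cell_tower = haar_odometer +
  fixes k :: nat and en :: "nat \<Rightarrow> 'a" and \<tau> :: "nat \<Rightarrow> 'a \<times> nat" and kind :: "nat \<Rightarrow> nat"
    and m :: "nat \<Rightarrow> nat" and U :: "nat \<Rightarrow> 'a set" and \<kappa> :: "nat \<Rightarrow> 'a \<Rightarrow> 'a" and F :: "nat \<Rightarrow> 'a set"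
    and W :: "nat \<Rightarrow> 'a set"
  assumes k_ge_2: "2 \<le> k"
    and en: "range en = carrier G"
    and tasks: "\<And>h l t n0. h \<in> carrier G \<Longrightarrow> \<exists>N\<ge>n0. \<tau> N = (h, l) \<and> kind N = t"
    and U_0: "U 0 = carrier G"
    and cells: "\<And>n. cells (m n) (U n) (\<kappa> n) (F n)"
    and refines: "\<And>n. refines (en ` {..n}) (en n) (target \<tau> n (U n)) ((1/2) ^ (n + 2) / real (q (m 0)))
      (m n) (U n) (\<kappa> n) (m (Suc n)) (U (Suc n)) (\<kappa> (Suc n))"
    and W_0: "W 0 = {}"
    and W_coset: "\<And>j. 0 < j \<Longrightarrow> j < k \<Longrightarrow> \<exists>g\<in>carrier G. W j = coset (m 0) g"
    and W_disjoint: "\<And>i j. \<lbrakk>i < k; j < k; i \<noteq> j\<rbrakk> \<Longrightarrow> W i \<inter> W j = {}"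
begin

abbreviation tgt where "tgt N \<equiv> target \<tau> N (U N)"

definition R where "R N = U N - U (Suc N)"

text \<open>The ones written by step \<open>N\<close>. All cells that are closed in this step but are not translates of the
cell of the target are filled with zeros.\<close>

definition PN where "PN N = {g \<in> U N. \<kappa> N g \<in> coset (m (Suc N)) (\<kappa> N (tgt N)) \<and>
    (if kind N < k then g \<in> W (kind N) else g \<in> coset (m (Suc N)) (tgt N))}"

definition P where "P = (\<Union>N. PN N)"

lemma tower_step:
  "m n < m (Suc n)" "U (Suc n) \<subseteq> U n" "en n \<notin> U (Suc n)"
  "\<forall>g\<in>U n. \<forall>h\<in>U n. \<kappa> n g = \<kappa> n h \<longrightarrow> (g \<in> U (Suc n) \<longleftrightarrow> h \<in> U (Suc n))"
  "\<forall>g\<in>U n. \<kappa> n g \<in> coset (m (Suc n)) (\<kappa> n (tgt n)) \<longrightarrow> g \<notin> U (Suc n)"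
  "\<forall>g\<in>U n. \<exists>c\<in>\<Gamma> (m n). g \<otimes> c \<in> U (Suc n)"
  "prob (clo (R n)) \<le> (1/2) ^ (n + 2) / real (q (m 0))"
  "\<forall>g\<in>U (Suc n). \<forall>h\<in>U (Suc n). \<kappa> n g = \<kappa> n h \<longrightarrow> \<kappa> (Suc n) g = \<kappa> (Suc n) h"
  "\<forall>b\<in>en ` {..n}. \<forall>g\<in>U (Suc n). b \<otimes> g \<in> U (Suc n) \<longrightarrow> \<kappa> (Suc n) (b \<otimes> g) = \<kappa> (Suc n) g"
  using refines[of n] unfolding refines_def R_def by - (elim conjE, assumption)+

lemmas m_Suc = tower_step(1)
  and U_Suc = tower_step(2)
  and en_removed = tower_step(3)
  and saturated = tower_step(4)[rule_format]
  and target_removed = tower_step(5)[rule_format]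
  and meets_Suc = tower_step(6)[rule_format]
  and prob_R = tower_step(7)
  and coarser = tower_step(8)[rule_format]
  and adjacent = tower_step(9)[rule_format]

lemma cells_step:
  "periodic (m n) (U n)" "U n \<noteq> {}"
  "\<forall>g\<in>U n. \<kappa> n g \<in> carrier G \<and> (\<exists>f\<in>F n. g = f \<otimes> \<kappa> n g)"
  "\<forall>g\<in>U n. \<forall>c\<in>\<Gamma> (m n). \<kappa> n (g \<otimes> c) = \<kappa> n g \<otimes> c"
  using cells[of n] unfolding cells_def by - (elim conjE, assumption)+

lemmas U_periodic = cells_step(1)
  and U_nonempty = cells_step(2)
  and \<kappa>_carrier = cells_step(3)[rule_format, THEN conjunct1]
  and \<kappa>_equivariant = cells_step(4)[rule_format]

lemma U_carrier: "g \<in> U n \<Longrightarrow> g \<in> carrier G"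
  using periodic_carrier[OF U_periodic] .

lemma m_strict: "strict_mono m"
  using m_Suc by (simp add: strict_mono_Suc_iff)

lemma m_le: "i \<le> n \<Longrightarrow> m i \<le> m n"
  using m_strict by (simp add: strict_mono_less_eq)

lemma Gam_m: "i \<le> n \<Longrightarrow> c \<in> \<Gamma> (m n) \<Longrightarrow> c \<in> \<Gamma> (m i)"
  using Gam_antimono[OF m_le] by blast

lemma U_antimono: "i \<le> n \<Longrightarrow> U n \<subseteq> U i"
  using lift_Suc_antimono_le[of U i n] U_Suc by simp

lemma U_vanish: "g \<in> carrier G \<Longrightarrow> \<exists>n. g \<notin> U n"
  using en en_removed by (metis rangeE)

lemma tgt_in: "tgt N \<in> U N"
  using target(1)[OF U_nonempty] .

lemma W_periodic:
  assumes "j < k"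
  shows "periodic (m 0) (W j)"
proof (cases "j = 0")
  case True then show ?thesis using W_0 by (simp add: periodic_def)
next
  case False
  then obtain g where "g \<in> carrier G" "W j = coset (m 0) g" using W_coset assms by blast
  then show ?thesis using periodic_coset by simp
qed

lemma R_exists:
  assumes "g \<in> U i" "g \<notin> U n"
  shows "\<exists>N. i \<le> N \<and> N < n \<and> g \<in> R N"
proof -
  define l where "l = (LEAST l. g \<notin> U l)"
  have l: "g \<notin> U l" unfolding l_def using assms(2) by (rule LeastI)
  have below: "g \<in> U j" if "j < l" for j using not_less_Least[of j "\<lambda>l. g \<notin> U l"] that by (auto simp: l_def)
  have "l \<le> n" unfolding l_def using assms(2) by (rule Least_le)
  moreover have "i < l" using U_antimono[of l i] assms(1) l by (meson not_le subsetD)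
  ultimately have "i \<le> l - 1" "l - 1 < n" "Suc (l - 1) = l" by auto
  then show ?thesis using below[of "l - 1"] l by (intro exI[of _ "l - 1"]) (simp add: R_def)
qed

lemma R_unique:
  assumes "g \<in> R i" "g \<in> R n"
  shows "i = n"
proof (rule ccontr)
  assume "i \<noteq> n"
  then consider "Suc i \<le> n" | "Suc n \<le> i" by linarith
  then show False using U_antimono[of "Suc i" n] U_antimono[of "Suc n" i] assms unfolding R_def by cases blast+
qed

lemma R_periodic: "periodic (m (Suc N)) (R N)"
  unfolding R_def using periodic_antimono[OF U_periodic[of N] m_le[of N "Suc N"]] U_periodic
  by (intro periodic_Diff) simp_all

lemma PN_subset: "PN N \<subseteq> R N"
  using target_removed by (auto simp: PN_def R_def)

lemma PN_mult:
  assumes g: "g \<in> PN N" and c: "c \<in> \<Gamma> (m (Suc N))"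
  shows "g \<otimes> c \<in> PN N"
proof -
  have c': "c \<in> \<Gamma> (m N)" "c \<in> \<Gamma> (m 0)" using Gam_m[OF _ c] by simp_all
  have gU: "g \<in> U N" and k1: "\<kappa> N g \<in> coset (m (Suc N)) (\<kappa> N (tgt N))"
    and k2: "if kind N < k then g \<in> W (kind N) else g \<in> coset (m (Suc N)) (tgt N)"
    using g by (simp_all add: PN_def)
  have "g \<otimes> c \<in> U N" using periodic_mult[OF U_periodic gU c'(1)] .
  moreover have "\<kappa> N (g \<otimes> c) \<in> coset (m (Suc N)) (\<kappa> N (tgt N))"
    using periodic_mult[OF periodic_coset[OF \<kappa>_carrier[OF tgt_in]] k1 c] \<kappa>_equivariant[OF gU c'(1)] by simp
  moreover have "if kind N < k then g \<otimes> c \<in> W (kind N) else g \<otimes> c \<in> coset (m (Suc N)) (tgt N)"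
    using k2 periodic_mult[OF W_periodic _ c'(2), of "kind N" g]
      periodic_mult[OF periodic_coset[OF U_carrier[OF tgt_in]] _ c, of g] by simp
  ultimately show ?thesis by (simp add: PN_def)
qed

lemma PN_periodic: "periodic (m (Suc N)) (PN N)"
  using PN_mult U_carrier by (intro periodicI) (auto simp: PN_def)

lemma P_on_R: "g \<in> R N \<Longrightarrow> g \<in> P \<longleftrightarrow> g \<in> PN N"
  using PN_subset R_unique unfolding P_def by blast

lemma P_const:
  assumes g: "g \<in> carrier G" "g \<notin> U n" and c: "c \<in> \<Gamma> (m n)"
  shows "g \<otimes> c \<in> P \<longleftrightarrow> g \<in> P"
proof -
  obtain N where N: "N < n" "g \<in> R N" using R_exists[of g 0 n] g U_0 by blast
  have c': "c \<in> \<Gamma> (m (Suc N))" using Gam_m[OF _ c, of "Suc N"] N by simp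
  have "g \<otimes> c \<in> R N" using periodic_mult[OF R_periodic N(2) c'] .
  then show ?thesis
    using P_on_R[OF N(2)] P_on_R[of "g \<otimes> c" N] periodic_mult_iff[OF PN_periodic g(1) c'] by simp
qed

text \<open>Cells are closed as a whole and otherwise only grow; so two elements of a cell are closed in the same
step, as elements of the same cell.\<close>

lemma cell_persists:
  assumes "n \<le> N" "g \<in> U n" "h \<in> U n" "\<kappa> n g = \<kappa> n h" "g \<in> U N"
  shows "h \<in> U N \<and> \<kappa> N g = \<kappa> N h"
  using assms(1,5)
proof (induction N rule: dec_induct)
  case base then show ?case using assms by simp
next
  case (step N)
  have "g \<in> U N" using step U_Suc by blast
  then have IH: "h \<in> U N" "\<kappa> N g = \<kappa> N h" using step by simp_all
  then have "h \<in> U (Suc N)" using saturated[OF \<open>g \<in> U N\<close> IH] step by simp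
  then show ?case using coarser[OF step.prems _ IH(2)] by simp
qed

lemma cell_removed_together:
  assumes n: "n \<le> N" and gh: "g \<in> U n" "h \<in> U n" "\<kappa> n g = \<kappa> n h" and g: "g \<in> R N"
  shows "h \<in> R N \<and> \<kappa> N g = \<kappa> N h"
proof -
  have gN: "g \<in> U N" "g \<notin> U (Suc N)" using g by (simp_all add: R_def)
  have hN: "h \<in> U N" "\<kappa> N g = \<kappa> N h" using cell_persists[OF n gh gN(1)] by simp_all
  then show ?thesis using saturated[OF gN(1) hN] gN by (simp add: R_def)
qed

lemma meets:
  assumes "n \<le> N" "g \<in> U n"
  shows "\<exists>c\<in>\<Gamma> (m n). g \<otimes> c \<in> U N"
  using assms(1)
proof (induction N rule: dec_induct)
  case base then show ?case using assms U_carrier by (intro bexI[of _ \<one>]) simp_all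
next
  case (step N)
  then obtain c where c: "c \<in> \<Gamma> (m n)" "g \<otimes> c \<in> U N" by blast
  obtain d where d: "d \<in> \<Gamma> (m N)" "g \<otimes> c \<otimes> d \<in> U (Suc N)" using meets_Suc[OF c(2)] by blast
  have "g \<otimes> (c \<otimes> d) \<in> U (Suc N)"
    using d c(1) U_carrier[OF assms(2)] Gam_carrier by (simp add: m_assoc)
  then show ?case using Gam_mult[OF c(1) Gam_m[OF step(1) d(1)]] by blast
qed

lemma eventually_adjacent:
  assumes "finite D" "D \<subseteq> carrier G"
  shows "\<exists>n0. \<forall>n\<ge>n0. \<forall>b\<in>D. \<forall>g\<in>U n. b \<otimes> g \<in> U n \<longrightarrow> \<kappa> n (b \<otimes> g) = \<kappa> n g"
proof -
  have "D \<subseteq> range en" using assms en by simp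
  then obtain C where C: "finite C" "D = en ` C" using finite_subset_image[OF assms(1)] by blast
  then obtain j where j: "C \<subseteq> {..j}" using finite_nat_iff_bounded_le by blast
  have "\<kappa> n (b \<otimes> g) = \<kappa> n g" if "n \<ge> Suc j" "b \<in> D" "g \<in> U n" "b \<otimes> g \<in> U n" for n b g
  proof -
    define i where "i = n - 1"
    have i: "n = Suc i" "j \<le> i" using that(1) by (simp_all add: i_def)
    have "b \<in> en ` {..i}" using that(2) C j i by force
    then show ?thesis using adjacent[of b i g] that i by simp
  qed
  then show ?thesis by blast
qed

text \<open>The quotients of the elements of a finite window form a finite set, which consists of neighbours from
some level on.\<close>

lemma window_in_cell:
  assumes K: "finite K" "K \<subseteq> carrier G"
  shows "\<exists>n0. \<forall>n\<ge>n0. \<forall>g\<in>carrier G. \<forall>b\<in>K. \<forall>b'\<in>K. b \<otimes> g \<in> U n \<longrightarrow> b' \<otimes> g \<in> U n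
      \<longrightarrow> \<kappa> n (b' \<otimes> g) = \<kappa> n (b \<otimes> g)"
proof -
  define D where "D = (\<lambda>(b', b). b' \<otimes> inv b) ` (K \<times> K)"
  have "finite D" "D \<subseteq> carrier G" using K by (auto simp: D_def)
  then obtain n0 where n0: "\<forall>n\<ge>n0. \<forall>d\<in>D. \<forall>g\<in>U n. d \<otimes> g \<in> U n \<longrightarrow> \<kappa> n (d \<otimes> g) = \<kappa> n g"
    using eventually_adjacent by blast
  have "\<kappa> n (b' \<otimes> g) = \<kappa> n (b \<otimes> g)"
    if n: "n \<ge> n0" and g: "g \<in> carrier G" and b: "b \<in> K" "b' \<in> K" and bU: "b \<otimes> g \<in> U n" "b' \<otimes> g \<in> U n" for n g b b'
  proof -
    have G: "b \<in> carrier G" "b' \<in> carrier G" using b K by blast+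
    have eq: "(b' \<otimes> inv b) \<otimes> (b \<otimes> g) = b' \<otimes> g" using G g by (simp add: m_assoc mult_inv_cancel)
    have "b' \<otimes> inv b \<in> D" using b unfolding D_def by force
    then have "(b' \<otimes> inv b) \<otimes> (b \<otimes> g) \<in> U n \<longrightarrow> \<kappa> n ((b' \<otimes> inv b) \<otimes> (b \<otimes> g)) = \<kappa> n (b \<otimes> g)"
      using n0 n bU(1) by blast
    then show ?thesis unfolding eq using bU(2) by blast
  qed
  then show ?thesis by blast
qed

text \<open>As \<open>\<kappa>\<close> is equivariant, different elements of the coset of the target have different centres.\<close>

lemma single_in_cell:
  assumes "g \<in> coset (m (Suc N)) (tgt N)" "h \<in> coset (m (Suc N)) (tgt N)" "\<kappa> N g = \<kappa> N h"
  shows "g = h"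
proof -
  obtain c d where c: "c \<in> \<Gamma> (m (Suc N))" "g = tgt N \<otimes> c" and d: "d \<in> \<Gamma> (m (Suc N))" "h = tgt N \<otimes> d"
    using assms unfolding l_coset_def by blast
  have G: "c \<in> carrier G" "d \<in> carrier G" using c d Gam_carrier by blast+
  have "\<kappa> N (tgt N) \<otimes> c = \<kappa> N (tgt N) \<otimes> d"
    using assms(3) \<kappa>_equivariant[OF tgt_in Gam_m[OF _ c(1)]] \<kappa>_equivariant[OF tgt_in Gam_m[OF _ d(1)]] c(2) d(2) by simp
  then have "c = d" using \<kappa>_carrier[OF tgt_in] G by simp
  then show ?thesis using c d by simp
qed

text \<open>All holes of a window belong to one cell, so they are closed together, in the step \<open>N\<close> that closes
one of them; the pattern that they receive is the one used for this cell.\<close>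

lemma patterns:
  assumes K: "finite K" "K \<subseteq> carrier G"
  shows "\<exists>n. \<forall>g\<in>carrier G.
        (\<exists>j<k. \<forall>b\<in>K. b \<otimes> g \<in> U n \<longrightarrow> (b \<otimes> g \<in> P \<longleftrightarrow> b \<otimes> g \<in> W j)) \<or>
        (\<exists>p\<in>K. \<forall>b\<in>K. b \<otimes> g \<in> U n \<longrightarrow> (b \<otimes> g \<in> P \<longleftrightarrow> b = p))"
proof -
  obtain n where n: "\<forall>n'\<ge>n. \<forall>g\<in>carrier G. \<forall>b\<in>K. \<forall>b'\<in>K. b \<otimes> g \<in> U n' \<longrightarrow> b' \<otimes> g \<in> U n'
      \<longrightarrow> \<kappa> n' (b' \<otimes> g) = \<kappa> n' (b \<otimes> g)" using window_in_cell[OF K] by blast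
  have k0: "0 < k" using k_ge_2 by simp
  have "(\<exists>j<k. \<forall>b\<in>K. b \<otimes> g \<in> U n \<longrightarrow> (b \<otimes> g \<in> P \<longleftrightarrow> b \<otimes> g \<in> W j)) \<or>
        (\<exists>p\<in>K. \<forall>b\<in>K. b \<otimes> g \<in> U n \<longrightarrow> (b \<otimes> g \<in> P \<longleftrightarrow> b = p))" if g: "g \<in> carrier G" for g
  proof (cases "\<exists>b\<in>K. b \<otimes> g \<in> U n")
    case False
    then show ?thesis using k0 by blast
  next
    case True
    then obtain b0 where b0: "b0 \<in> K" "b0 \<otimes> g \<in> U n" by blast
    obtain l where "b0 \<otimes> g \<notin> U l" using U_vanish[OF U_carrier[OF b0(2)]] by blast
    then obtain N where N: "n \<le> N" "b0 \<otimes> g \<in> R N" using R_exists[OF b0(2)] by blast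
    have all: "b \<otimes> g \<in> R N \<and> \<kappa> N (b0 \<otimes> g) = \<kappa> N (b \<otimes> g)" if b: "b \<in> K" "b \<otimes> g \<in> U n" for b
    proof -
      have "\<kappa> n (b0 \<otimes> g) = \<kappa> n (b \<otimes> g)" using n g b b0 by blast
      then show ?thesis using cell_removed_together[OF N(1) b0(2) b(2) _ N(2)] by blast
    qed
    have val: "b \<otimes> g \<in> P \<longleftrightarrow> \<kappa> N (b0 \<otimes> g) \<in> coset (m (Suc N)) (\<kappa> N (tgt N)) \<and>
        (if kind N < k then b \<otimes> g \<in> W (kind N) else b \<otimes> g \<in> coset (m (Suc N)) (tgt N))"
      if b: "b \<in> K" "b \<otimes> g \<in> U n" for b
      using all[OF b] P_on_R[of "b \<otimes> g" N] unfolding PN_def R_def by simp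
    show ?thesis
    proof (cases "\<kappa> N (b0 \<otimes> g) \<in> coset (m (Suc N)) (\<kappa> N (tgt N))")
      case False
      then have "\<forall>b\<in>K. b \<otimes> g \<in> U n \<longrightarrow> (b \<otimes> g \<in> P \<longleftrightarrow> b \<otimes> g \<in> W 0)" using val W_0 by simp
      then show ?thesis using k0 by blast
    next
      case hit: True
      show ?thesis
      proof (cases "kind N < k")
        case True
        then have "\<forall>b\<in>K. b \<otimes> g \<in> U n \<longrightarrow> (b \<otimes> g \<in> P \<longleftrightarrow> b \<otimes> g \<in> W (kind N))" using val hit by simp
        then show ?thesis using True by blast
      next
        case single: False
        show ?thesis
        proof (cases "\<exists>p\<in>K. p \<otimes> g \<in> U n \<and> p \<otimes> g \<in> coset (m (Suc N)) (tgt N)")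
          case True
          then obtain p where p: "p \<in> K" "p \<otimes> g \<in> U n" "p \<otimes> g \<in> coset (m (Suc N)) (tgt N)" by blast
          have "b = p" if b: "b \<in> K" "b \<otimes> g \<in> U n" "b \<otimes> g \<in> coset (m (Suc N)) (tgt N)" for b
          proof -
            have "\<kappa> N (b \<otimes> g) = \<kappa> N (p \<otimes> g)" using all[OF b(1,2)] all[OF p(1,2)] by simp
            then have "b \<otimes> g = p \<otimes> g" using single_in_cell[OF b(3) p(3)] by simp
            moreover have "b \<in> carrier G" "p \<in> carrier G" using b(1) p(1) K by blast+
            ultimately show ?thesis using g by simp
          qed
          then have "\<forall>b\<in>K. b \<otimes> g \<in> U n \<longrightarrow> (b \<otimes> g \<in> P \<longleftrightarrow> b = p)"
            using val hit single p(3) by auto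
          then show ?thesis using p(1) by blast
        next
          case False
          then have "\<forall>b\<in>K. b \<otimes> g \<in> U n \<longrightarrow> (b \<otimes> g \<in> P \<longleftrightarrow> b \<otimes> g \<in> W 0)" using val single W_0 by simp
          then show ?thesis using k0 by blast
        qed
      qed
    qed
  qed
  then show ?thesis by blast
qed

text \<open>The task that asks for the hole \<open>b0 \<otimes> g\<close> and the pattern \<open>t\<close> comes up after step \<open>n\<close>. By then this hole
may be closed, but some translate of it by \<open>\<Gamma> (m n)\<close> is still open, and so is the same translate of
all the holes of the window.\<close>

lemma task_performed:
  assumes n: "\<forall>g\<in>carrier G. \<forall>b\<in>K. \<forall>b'\<in>K. b \<otimes> g \<in> U n \<longrightarrow> b' \<otimes> g \<in> U n
      \<longrightarrow> \<kappa> n (b' \<otimes> g) = \<kappa> n (b \<otimes> g)"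
    and K: "K \<subseteq> carrier G" and g: "g \<in> carrier G" and b0: "b0 \<in> K" "b0 \<otimes> g \<in> U n"
  shows "\<exists>c\<in>\<Gamma> (m n). \<forall>b\<in>K. b \<otimes> g \<in> U n \<longrightarrow>
    (b \<otimes> g \<otimes> c \<in> P \<longleftrightarrow> (if t < k then b \<otimes> g \<in> W t else b = b0))"
proof -
  have b0g: "b0 \<otimes> g \<in> carrier G" using U_carrier[OF b0(2)] .
  obtain N where N: "N \<ge> n" "\<tau> N = (b0 \<otimes> g, m n)" "kind N = t" using tasks[OF b0g] by blast
  obtain c' where c': "c' \<in> \<Gamma> (m n)" "b0 \<otimes> g \<otimes> c' \<in> U N" using meets[OF N(1) b0(2)] by blast
  have "U N \<inter> coset (m n) (b0 \<otimes> g) \<noteq> {}" using c' coset_mult[OF b0g c'(1)] by blast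
  then have "tgt N \<in> coset (m n) (b0 \<otimes> g)" using target(2)[OF U_nonempty, of N \<tau> N] N(2) by simp
  then obtain c where c: "c \<in> \<Gamma> (m n)" "tgt N = b0 \<otimes> g \<otimes> c" unfolding l_coset_def by blast
  have cG: "c \<in> carrier G" using c Gam_carrier by blast
  have tR: "tgt N \<in> R N" using tgt_in target_removed[OF tgt_in] \<kappa>_carrier[OF tgt_in] self_in_coset
    by (simp add: R_def)
  have tn: "b0 \<otimes> g \<otimes> c \<in> U n" using periodic_mult[OF U_periodic b0(2) c(1)] .
  have "b \<otimes> g \<otimes> c \<in> P \<longleftrightarrow> (if t < k then b \<otimes> g \<in> W t else b = b0)" if b: "b \<in> K" "b \<otimes> g \<in> U n" for b
  proof -
    have G: "b \<in> carrier G" "b0 \<in> carrier G" using b b0 K by blast+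
    have bn: "b \<otimes> g \<otimes> c \<in> U n" using periodic_mult[OF U_periodic b(2) c(1)] .
    have "\<kappa> n (b0 \<otimes> g) = \<kappa> n (b \<otimes> g)" using n g b b0 by blast
    then have "\<kappa> n (b0 \<otimes> g \<otimes> c) = \<kappa> n (b \<otimes> g \<otimes> c)"
      using \<kappa>_equivariant[OF b0(2) c(1)] \<kappa>_equivariant[OF b(2) c(1)] by simp
    then have bR: "b \<otimes> g \<otimes> c \<in> R N" "\<kappa> N (b \<otimes> g \<otimes> c) = \<kappa> N (tgt N)"
      using cell_removed_together[OF N(1) tn bn] tR c(2) by simp_all
    have "b \<otimes> g \<otimes> c \<in> P \<longleftrightarrow> (if t < k then b \<otimes> g \<otimes> c \<in> W t else b \<otimes> g \<otimes> c \<in> coset (m (Suc N)) (tgt N))"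
      using P_on_R[OF bR(1)] bR N(3) \<kappa>_carrier[OF tgt_in, of N] unfolding PN_def R_def by simp
    also have "\<dots> \<longleftrightarrow> (if t < k then b \<otimes> g \<in> W t else b = b0)"
    proof (cases "t < k")
      case True
      then show ?thesis using periodic_mult_iff[OF W_periodic[OF True] _ Gam_m[OF _ c(1)], of "b \<otimes> g"] G g by simp
    next
      case False
      have "b \<otimes> g \<otimes> c \<in> coset (m (Suc N)) (tgt N) \<longleftrightarrow> b = b0"
      proof
        assume "b \<otimes> g \<otimes> c \<in> coset (m (Suc N)) (tgt N)"
        then have "b \<otimes> g \<otimes> c = tgt N"
          using single_in_cell[OF _ self_in_coset[OF U_carrier[OF tgt_in]]] bR(2) by simp
        then have "b \<otimes> g \<otimes> c = b0 \<otimes> g \<otimes> c" using c(2) by simp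
        then show "b = b0" using G g cG by simp
      next
        assume "b = b0"
        then show "b \<otimes> g \<otimes> c \<in> coset (m (Suc N)) (tgt N)"
          using c(2) self_in_coset[OF U_carrier[OF tgt_in[of N]], of "m (Suc N)"] by simp
      qed
      then show ?thesis using False by simp
    qed
    finally show ?thesis .
  qed
  then show ?thesis using c(1) by blast
qed

lemma realized:
  assumes K: "finite K" "K \<subseteq> carrier G"
  shows "\<exists>n\<ge>n0. \<forall>g\<in>carrier G.
        (\<forall>j<k. \<exists>c\<in>\<Gamma> (m n). \<forall>b\<in>K. b \<otimes> g \<in> U n \<longrightarrow> (b \<otimes> g \<otimes> c \<in> P \<longleftrightarrow> b \<otimes> g \<in> W j)) \<and>
        (\<forall>p\<in>K. p \<otimes> g \<in> U n \<longrightarrow>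
          (\<exists>c\<in>\<Gamma> (m n). \<forall>b\<in>K. b \<otimes> g \<in> U n \<longrightarrow> (b \<otimes> g \<otimes> c \<in> P \<longleftrightarrow> b = p)))"
proof -
  obtain n1 where n1: "\<forall>n\<ge>n1. \<forall>g\<in>carrier G. \<forall>b\<in>K. \<forall>b'\<in>K. b \<otimes> g \<in> U n \<longrightarrow> b' \<otimes> g \<in> U n
      \<longrightarrow> \<kappa> n (b' \<otimes> g) = \<kappa> n (b \<otimes> g)" using window_in_cell[OF K] by blast
  define n where "n = max n0 n1"
  have "n1 \<le> n" by (simp add: n_def)
  have n: "\<forall>g\<in>carrier G. \<forall>b\<in>K. \<forall>b'\<in>K. b \<otimes> g \<in> U n \<longrightarrow> b' \<otimes> g \<in> U n
      \<longrightarrow> \<kappa> n (b' \<otimes> g) = \<kappa> n (b \<otimes> g)" using n1 \<open>n1 \<le> n\<close> by blast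
  have "n \<ge> n0" by (simp add: n_def)
  moreover have "\<exists>c\<in>\<Gamma> (m n). \<forall>b\<in>K. b \<otimes> g \<in> U n \<longrightarrow> (b \<otimes> g \<otimes> c \<in> P \<longleftrightarrow> b \<otimes> g \<in> W j)"
    if g: "g \<in> carrier G" and j: "j < k" for g j
  proof (cases "\<exists>b\<in>K. b \<otimes> g \<in> U n")
    case True
    then obtain b0 where "b0 \<in> K" "b0 \<otimes> g \<in> U n" by blast
    from task_performed[OF n K(2) g this, of j] show ?thesis using j by simp
  next
    case False
    then show ?thesis by (intro bexI[of _ \<one>]) simp_all
  qed
  moreover have "\<exists>c\<in>\<Gamma> (m n). \<forall>b\<in>K. b \<otimes> g \<in> U n \<longrightarrow> (b \<otimes> g \<otimes> c \<in> P \<longleftrightarrow> b = p)"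
    if g: "g \<in> carrier G" and p: "p \<in> K" "p \<otimes> g \<in> U n" for g p
    using task_performed[OF n K(2) g p, of k] by simp
  ultimately show ?thesis by blast
qed

text \<open>A coset of a hole contains ones and zeros, since the single \<open>1\<close> and the pattern \<open>W 0 = {}\<close> are
both realized in it.\<close>

lemma nonconstant:
  assumes t: "t \<in> U i"
  shows "\<exists>a\<in>coset (m i) t. a \<in> P \<longleftrightarrow> v"
proof -
  have tG: "t \<in> carrier G" using U_carrier[OF t] .
  obtain n where n: "n \<ge> i" "\<forall>g\<in>carrier G.
        (\<forall>j<k. \<exists>c\<in>\<Gamma> (m n). \<forall>b\<in>{\<one>}. b \<otimes> g \<in> U n \<longrightarrow> (b \<otimes> g \<otimes> c \<in> P \<longleftrightarrow> b \<otimes> g \<in> W j)) \<and>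
        (\<forall>p\<in>{\<one>}. p \<otimes> g \<in> U n \<longrightarrow>
          (\<exists>c\<in>\<Gamma> (m n). \<forall>b\<in>{\<one>}. b \<otimes> g \<in> U n \<longrightarrow> (b \<otimes> g \<otimes> c \<in> P \<longleftrightarrow> b = p)))"
    using realized[of "{\<one>}" i] by auto
  obtain d where d: "d \<in> \<Gamma> (m i)" "t \<otimes> d \<in> U n" using meets[OF n(1) t] by blast
  have dG: "d \<in> carrier G" using d Gam_carrier by blast
  have tdG: "t \<otimes> d \<in> carrier G" using tG dG by simp
  have "\<exists>c\<in>\<Gamma> (m n). t \<otimes> d \<otimes> c \<in> P \<longleftrightarrow> v"
  proof (cases v)
    case True
    then show ?thesis using n(2)[rule_format, OF tdG] d(2) tdG tG dG by auto
  next
    case False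
    have "0 < k" using k_ge_2 by simp
    then show ?thesis using n(2)[rule_format, OF tdG] d(2) tdG tG dG False W_0 by force
  qed
  then obtain c where c: "c \<in> \<Gamma> (m n)" "t \<otimes> d \<otimes> c \<in> P \<longleftrightarrow> v" by blast
  have cG: "c \<in> carrier G" using c Gam_carrier by blast
  have "d \<otimes> c \<in> \<Gamma> (m i)" using Gam_mult[OF d(1) Gam_m[OF n(1) c(1)]] .
  then have "t \<otimes> (d \<otimes> c) \<in> coset (m i) t" using coset_mult[OF tG] by blast
  then show ?thesis using c(2) tG dG cG by (intro bexI[of _ "t \<otimes> (d \<otimes> c)"]) (simp_all add: m_assoc)
qed

text \<open>A uniform finite version of the preceding lemma: there are only finitely many cosets of holes, and each
of the ones and zeros that witness the claim persists on a coset of some deeper level \<open>L\<close>.\<close>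

lemma finite_nonconstant:
  "\<exists>S. finite S \<and> S \<subseteq> \<Gamma> (m i) \<and> (\<forall>h\<in>U i. \<exists>s\<in>S. \<not> (s \<otimes> h \<in> P \<longleftrightarrow> h \<in> P))"
proof -
  obtain T where T: "finite T" "T \<subseteq> carrier G" "\<And>g. g \<in> carrier G \<Longrightarrow> \<exists>t\<in>T. t \<in> coset (m i) g"
    using finite_transversal[of "m i"] by blast
  have "\<exists>a. a \<in> coset (m i) t \<and> (a \<in> P \<longleftrightarrow> v)" if "t \<in> U i" for t v using nonconstant[OF that, of v] by blast
  then obtain a where a: "\<And>t v. t \<in> U i \<Longrightarrow> a t v \<in> coset (m i) t \<and> (a t v \<in> P \<longleftrightarrow> v)" by metis
  have aG: "a t v \<in> carrier G" if "t \<in> U i" for t v using a[OF that] coset_carrier[OF U_carrier[OF that]] by blast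
  have "\<exists>l. t \<in> U i \<longrightarrow> a t v \<notin> U l" for t v using U_vanish aG by blast
  then obtain l where l: "\<And>t v. t \<in> U i \<Longrightarrow> a t v \<notin> U (l t v)" by metis
  define L where "L = Max (insert i ((\<lambda>(t, v). l t v) ` (T \<times> UNIV)))"
  have fin: "finite (insert i ((\<lambda>(t, v). l t v) ` (T \<times> (UNIV :: bool set))))" using T by simp
  have "i \<le> L" unfolding L_def using fin by (rule Max_ge) simp
  have lL: "l t v \<le> L" if "t \<in> T" for t v
    unfolding L_def using fin by (rule Max_ge) (use that in force)
  obtain T' where T': "finite T'" "T' \<subseteq> carrier G" "\<And>g. g \<in> carrier G \<Longrightarrow> \<exists>t\<in>T'. t \<in> coset (m L) g"
    using finite_transversal[of "m L"] by blast
  have "\<exists>s\<in>T' \<inter> \<Gamma> (m i). \<not> (s \<otimes> h \<in> P \<longleftrightarrow> h \<in> P)" if h: "h \<in> U i" for h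
  proof -
    have hG: "h \<in> carrier G" using U_carrier[OF h] .
    obtain t where t: "t \<in> T" "t \<in> coset (m i) h" using T(3)[OF hG] by blast
    have tU: "t \<in> U i" using periodic_coset_subset[OF U_periodic h] t by blast
    define x where "x = a t (\<not> (h \<in> P))"
    have x: "x \<in> coset (m i) t" "x \<in> P \<longleftrightarrow> \<not> (h \<in> P)" "x \<in> carrier G" "x \<notin> U L"
      using a[OF tU, of "\<not> (h \<in> P)"] aG[OF tU, of "\<not> (h \<in> P)"] l[OF tU, of "\<not> (h \<in> P)"]
        U_antimono[OF lL[OF t(1), of "\<not> (h \<in> P)"]] unfolding x_def by auto
    have "x \<in> coset (m i) h" using x(1) coset_eqI[OF hG t(2)] by simp
    then obtain c where c: "c \<in> \<Gamma> (m i)" "x = h \<otimes> c" unfolding l_coset_def by blast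
    have xh: "x \<otimes> inv h \<in> \<Gamma> (m i)" unfolding c(2) using Gam_conj[OF c(1) hG] .
    have xhG: "x \<otimes> inv h \<in> carrier G" using x hG by simp
    obtain s where s: "s \<in> T'" "s \<in> coset (m L) (x \<otimes> inv h)" using T'(3)[OF xhG] by blast
    then obtain d where d: "d \<in> \<Gamma> (m L)" "s = x \<otimes> inv h \<otimes> d" unfolding l_coset_def by blast
    have "s \<in> \<Gamma> (m i)" unfolding d(2) using Gam_mult[OF xh Gam_m[OF \<open>i \<le> L\<close> d(1)]] .
    moreover have "s \<otimes> h \<in> coset (m L) x"
      using coset_right_mem[OF xhG hG d(1)] d(2) x(3) hG by (simp add: m_assoc)
    then obtain e where e: "e \<in> \<Gamma> (m L)" "s \<otimes> h = x \<otimes> e" unfolding l_coset_def by blast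
    have "s \<otimes> h \<in> P \<longleftrightarrow> x \<in> P" unfolding e(2) using P_const[OF x(3,4) e(1)] .
    ultimately show ?thesis using s(1) x(2) by blast
  qed
  then show ?thesis using T'(1) by (intro exI[of _ "T' \<inter> \<Gamma> (m i)"]) simp
qed

text \<open>Take a step \<open>N \<ge> n\<close> that writes a single \<open>1\<close> per cell. Its ones form exactly one coset, so the
position of \<open>g\<close> modulo \<open>\<Gamma> (m (Suc N))\<close> is known once these ones are told from the ones of other
steps. The step in which a position is closed can be read off finitely many
symbols by the preceding lemma: as long as the position is a hole, its coset is not constant.\<close>

lemma recognizable:
  "\<exists>K. finite K \<and> K \<subseteq> carrier G \<and> (\<forall>g\<in>carrier G. \<forall>h\<in>carrier G.
        (\<forall>b\<in>K. b \<otimes> g \<in> P \<longleftrightarrow> b \<otimes> h \<in> P) \<longrightarrow> h \<in> coset n g)"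
proof -
  obtain N where N: "N \<ge> n" "kind N = k" using tasks[OF one_closed] by blast
  let ?M = "m (Suc N)"
  have nM: "n \<le> ?M" using N strict_mono_imp_increasing[OF m_strict, of "Suc N"] by linarith
  have PN: "PN N = coset ?M (tgt N)"
  proof (intro equalityI subsetI)
    fix g assume "g \<in> coset ?M (tgt N)"
    then obtain c where c: "c \<in> \<Gamma> ?M" "g = tgt N \<otimes> c" unfolding l_coset_def by blast
    have c': "c \<in> \<Gamma> (m N)" using Gam_m[OF _ c(1)] by simp
    have "\<kappa> N g \<in> coset ?M (\<kappa> N (tgt N))"
      unfolding c(2) \<kappa>_equivariant[OF tgt_in c'] using coset_mult[OF \<kappa>_carrier[OF tgt_in] c(1)] .
    then show "g \<in> PN N"
      using periodic_mult[OF U_periodic tgt_in c'] c \<open>g \<in> coset ?M (tgt N)\<close> N(2) by (simp add: PN_def)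
  qed (use N(2) in \<open>simp add: PN_def\<close>)
  have "\<forall>i. \<exists>S. finite S \<and> S \<subseteq> \<Gamma> (m i) \<and> (\<forall>h\<in>U i. \<exists>s\<in>S. \<not> (s \<otimes> h \<in> P \<longleftrightarrow> h \<in> P))"
    using finite_nonconstant by blast
  then obtain S where S: "\<And>i. finite (S i)" "\<And>i. S i \<subseteq> \<Gamma> (m i)"
    "\<And>i h. h \<in> U i \<Longrightarrow> \<exists>s\<in>S i. \<not> (s \<otimes> h \<in> P \<longleftrightarrow> h \<in> P)" by metis
  obtain T where T: "finite T" "T \<subseteq> carrier G" "\<And>g. g \<in> carrier G \<Longrightarrow> \<exists>t\<in>T. t \<in> coset ?M g"
    using finite_transversal[of ?M] by blast
  define K where "K = T \<union> (\<Union>i\<in>{..Suc N}. (\<lambda>(s, b). s \<otimes> b) ` (S i \<times> T))"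
  have SG: "s \<in> carrier G" if "s \<in> S i" for s i using S(2) that Gam_carrier by blast
  have "finite K" unfolding K_def using T S(1) by simp
  moreover have "K \<subseteq> carrier G" unfolding K_def using T(2) SG by auto
  moreover have "h \<in> coset n g" if g: "g \<in> carrier G" and h: "h \<in> carrier G"
    and agree: "\<forall>b\<in>K. b \<otimes> g \<in> P \<longleftrightarrow> b \<otimes> h \<in> P" for g h
  proof -
    have pG: "tgt N \<in> carrier G" using U_carrier[OF tgt_in] .
    have xG: "tgt N \<otimes> inv g \<in> carrier G" using pG g by simp
    obtain b where b: "b \<in> T" "b \<in> coset ?M (tgt N \<otimes> inv g)" using T(3)[OF xG] by blast
    obtain c where c: "c \<in> \<Gamma> ?M" "b = tgt N \<otimes> inv g \<otimes> c" using b(2) unfolding l_coset_def by blast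
    have bG: "b \<in> carrier G" using b T by blast
    have "b \<otimes> g \<in> coset ?M (tgt N)"
      using coset_right_mem[OF xG g c(1)] c(2) pG g by (simp add: m_assoc)
    then have bgN: "b \<otimes> g \<in> PN N" using PN by simp
    have bg: "b \<otimes> g \<in> P" using bgN by (auto simp: P_def)
    have bK: "b \<in> K" using b by (simp add: K_def)
    have sbK: "s \<otimes> b \<in> K" if "s \<in> S i" "i \<le> Suc N" for s i using that b unfolding K_def by force
    have bgG: "b \<otimes> g \<in> carrier G" "b \<otimes> h \<in> carrier G" using bG g h by simp_all
    have const: "s \<otimes> x \<in> P \<longleftrightarrow> x \<in> P" if "s \<in> S i" "x \<in> carrier G" "x \<notin> U i" for s i x
    proof -
      have s: "s \<in> \<Gamma> (m i)" using that S(2) by blast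
      have "s \<otimes> x \<in> coset (m i) x" using coset_right_mem[OF one_closed that(2) s] that(2) SG[OF that(1)] by simp
      then obtain d where d: "d \<in> \<Gamma> (m i)" "s \<otimes> x = x \<otimes> d" unfolding l_coset_def by blast
      show ?thesis unfolding d(2) using P_const[OF that(2,3) d(1)] .
    qed
    have assoc: "s \<otimes> (b \<otimes> g) \<in> P \<longleftrightarrow> s \<otimes> (b \<otimes> h) \<in> P" if "s \<in> S i" "i \<le> Suc N" for s i
      using agree sbK[OF that] SG[OF that(1)] bG g h by (simp add: m_assoc[symmetric])
    have "b \<otimes> h \<in> P" using agree bK bg by blast
    then obtain i where i: "b \<otimes> h \<in> PN i" by (auto simp: P_def)
    have bhR: "b \<otimes> h \<in> U i" "b \<otimes> h \<notin> U (Suc i)" using PN_subset i by (auto simp: R_def)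
    have bgR: "b \<otimes> g \<in> U N" "b \<otimes> g \<notin> U (Suc N)" using PN_subset bgN by (auto simp: R_def)
    \<comment> \<open>\<open>g\<close> and \<open>h\<close> see the same symbols, so \<open>b \<otimes> h\<close> is closed in the step in which \<open>b \<otimes> g\<close> is closed.\<close>
    have "i = N"
    proof (rule ccontr)
      assume "i \<noteq> N"
      then consider "Suc i \<le> N" | "Suc N \<le> i" by linarith
      then show False
      proof cases
        case 1
        then have "b \<otimes> g \<in> U (Suc i)" using bgR U_antimono by blast
        then obtain s where s: "s \<in> S (Suc i)" "\<not> (s \<otimes> (b \<otimes> g) \<in> P \<longleftrightarrow> b \<otimes> g \<in> P)" using S(3) by blast
        then show False using assoc[OF s(1)] const[OF s(1) bgG(2) bhR(2)] 1 bg \<open>b \<otimes> h \<in> P\<close> by simp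
      next
        case 2
        then have "b \<otimes> h \<in> U (Suc N)" using bhR U_antimono by blast
        then obtain s where s: "s \<in> S (Suc N)" "\<not> (s \<otimes> (b \<otimes> h) \<in> P \<longleftrightarrow> b \<otimes> h \<in> P)" using S(3) by blast
        then show False using assoc[OF s(1)] const[OF s(1) bgG(1) bgR(2)] bg \<open>b \<otimes> h \<in> P\<close> by simp
      qed
    qed
    then have "b \<otimes> h \<in> coset ?M (tgt N)" using i PN by simp
    then have "b \<otimes> h \<in> coset ?M (b \<otimes> g)" using coset_eqI[OF pG \<open>b \<otimes> g \<in> coset ?M (tgt N)\<close>] by simp
    then have "inv (b \<otimes> g) \<otimes> (b \<otimes> h) \<in> \<Gamma> ?M" using mem_coset_iff[OF bgG(1)] by blast
    then have "inv g \<otimes> h \<in> \<Gamma> ?M" using bG g h by (simp add: inv_mult_group m_assoc mult_inv_cancel)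
    then have "h \<in> coset ?M g" using mem_coset_iff[OF g] h by blast
    then show ?thesis using coset_antimono[OF nM] by blast
  qed
  ultimately show ?thesis by blast
qed

text \<open>The steps remove at most the density \<open>1 / (4 q) + 1 / (8 q) + \<dots> = 1 / (2 q)\<close> from the coset \<open>W j\<close>
of density \<open>1 / q\<close>, where \<open>q = q (m 0)\<close>.\<close>

lemma U_dense:
  assumes j: "0 < j" "j < k"
  shows "1 / (2 * real (q (m 0))) \<le> prob (clo (U n \<inter> W j))"
proof -
  obtain w where w: "w \<in> carrier G" "W j = coset (m 0) w" using W_coset[OF j] by blast
  have perUW: "periodic (m n) (U n \<inter> W j)"
    using periodic_Int[OF U_periodic periodic_antimono[OF W_periodic[OF j(2)] m_le]] by simp
  have "cyl (m 0) (W j) \<subseteq> clo (U n \<inter> W j) \<union> (\<Union>i\<in>{..<n}. clo (R i))"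
  proof
    fix \<xi> assume "\<xi> \<in> cyl (m 0) (W j)"
    then have \<xi>: "\<xi> \<in> Y" "\<xi> (m 0) = W j" by (simp_all add: cyl_def)
    obtain g where g: "g \<in> carrier G" "g \<in> \<xi> (m n)" using odometer_ex[OF \<xi>(1)] by blast
    have gi: "g \<in> \<xi> (m i)" if "i \<le> n" for i using odometer_antimono[OF \<xi>(1) m_le[OF that]] g(2) by blast
    show "\<xi> \<in> clo (U n \<inter> W j) \<union> (\<Union>i\<in>{..<n}. clo (R i))"
    proof (cases "g \<in> U n")
      case True
      then have "g \<in> \<xi> (m n) \<inter> (U n \<inter> W j)" using g gi[of 0] \<xi>(2) by simp
      then show ?thesis unfolding clo_periodic(1)[OF perUW] using \<xi>(1) by blast
    next
      case False
      then obtain i where i: "i < n" "g \<in> R i" using R_exists[of g 0 n] U_0 g by blast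
      then have "g \<in> \<xi> (m (Suc i)) \<inter> R i" using gi by simp
      then have "\<xi> \<in> clo (R i)" unfolding clo_periodic(1)[OF R_periodic] using \<xi>(1) by blast
      then show ?thesis using i(1) by blast
    qed
  qed
  then have "prob (cyl (m 0) (W j)) \<le> prob (clo (U n \<inter> W j) \<union> (\<Union>i\<in>{..<n}. clo (R i)))"
    using clo_sets by (intro finite_measure_mono) auto
  also have "\<dots> \<le> prob (clo (U n \<inter> W j)) + prob (\<Union>i\<in>{..<n}. clo (R i))"
    using clo_sets by (intro measure_Un_le) auto
  also have "prob (\<Union>i\<in>{..<n}. clo (R i)) \<le> (\<Sum>i<n. prob (clo (R i)))"
    using clo_sets by (intro finite_measure_subadditive_finite) auto
  also have "(\<Sum>i<n. prob (clo (R i))) \<le> (\<Sum>i<n. (1/2) ^ (i + 2) / real (q (m 0)))"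
    using prob_R by (rule sum_mono)
  also have "\<dots> = (\<Sum>i<n. (1/2) ^ i) / (4 * real (q (m 0)))"
    by (simp add: sum_divide_distrib power_add)
  also have "(\<Sum>i<n. (1/2::real) ^ i) \<le> 2"
    using sum_gp_strict[of "1/2::real" n] by simp
  finally have "prob (cyl (m 0) (W j)) \<le> prob (clo (U n \<inter> W j)) + 2 / (4 * real (q (m 0)))"
    by (simp add: divide_right_mono)
  moreover have "prob (cyl (m 0) (W j)) = 1 / real (q (m 0))"
    using measure_cyl[of "W j" "m 0"] w by (auto simp: lcosets_eq)
  ultimately show ?thesis by (simp add: field_simps)
qed

lemma layered: "layered_array G \<Gamma> \<nu> P m U W k"
proof
  show "\<exists>\<delta>>0. \<forall>n j. 0 < j \<longrightarrow> j < k \<longrightarrow> \<delta> \<le> prob (clo (U n \<inter> W j))"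
    using U_dense q_pos[of "m 0"] by (intro exI[of _ "1 / (2 * real (q (m 0)))"]) simp
  show "P \<subseteq> carrier G" using PN_subset U_carrier by (auto simp: P_def R_def)
qed (fact k_ge_2 m_strict U_periodic U_Suc U_vanish P_const W_0 W_periodic W_disjoint patterns realized recognizable)+

end

lemma (in haar_odometer) layered_array_exists:
  assumes k: "2 \<le> k"
  shows "\<exists>P m U W. layered_array G \<Gamma> \<nu> P m U W k"
proof -
  obtain m0 where m0: "k \<le> q m0" using q_unbounded by blast
  then obtain f where f: "inj_on f {..<k}" "f ` {..<k} \<subseteq> lcosets (\<Gamma> m0)"
    using card_le_inj[of "{..<k}" "lcosets (\<Gamma> m0)"] finite_lcosets by (auto simp: q_def)
  define W where "W = (\<lambda>j. if j = 0 then {} else f j)"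
  define en where "en = from_nat_into (carrier G)"
  have en: "range en = carrier G"
    unfolding en_def using countable_carrier carrier_not_empty by (intro range_from_nat_into)
  \<comment> \<open>The second component of \<open>prod_decode N\<close> does not enter the task, so every task occurs infinitely often.\<close>
  define dec where "dec = (\<lambda>N. prod_decode (fst (prod_decode N)))"
  define \<tau> where "\<tau> = (\<lambda>N. (en (fst (dec N)), fst (prod_decode (snd (dec N)))))"
  define kind where "kind = (\<lambda>N. snd (prod_decode (snd (dec N))))"
  have tasks: "\<exists>N\<ge>n0. \<tau> N = (h, l) \<and> kind N = t" if "h \<in> carrier G" for h l t n0
  proof -
    obtain i where "h = en i" using \<open>h \<in> carrier G\<close> unfolding en[symmetric] by blast
    then show ?thesis
      by (intro exI[of _ "prod_encode (prod_encode (i, prod_encode (l, t)), n0)"])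
        (simp add: \<tau>_def kind_def dec_def le_prod_encode_2)
  qed
  have enG: "en n \<in> carrier G" for n using en by blast
  have \<delta>: "(1/2) ^ (n + 2) / real (q m0) > (0::real)" for n using q_pos[of m0] by simp
  obtain m U \<kappa> F where "m 0 = m0 \<and> U 0 = carrier G \<and> (\<forall>n. cells (m n) (U n) (\<kappa> n) (F n)) \<and>
    (\<forall>n. refines (en ` {..n}) (en n) (target \<tau> n (U n)) ((1/2) ^ (n + 2) / real (q m0))
      (m n) (U n) (\<kappa> n) (m (Suc n)) (U (Suc n)) (\<kappa> (Suc n)))"
    using tower_exists[of en "\<lambda>n. (1/2) ^ (n + 2) / real (q m0)" m0 \<tau>, OF enG \<delta>] by (elim exE)
  then have tower: "m 0 = m0" "U 0 = carrier G" "\<And>n. cells (m n) (U n) (\<kappa> n) (F n)"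
    "\<And>n. refines (en ` {..n}) (en n) (target \<tau> n (U n)) ((1/2) ^ (n + 2) / real (q m0))
      (m n) (U n) (\<kappa> n) (m (Suc n)) (U (Suc n)) (\<kappa> (Suc n))"
    by blast+
  interpret cell_tower G \<Gamma> \<nu> k en \<tau> kind m U \<kappa> F W
  proof
    show "\<exists>g\<in>carrier G. W j = coset (m 0) g" if "0 < j" "j < k" for j
      using f(2) that tower(1) by (auto simp: W_def lcosets_eq)
    show "W i \<inter> W j = {}" if "i < k" "j < k" "i \<noteq> j" for i j
    proof (cases "i = 0 \<or> j = 0")
      case False
      have "f i \<noteq> f j" using inj_onD[OF f(1), of i j] that by auto
      then have "f i \<inter> f j = {}" using lcos_disjoint[OF subgroup_Gam] f(2) that by blast
      then show ?thesis using False by (simp add: W_def)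
    qed (auto simp: W_def)
  qed (use k en tasks tower in \<open>simp_all add: W_def\<close>)
  show ?thesis using layered by blast
qed

section \<open>The subshift\<close>

context layered_array
begin

lemma m_le: "i \<le> n \<Longrightarrow> m i \<le> m n"
  using m_mono by (simp add: strict_mono_less_eq)

lemma le_m: "n \<le> m n"
  using strict_mono_imp_increasing[OF m_mono] .

lemma U_antimono: "i \<le> n \<Longrightarrow> U n \<subseteq> U i"
  using lift_Suc_antimono_le[of U i n] U_Suc by simp

definition array_of :: "'a set \<Rightarrow> 'a \<Rightarrow> nat" where
  "array_of A = (\<lambda>h\<in>carrier G. if h \<in> A then 1 else 0)"

definition x0 :: "'a \<Rightarrow> nat" where "x0 = array_of P"

abbreviation FS where "FS \<equiv> full_shift G"
abbreviation sh where "sh \<equiv> shift_action G"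
abbreviation X where "X \<equiv> orbit_closure G x0"
abbreviation XT where "XT \<equiv> orbit_closure_top G x0"

lemma topspace_FS: "topspace FS = PiE (carrier G) (\<lambda>_. {0, 1})"
  by (simp add: full_shift_def)

lemma array_of_FS: "array_of A \<in> topspace FS"
  by (simp add: topspace_FS array_of_def)

lemma array_of_eq_1: "h \<in> carrier G \<Longrightarrow> array_of A h = 1 \<longleftrightarrow> h \<in> A"
  by (simp add: array_of_def)

lemma FS_eqI:
  assumes y: "y \<in> topspace FS" "z \<in> topspace FS" and eq: "\<And>h. h \<in> carrier G \<Longrightarrow> y h = 1 \<longleftrightarrow> z h = 1"
  shows "y = z"
proof (rule PiE_ext)
  show "y \<in> PiE (carrier G) (\<lambda>_. {0, 1})" "z \<in> PiE (carrier G) (\<lambda>_. {0, 1})" using y topspace_FS by simp_all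
  fix h assume h: "h \<in> carrier G"
  then have "y h \<in> {0, 1}" "z h \<in> {0, 1}" using y topspace_FS by (auto dest: PiE_mem)
  then show "y h = z h" using eq[OF h] by auto
qed

lemma sh_apply: "h \<in> carrier G \<Longrightarrow> sh g y h = y (h \<otimes> g)"
  by (simp add: shift_action_def)

lemma sh_FS: "g \<in> carrier G \<Longrightarrow> y \<in> topspace FS \<Longrightarrow> sh g y \<in> topspace FS"
  unfolding topspace_FS shift_action_def by (rule restrict_PiE_iff[THEN iffD2]) (auto dest: PiE_mem)

lemma openin_FS_window:
  assumes K: "finite K" "K \<subseteq> carrier G"
  shows "openin FS {z \<in> topspace FS. \<forall>b\<in>K. z b = y b}"
proof -
  have "openin FS {z \<in> topspace FS. z b \<in> {y b} \<inter> {0, 1}}" if "b \<in> K" for b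
    unfolding full_shift_def
    by (rule openin_continuous_map_preimage[OF continuous_map_product_projection]) (use that K in auto)
  then have "openin FS (topspace FS \<inter> (\<Inter>b\<in>K. {z \<in> topspace FS. z b \<in> {y b} \<inter> {0, 1}}))"
    using K by (cases "K = {}") (auto intro!: openin_Int openin_Inter)
  moreover have "z b \<in> {0, 1}" if "z \<in> topspace FS" "b \<in> K" for z b
    using that K unfolding topspace_FS by (auto dest: PiE_mem)
  then have "topspace FS \<inter> (\<Inter>b\<in>K. {z \<in> topspace FS. z b \<in> {y b} \<inter> {0, 1}})
      = {z \<in> topspace FS. \<forall>b\<in>K. z b = y b}" by fastforce
  ultimately show ?thesis by simp
qed

lemma FS_window:
  assumes "openin FS T" "y \<in> T"
  shows "\<exists>K. finite K \<and> K \<subseteq> carrier G \<and> (\<forall>z\<in>topspace FS. (\<forall>b\<in>K. z b = y b) \<longrightarrow> z \<in> T)"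
proof -
  obtain V where V: "finite {i \<in> carrier G. V i \<noteq> topspace (discrete_topology {0, 1::nat})}"
    "y \<in> PiE (carrier G) V" "PiE (carrier G) V \<subseteq> T"
    using assms unfolding full_shift_def openin_product_topology_alt by blast
  define K where "K = {i \<in> carrier G. V i \<noteq> topspace (discrete_topology {0, 1::nat})}"
  have "z \<in> T" if z: "z \<in> topspace FS" "\<forall>b\<in>K. z b = y b" for z
  proof -
    have "z \<in> PiE (carrier G) V"
    proof (rule PiE_I)
      fix i assume i: "i \<in> carrier G"
      show "z i \<in> V i"
      proof (cases "i \<in> K")
        case True
        then show ?thesis using z(2) PiE_mem[OF V(2) i] by simp
      next
        case False
        then have "V i = {0, 1}" using i by (simp add: K_def)
        then show ?thesis using z(1) i unfolding topspace_FS by (auto dest: PiE_mem)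
      qed
    next
      fix i assume "i \<notin> carrier G"
      then show "z i = undefined" using z(1) unfolding topspace_FS by (rule PiE_arb[rotated])
    qed
    then show ?thesis using V(3) by blast
  qed
  then show ?thesis using V(1) by (intro exI[of _ K]) (auto simp: K_def)
qed

lemma X_closure: "y \<in> X \<longleftrightarrow> y \<in> topspace FS \<and> (\<forall>T. y \<in> T \<and> openin FS T \<longrightarrow> (\<exists>g\<in>carrier G. sh g x0 \<in> T))"
  unfolding orbit_closure_def in_closure_of by (rule conj_cong[OF refl], rule all_cong1) auto

lemma X_iff:
  "y \<in> X \<longleftrightarrow> y \<in> topspace FS \<and> (\<forall>K. finite K \<longrightarrow> K \<subseteq> carrier G \<longrightarrow>
     (\<exists>g\<in>carrier G. \<forall>b\<in>K. y b = 1 \<longleftrightarrow> b \<otimes> g \<in> P))" (is "?L \<longleftrightarrow> ?R")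
proof
  have eq: "y b = sh g x0 b \<longleftrightarrow> (y b = 1 \<longleftrightarrow> b \<otimes> g \<in> P)"
    if "y \<in> topspace FS" "b \<in> carrier G" "g \<in> carrier G" for y b g
  proof -
    have "y b \<in> {0, 1}" using that unfolding topspace_FS by (auto dest: PiE_mem)
    then show ?thesis using that by (auto simp: sh_apply x0_def array_of_def)
  qed
  {
    assume y: ?L
    then have yFS: "y \<in> topspace FS" using X_closure by simp
    have "\<exists>g\<in>carrier G. \<forall>b\<in>K. y b = 1 \<longleftrightarrow> b \<otimes> g \<in> P" if K: "finite K" "K \<subseteq> carrier G" for K
    proof -
      have "y \<in> {z \<in> topspace FS. \<forall>b\<in>K. z b = y b}" using yFS by simp
      then obtain g where g: "g \<in> carrier G" "sh g x0 \<in> {z \<in> topspace FS. \<forall>b\<in>K. z b = y b}"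
        using y openin_FS_window[OF K, of y] unfolding X_closure by meson
      have "y b = 1 \<longleftrightarrow> b \<otimes> g \<in> P" if b: "b \<in> K" for b
      proof -
        have "b \<in> carrier G" "y b = sh g x0 b" using g(2) b K by auto
        then show ?thesis using eq[OF yFS _ g(1), of b] by simp
      qed
      then show ?thesis using g by blast
    qed
    then show ?R using yFS by blast
  }
  {
    assume R: ?R
    then have yFS: "y \<in> topspace FS" by blast
    show ?L
      unfolding X_closure
    proof (intro conjI allI impI)
      show "y \<in> topspace FS" by (rule yFS)
      fix T assume T: "y \<in> T \<and> openin FS T"
      then obtain K where K: "finite K" "K \<subseteq> carrier G" "\<forall>z\<in>topspace FS. (\<forall>b\<in>K. z b = y b) \<longrightarrow> z \<in> T"
        using FS_window[OF conjunct2[OF T] conjunct1[OF T]] by (elim exE conjE)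
      then obtain g where g: "g \<in> carrier G" "\<forall>b\<in>K. y b = 1 \<longleftrightarrow> b \<otimes> g \<in> P" using R by blast
      have "\<forall>b\<in>K. sh g x0 b = y b" 
      proof
        fix b assume b: "b \<in> K"
        then have "b \<in> carrier G" using K(2) by blast
        then show "sh g x0 b = y b" using eq[OF yFS _ g(1), of b] g(2) b by simp
      qed
      then have "sh g x0 \<in> T" using K(3) sh_FS[OF g(1), of x0] array_of_FS[of P] by (simp add: x0_def)
      then show "\<exists>g\<in>carrier G. sh g x0 \<in> T" using g(1) by blast
    qed
  }
qed

lemma X_FS: "y \<in> X \<Longrightarrow> y \<in> topspace FS"
  using X_iff by blast

lemma X_approx: "y \<in> X \<Longrightarrow> finite K \<Longrightarrow> K \<subseteq> carrier G \<Longrightarrow> \<exists>g\<in>carrier G. \<forall>b\<in>K. y b = 1 \<longleftrightarrow> b \<otimes> g \<in> P"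
  using X_iff by blast

lemma topspace_XT: "topspace XT = X"
  unfolding orbit_closure_top_def using X_FS by auto

lemma openin_XT_window:
  assumes K: "finite K" "K \<subseteq> carrier G"
  shows "openin XT {z \<in> X. \<forall>b\<in>K. z b = y b}"
proof -
  have "{z \<in> X. \<forall>b\<in>K. z b = y b} = {z \<in> topspace FS. \<forall>b\<in>K. z b = y b} \<inter> X" using X_FS by blast
  then show ?thesis unfolding orbit_closure_top_def openin_subtopology
    by (intro exI[of _ "{z \<in> topspace FS. \<forall>b\<in>K. z b = y b}"] conjI openin_FS_window[OF K])
qed

lemma XT_window:
  assumes "openin XT T" "y \<in> T"
  shows "\<exists>K. finite K \<and> K \<subseteq> carrier G \<and> (\<forall>z\<in>X. (\<forall>b\<in>K. z b = y b) \<longrightarrow> z \<in> T)"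
proof -
  obtain T' where T': "openin FS T'" "T = T' \<inter> X"
    using assms(1) unfolding orbit_closure_top_def openin_subtopology by blast
  then obtain K where "finite K" "K \<subseteq> carrier G" "\<forall>z\<in>topspace FS. (\<forall>b\<in>K. z b = y b) \<longrightarrow> z \<in> T'"
    using FS_window[OF T'(1), of y] assms(2) by auto
  then show ?thesis using T'(2) X_FS by (intro exI[of _ K]) simp
qed

lemma X_sh:
  assumes g: "g \<in> carrier G" and y: "y \<in> X"
  shows "sh g y \<in> X"
  unfolding X_iff
proof (intro conjI allI impI)
  show "sh g y \<in> topspace FS" using sh_FS[OF g X_FS[OF y]] .
  fix K assume K: "finite K" "K \<subseteq> carrier G"
  then have "finite ((\<lambda>b. b \<otimes> g) ` K)" "(\<lambda>b. b \<otimes> g) ` K \<subseteq> carrier G" using g by auto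
  then obtain r where r: "r \<in> carrier G" "\<forall>b\<in>(\<lambda>b. b \<otimes> g) ` K. y b = 1 \<longleftrightarrow> b \<otimes> r \<in> P"
    using X_approx[OF y] by blast
  have "sh g y b = 1 \<longleftrightarrow> b \<otimes> (g \<otimes> r) \<in> P" if b: "b \<in> K" for b
  proof -
    have bG: "b \<in> carrier G" using b K by blast
    have "y (b \<otimes> g) = 1 \<longleftrightarrow> b \<otimes> g \<otimes> r \<in> P" using r(2) b by blast
    then show ?thesis using sh_apply[OF bG, of g y] m_assoc[OF bG g r(1)] by simp
  qed
  then show "\<exists>r\<in>carrier G. \<forall>b\<in>K. sh g y b = 1 \<longleftrightarrow> b \<otimes> r \<in> P"
    using g r(1) by (intro bexI[of _ "g \<otimes> r"]) simp_all
qed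

lemma sh_sh: "g \<in> carrier G \<Longrightarrow> h \<in> carrier G \<Longrightarrow> sh (g \<otimes> h) y = sh g (sh h y)"
  unfolding shift_action_def by (rule restrict_ext) (simp add: m_assoc)

lemma sh_one: "y \<in> topspace FS \<Longrightarrow> sh \<one> y = y"
  by (rule FS_eqI) (simp_all add: sh_FS sh_apply)

lemma compact_XT: "compact_space XT"
proof -
  have "compact_space FS"
    unfolding full_shift_def compact_space_product_topology compact_space_discrete_topology by simp
  then have "compactin FS X"
    unfolding orbit_closure_def by (rule closedin_compact_space) simp
  then show ?thesis unfolding orbit_closure_top_def by (rule compact_space_subtopology)
qed

lemma x0_X: "x0 \<in> X"
  unfolding X_iff
proof (intro conjI allI impI)
  show "x0 \<in> topspace FS" unfolding x0_def by (rule array_of_FS)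
  fix K assume "finite K" "K \<subseteq> carrier G"
  then show "\<exists>g\<in>carrier G. \<forall>b\<in>K. x0 b = 1 \<longleftrightarrow> b \<otimes> g \<in> P"
    by (intro bexI[of _ \<one>] ballI) (auto simp: x0_def array_of_def subset_iff)
qed

section \<open>The factor map\<close>

definition code_window :: "nat \<Rightarrow> 'a set" where
  "code_window n = (SOME K. finite K \<and> K \<subseteq> carrier G \<and> (\<forall>g\<in>carrier G. \<forall>h\<in>carrier G.
        (\<forall>b\<in>K. b \<otimes> g \<in> P \<longleftrightarrow> b \<otimes> h \<in> P) \<longrightarrow> h \<in> coset n g))"

lemma code_window: "finite (code_window n)" "code_window n \<subseteq> carrier G"
  "\<lbrakk>g \<in> carrier G; h \<in> carrier G; \<forall>b\<in>code_window n. b \<otimes> g \<in> P \<longleftrightarrow> b \<otimes> h \<in> P\<rbrakk> \<Longrightarrow> h \<in> coset n g"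
  using someI_ex[OF recognizable[of n]] unfolding code_window_def[symmetric] by blast+

text \<open>The coset of \<open>y\<close> at level \<open>n\<close> is that of any \<open>g\<close> for which \<open>y\<close> and the translate of the array by \<open>g\<close> agree on the
window \<open>code_window n\<close>.\<close>

definition \<beta> :: "('a \<Rightarrow> nat) \<Rightarrow> nat \<Rightarrow> 'a set" where
  "\<beta> y = (\<lambda>n. coset n (SOME g. g \<in> carrier G \<and> (\<forall>b\<in>code_window n. y b = 1 \<longleftrightarrow> b \<otimes> g \<in> P)))"

lemma \<beta>_eq:
  assumes g: "g \<in> carrier G" "\<forall>b\<in>code_window n. y b = 1 \<longleftrightarrow> b \<otimes> g \<in> P"
  shows "\<beta> y n = coset n g"
proof -
  define r where "r = (SOME g. g \<in> carrier G \<and> (\<forall>b\<in>code_window n. y b = 1 \<longleftrightarrow> b \<otimes> g \<in> P))"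
  have r: "r \<in> carrier G \<and> (\<forall>b\<in>code_window n. y b = 1 \<longleftrightarrow> b \<otimes> r \<in> P)"
    unfolding r_def by (rule someI[of _ g]) (use g in blast)
  have "r \<in> coset n g" by (rule code_window(3)) (use g r in blast)+
  then show ?thesis using coset_eqI[OF g(1)] unfolding \<beta>_def r_def[symmetric] by simp
qed

lemma \<beta>_approx:
  assumes y: "y \<in> X" and K: "finite K" "K \<subseteq> carrier G"
  shows "\<exists>g\<in>carrier G. g \<in> \<beta> y n \<and> (\<forall>b\<in>K. y b = 1 \<longleftrightarrow> b \<otimes> g \<in> P)"
proof -
  obtain g where g: "g \<in> carrier G" "\<forall>b\<in>K \<union> code_window n. y b = 1 \<longleftrightarrow> b \<otimes> g \<in> P"
    using X_approx[OF y, of "K \<union> code_window n"] K code_window by blast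
  then have "\<beta> y n = coset n g" using \<beta>_eq[of g n y] by blast
  then show ?thesis using g by (intro bexI[of _ g]) simp_all
qed

lemma \<beta>_in: "y \<in> X \<Longrightarrow> \<beta> y \<in> Y"
proof (rule odometerI)
  assume y: "y \<in> X"
  fix n
  obtain g where g: "g \<in> carrier G" "\<forall>b\<in>code_window n \<union> code_window (Suc n). y b = 1 \<longleftrightarrow> b \<otimes> g \<in> P"
    using X_approx[OF y, of "code_window n \<union> code_window (Suc n)"] code_window by blast
  then have "\<beta> y n = coset n g" "\<beta> y (Suc n) = coset (Suc n) g"
    using \<beta>_eq[of g n y] \<beta>_eq[of g "Suc n" y] by blast+
  then show "\<beta> y n \<in> lcosets (\<Gamma> n)" "\<beta> y (Suc n) \<subseteq> \<beta> y n"
    using g(1) coset_antimono[of n "Suc n" g] by (auto simp: lcosets_eq)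
qed

lemma \<beta>_sh:
  assumes g: "g \<in> carrier G" and y: "y \<in> X"
  shows "\<beta> (sh g y) = act g (\<beta> y)"
proof
  fix n
  have K: "finite ((\<lambda>b. b \<otimes> g) ` code_window n)" "(\<lambda>b. b \<otimes> g) ` code_window n \<subseteq> carrier G" using g code_window(1,2)[of n] by auto
  obtain r where r: "r \<in> carrier G" "r \<in> \<beta> y n" "\<forall>b\<in>(\<lambda>b. b \<otimes> g) ` code_window n. y b = 1 \<longleftrightarrow> b \<otimes> r \<in> P"
    using \<beta>_approx[OF y K, of n] by blast
  have "sh g y b = 1 \<longleftrightarrow> b \<otimes> (g \<otimes> r) \<in> P" if b: "b \<in> code_window n" for b
  proof -
    have bG: "b \<in> carrier G" using b code_window(2) by blast
    have "y (b \<otimes> g) = 1 \<longleftrightarrow> b \<otimes> g \<otimes> r \<in> P" using r(3) b by blast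
    then show ?thesis using sh_apply[OF bG, of g y] m_assoc[OF bG g r(1)] by simp
  qed
  then have "\<beta> (sh g y) n = coset n (g \<otimes> r)" using g r(1) by (intro \<beta>_eq) simp_all
  then show "\<beta> (sh g y) n = act g (\<beta> y) n" using act_mem[OF g \<beta>_in[OF y] r(2)] by simp
qed

lemma \<beta>_window: "\<forall>b\<in>code_window n. z b = y b \<Longrightarrow> \<beta> z n = \<beta> y n"
  unfolding \<beta>_def by simp

lemma continuous_\<beta>: "continuous_map XT YT \<beta>"
  unfolding continuous_map_def topspace_XT topspace_YT
proof (intro conjI allI impI)
  show "\<beta> \<in> X \<rightarrow> Y" using \<beta>_in by blast
  fix V assume V: "openin YT V"
  have "\<exists>T. openin XT T \<and> y \<in> T \<and> T \<subseteq> {x \<in> X. \<beta> x \<in> V}" if "y \<in> {x \<in> X. \<beta> x \<in> V}" for y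
  proof -
    have y: "y \<in> X" "\<beta> y \<in> V" using that by simp_all
    obtain n where n: "cyl n (\<beta> y n) \<subseteq> V" using V y(2) unfolding openin_YT_iff by blast
    have "{z \<in> X. \<forall>b\<in>code_window n. z b = y b} \<subseteq> {x \<in> X. \<beta> x \<in> V}"
    proof
      fix z assume "z \<in> {z \<in> X. \<forall>b\<in>code_window n. z b = y b}"
      then have z: "z \<in> X" "\<forall>b\<in>code_window n. z b = y b" by simp_all
      then have "\<beta> z \<in> cyl n (\<beta> y n)" using \<beta>_in[OF z(1)] \<beta>_window[OF z(2)] by (simp add: cyl_def)
      then show "z \<in> {x \<in> X. \<beta> x \<in> V}" using n z(1) by blast
    qed
    moreover have "y \<in> {z \<in> X. \<forall>b\<in>code_window n. z b = y b}" using y by simp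
    ultimately show ?thesis
      by (intro exI[of _ "{z \<in> X. \<forall>b\<in>code_window n. z b = y b}"] conjI openin_XT_window[OF code_window(1,2)])
  qed
  then show "openin XT {x \<in> X. \<beta> x \<in> V}" using openin_subopen[of XT "{x \<in> X. \<beta> x \<in> V}"] by blast
qed

section \<open>Fibres\<close>

lemma act_clo_iff:
  assumes A: "periodic l A" and \<xi>: "\<xi> \<in> Y" and h: "h \<in> carrier G" and r: "r \<in> \<xi> l"
  shows "act h \<xi> \<in> clo A \<longleftrightarrow> h \<otimes> r \<in> A"
proof -
  have rG: "r \<in> carrier G" using odometer_mem(1)[OF \<xi> r] .
  have "act h \<xi> \<in> clo A \<longleftrightarrow> act h \<xi> l \<inter> A \<noteq> {}"
    unfolding clo_periodic(1)[OF A] using act_in[OF h \<xi>] by simp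
  also have "\<dots> \<longleftrightarrow> coset l (h \<otimes> r) \<inter> A \<noteq> {}" using act_mem[OF h \<xi> r] by simp
  also have "\<dots> \<longleftrightarrow> h \<otimes> r \<in> A"
  proof
    assume "coset l (h \<otimes> r) \<inter> A \<noteq> {}"
    then obtain x where "x \<in> coset l (h \<otimes> r)" "x \<in> A" by blast
    then show "h \<otimes> r \<in> A" using periodic_mem_iff[OF A, of "h \<otimes> r" x] h rG by simp
  next
    assume "h \<otimes> r \<in> A"
    then show "coset l (h \<otimes> r) \<inter> A \<noteq> {}" using self_in_coset[of "h \<otimes> r" l] h rG by blast
  qed
  finally show ?thesis .
qed

lemmas hole_iff = act_clo_iff[OF U_periodic]

text \<open>The free positions above \<open>\<xi>\<close>.\<close>

definition aper :: "(nat \<Rightarrow> 'a set) \<Rightarrow> 'a set" where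
  "aper \<xi> = {h \<in> carrier G. \<forall>n. act h \<xi> \<in> clo (U n)}"

text \<open>The positions at which \<open>\<xi>\<close> dictates the symbol \<open>1\<close>. It does not matter for which \<open>n\<close> and \<open>r\<close> this is
tested (\<open>base_iff\<close>).\<close>

definition base :: "(nat \<Rightarrow> 'a set) \<Rightarrow> 'a set" where
  "base \<xi> = {h \<in> carrier G. \<exists>n. act h \<xi> \<notin> clo (U n) \<and> (\<exists>r\<in>\<xi> (m n). h \<otimes> r \<in> P)}"

definition pat :: "(nat \<Rightarrow> 'a set) \<Rightarrow> 'a set \<Rightarrow> 'a \<Rightarrow> nat" where
  "pat \<xi> C = array_of (base \<xi> \<union> (aper \<xi> \<inter> C))"

text \<open>The visits of \<open>\<xi>\<close> to \<open>W j\<close>.\<close>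

definition marks :: "nat \<Rightarrow> (nat \<Rightarrow> 'a set) \<Rightarrow> 'a set" where
  "marks j \<xi> = {h \<in> carrier G. act h \<xi> \<in> clo (W j)}"

lemma P_const_coset:
  assumes \<xi>: "\<xi> \<in> Y" and h: "h \<in> carrier G" and n: "act h \<xi> \<notin> clo (U n)"
    and r: "r \<in> \<xi> (m n)" "s \<in> \<xi> (m n)"
  shows "h \<otimes> s \<in> P \<longleftrightarrow> h \<otimes> r \<in> P"
proof -
  have rG: "r \<in> carrier G" using odometer_mem(1)[OF \<xi> r(1)] .
  have "s \<in> coset (m n) r" using odometer_mem(2)[OF \<xi> r(1)] r(2) by simp
  then obtain c where c: "c \<in> \<Gamma> (m n)" "s = r \<otimes> c" unfolding l_coset_def by blast
  have "h \<otimes> r \<notin> U n" using n hole_iff[OF \<xi> h r(1)] by simp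
  then have "h \<otimes> r \<otimes> c \<in> P \<longleftrightarrow> h \<otimes> r \<in> P" using h rG c(1) by (intro P_const) simp_all
  then show ?thesis using c h rG Gam_carrier[OF c(1)] by (simp add: m_assoc)
qed

lemma base_iff:
  assumes \<xi>: "\<xi> \<in> Y" and h: "h \<in> carrier G" and n: "act h \<xi> \<notin> clo (U n)" and r: "r \<in> \<xi> (m n)"
  shows "h \<in> base \<xi> \<longleftrightarrow> h \<otimes> r \<in> P"
proof
  assume "h \<otimes> r \<in> P" then show "h \<in> base \<xi>" unfolding base_def using h n r by blast
next
  assume "h \<in> base \<xi>"
  then obtain n' s where n': "act h \<xi> \<notin> clo (U n')" and s: "s \<in> \<xi> (m n')" "h \<otimes> s \<in> P"
    unfolding base_def by blast
  obtain t where "t \<in> \<xi> (m (max n n'))" using odometer_ex[OF \<xi>] by blast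
  then have t: "t \<in> \<xi> (m n)" "t \<in> \<xi> (m n')"
    using odometer_antimono[OF \<xi> m_le, of n "max n n'"] odometer_antimono[OF \<xi> m_le, of n' "max n n'"] by auto
  have "h \<otimes> t \<in> P" using P_const_coset[OF \<xi> h n' s(1) t(2)] s(2) by simp
  then show "h \<otimes> r \<in> P" using P_const_coset[OF \<xi> h n r t(1)] by simp
qed

lemma base_aper_disjoint: "base \<xi> \<inter> aper \<xi> = {}"
  by (auto simp: base_def aper_def)

lemma pat_eq_1: "h \<in> carrier G \<Longrightarrow> pat \<xi> C h = 1 \<longleftrightarrow> h \<in> base \<xi> \<or> (h \<in> aper \<xi> \<and> h \<in> C)"
  unfolding pat_def using array_of_eq_1[of h] by simp

lemma pat_FS: "pat \<xi> C \<in> topspace FS"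
  unfolding pat_def by (rule array_of_FS)

lemma clo_U_antimono: "i \<le> n \<Longrightarrow> clo (U n) \<subseteq> clo (U i)"
  using U_antimono[of i n] unfolding clo_def by blast

lemma off_aper:
  assumes y: "y \<in> X" and h: "h \<in> carrier G" "act h (\<beta> y) \<notin> clo (U n)"
  shows "y h = 1 \<longleftrightarrow> h \<in> base (\<beta> y)"
proof -
  obtain g where g: "g \<in> \<beta> y (m n)" "\<forall>b\<in>{h}. y b = 1 \<longleftrightarrow> b \<otimes> g \<in> P"
    using \<beta>_approx[OF y, of "{h}" "m n"] h by blast
  then show ?thesis using base_iff[OF \<beta>_in[OF y] h g(1)] by simp
qed

text \<open>By \<open>patterns\<close> each finite set \<open>K\<close> of free positions carries an admissible pattern, but the pattern could depend on
\<open>K\<close>. If none of them fitted globally, finitely many free positions would witness this: one for each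
of the \<open>k\<close> patterns, where the one for \<open>W 0 = {}\<close> carries the symbol \<open>1\<close>, and a second position with the
symbol \<open>1\<close>, which excludes the single marks.\<close>

lemma X_cases:
  assumes y: "y \<in> X"
  shows "(\<exists>j<k. y = pat (\<beta> y) (marks j (\<beta> y))) \<or> (\<exists>p\<in>aper (\<beta> y). y = pat (\<beta> y) {p})"
proof -
  define \<xi> where "\<xi> = \<beta> y"
  have \<xi>: "\<xi> \<in> Y" using \<beta>_in[OF y] by (simp add: \<xi>_def)
  define ones where "ones = {h \<in> aper \<xi>. y h = 1}"
  have aperG: "aper \<xi> \<subseteq> carrier G" by (auto simp: aper_def)
  have y_pat: "y = pat \<xi> C" if C: "aper \<xi> \<inter> C = ones" for C
  proof (rule FS_eqI[OF X_FS[OF y] pat_FS])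
    fix h assume h: "h \<in> carrier G"
    show "y h = 1 \<longleftrightarrow> pat \<xi> C h = 1"
    proof (cases "h \<in> aper \<xi>")
      case True
      then have "h \<notin> base \<xi>" using base_aper_disjoint by blast
      moreover have "h \<in> C \<longleftrightarrow> y h = 1" using True C unfolding ones_def by blast
      ultimately show ?thesis using pat_eq_1[OF h] True by simp
    next
      case False
      then obtain n where "act h \<xi> \<notin> clo (U n)" using h by (auto simp: aper_def)
      then show ?thesis using off_aper[OF y h, of n] pat_eq_1[OF h] False by (simp add: \<xi>_def)
    qed
  qed
  have window: "(\<exists>j<k. \<forall>b\<in>K. b \<in> ones \<longleftrightarrow> b \<in> marks j \<xi>) \<or> (\<exists>p\<in>K. \<forall>b\<in>K. b \<in> ones \<longleftrightarrow> b = p)"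
    if K: "finite K" "K \<subseteq> aper \<xi>" for K
  proof -
    have KG: "K \<subseteq> carrier G" using K aperG by blast
    obtain n where n: "\<forall>g\<in>carrier G.
        (\<exists>j<k. \<forall>b\<in>K. b \<otimes> g \<in> U n \<longrightarrow> (b \<otimes> g \<in> P \<longleftrightarrow> b \<otimes> g \<in> W j)) \<or>
        (\<exists>p\<in>K. \<forall>b\<in>K. b \<otimes> g \<in> U n \<longrightarrow> (b \<otimes> g \<in> P \<longleftrightarrow> b = p))"
      using patterns[OF K(1) KG] by blast
    obtain g where g: "g \<in> carrier G" "g \<in> \<xi> (m n)" "\<forall>b\<in>K. y b = 1 \<longleftrightarrow> b \<otimes> g \<in> P"
      using \<beta>_approx[OF y K(1) KG, of "m n"] unfolding \<xi>_def by blast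
    have g0: "g \<in> \<xi> (m 0)" using odometer_antimono[OF \<xi> m_le, of 0 n] g(2) by blast
    have inU: "b \<otimes> g \<in> U n" if "b \<in> K" for b
      using that K KG hole_iff[OF \<xi> _ g(2), of b] unfolding aper_def by blast
    have ones: "b \<in> ones \<longleftrightarrow> b \<otimes> g \<in> P" if "b \<in> K" for b using that K g(3) unfolding ones_def by blast
    have mk: "b \<in> marks j \<xi> \<longleftrightarrow> b \<otimes> g \<in> W j" if "b \<in> K" "j < k" for b j
      using act_clo_iff[OF W_periodic[OF that(2)] \<xi> _ g0, of b] that KG unfolding marks_def by blast
    consider j where "j < k" "\<forall>b\<in>K. b \<otimes> g \<in> U n \<longrightarrow> (b \<otimes> g \<in> P \<longleftrightarrow> b \<otimes> g \<in> W j)"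
      | p where "p \<in> K" "\<forall>b\<in>K. b \<otimes> g \<in> U n \<longrightarrow> (b \<otimes> g \<in> P \<longleftrightarrow> b = p)" using n g(1) by blast
    then show ?thesis
    proof cases
      case 1
      have "b \<in> ones \<longleftrightarrow> b \<in> marks j \<xi>" if "b \<in> K" for b
        using ones[OF that] mk[OF that 1(1)] 1(2) inU[OF that] that by blast
      then show ?thesis using 1(1) by blast
    next
      case 2
      have "b \<in> ones \<longleftrightarrow> b = p" if "b \<in> K" for b using ones[OF that] 2(2) inU[OF that] that by blast
      then show ?thesis using 2(1) by blast
    qed
  qed
  have "(\<exists>j<k. aper \<xi> \<inter> marks j \<xi> = ones) \<or> (\<exists>p\<in>aper \<xi>. aper \<xi> \<inter> {p} = ones)"
  proof (rule ccontr)
    assume neg: "\<not> ?thesis"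
    have ones_aper: "ones \<subseteq> aper \<xi>" by (auto simp: ones_def)
    have "\<forall>j. \<exists>h. j < k \<longrightarrow> h \<in> aper \<xi> \<and> \<not> (h \<in> ones \<longleftrightarrow> h \<in> marks j \<xi>)"
      using neg ones_aper by blast
    then obtain w where w: "\<And>j. j < k \<Longrightarrow> w j \<in> aper \<xi> \<and> \<not> (w j \<in> ones \<longleftrightarrow> w j \<in> marks j \<xi>)" by metis
    have "0 < k" using k_ge_2 by simp
    have "marks 0 \<xi> = {}" unfolding marks_def clo_def W_0 by blast
    then have p1: "w 0 \<in> ones" using w[OF \<open>0 < k\<close>] by blast
    then have "ones \<noteq> {w 0}" using neg ones_aper by blast
    then obtain p2 where p2: "p2 \<in> ones" "p2 \<noteq> w 0" using p1 by blast
    define K where "K = insert p2 (w ` {..<k})"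
    have K: "finite K" "K \<subseteq> aper \<xi>" using w p2 ones_aper by (auto simp: K_def)
    have wK: "w j \<in> K" if "j < k" for j using that by (simp add: K_def)
    have "p2 \<in> K" by (simp add: K_def)
    show False using window[OF K] w wK p1 p2 \<open>p2 \<in> K\<close> wK[OF \<open>0 < k\<close>] by metis
  qed
  then show ?thesis using y_pat unfolding \<xi>_def by blast
qed

text \<open>A pattern on the free positions occurs above \<open>\<xi>\<close> if translates of the array show it on every finite set of
free positions, arbitrarily close to \<open>\<xi>\<close>; the other positions take care of themselves.\<close>

lemma pat_in:
  assumes \<xi>: "\<xi> \<in> Y"
    and real: "\<And>K n0. \<lbrakk>finite K; K \<subseteq> carrier G\<rbrakk> \<Longrightarrow>
      \<exists>n\<ge>n0. \<exists>g\<in>\<xi> (m n). \<forall>b\<in>K \<inter> aper \<xi>. b \<otimes> g \<in> P \<longleftrightarrow> b \<in> C"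
  shows "pat \<xi> C \<in> X \<and> \<beta> (pat \<xi> C) = \<xi>"
proof -
  have approx: "\<exists>g. g \<in> carrier G \<and> g \<in> \<xi> l \<and> (\<forall>b\<in>K. pat \<xi> C b = 1 \<longleftrightarrow> b \<otimes> g \<in> P)"
    if K: "finite K" "K \<subseteq> carrier G" for K l
  proof -
    have "\<forall>b. \<exists>n. b \<in> K - aper \<xi> \<longrightarrow> act b \<xi> \<notin> clo (U n)" using K unfolding aper_def by blast
    then obtain f where f: "\<And>b. b \<in> K - aper \<xi> \<Longrightarrow> act b \<xi> \<notin> clo (U (f b))" by metis
    define n0 where "n0 = Max (insert l (f ` K))"
    have fin: "finite (insert l (f ` K))" using K by simp
    have n0: "l \<le> n0" "\<And>b. b \<in> K \<Longrightarrow> f b \<le> n0" unfolding n0_def using fin by (auto intro: Max_ge)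
    obtain n g where n: "n \<ge> n0" and g: "g \<in> \<xi> (m n)" "\<forall>b\<in>K \<inter> aper \<xi>. b \<otimes> g \<in> P \<longleftrightarrow> b \<in> C"
      using real[OF K, of n0] by blast
    have "l \<le> m n" using n0(1) n le_m[of n] by linarith
    then have gl: "g \<in> \<xi> l" using odometer_antimono[OF \<xi>] g(1) by blast
    have "pat \<xi> C b = 1 \<longleftrightarrow> b \<otimes> g \<in> P" if b: "b \<in> K" for b
    proof (cases "b \<in> aper \<xi>")
      case True
      then have "b \<notin> base \<xi>" using base_aper_disjoint by blast
      then show ?thesis using pat_eq_1[of b \<xi> C] b K True g(2) by blast
    next
      case False
      have bG: "b \<in> carrier G" using b K by blast
      have "f b \<le> n" using n0(2)[OF b] n by simp
      then have "act b \<xi> \<notin> clo (U n)" using f[of b] b False clo_U_antimono[of "f b" n] by blast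
      then show ?thesis using base_iff[OF \<xi> bG _ g(1)] pat_eq_1[OF bG] False by simp
    qed
    then show ?thesis using odometer_mem(1)[OF \<xi> g(1)] gl by blast
  qed
  have "pat \<xi> C \<in> X" unfolding X_iff using pat_FS approx by blast
  moreover have "\<beta> (pat \<xi> C) = \<xi>"
  proof
    fix l
    obtain g where "g \<in> carrier G" "g \<in> \<xi> l" "\<forall>b\<in>code_window l. pat \<xi> C b = 1 \<longleftrightarrow> b \<otimes> g \<in> P"
      using approx[OF code_window(1,2)] by blast
    then show "\<beta> (pat \<xi> C) l = \<xi> l" using \<beta>_eq odometer_mem(2)[OF \<xi>] by metis
  qed
  ultimately show ?thesis by blast
qed

lemma pat_marks_in:
  assumes \<xi>: "\<xi> \<in> Y" and j: "j < k"
  shows "pat \<xi> (marks j \<xi>) \<in> X \<and> \<beta> (pat \<xi> (marks j \<xi>)) = \<xi>"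
proof (rule pat_in[OF \<xi>])
  fix K n0 assume K: "finite K" "K \<subseteq> carrier G"
  obtain n where n: "n \<ge> n0" "\<forall>g\<in>carrier G.
        (\<forall>j<k. \<exists>c\<in>\<Gamma> (m n). \<forall>b\<in>K. b \<otimes> g \<in> U n \<longrightarrow> (b \<otimes> g \<otimes> c \<in> P \<longleftrightarrow> b \<otimes> g \<in> W j)) \<and>
        (\<forall>p\<in>K. p \<otimes> g \<in> U n \<longrightarrow>
          (\<exists>c\<in>\<Gamma> (m n). \<forall>b\<in>K. b \<otimes> g \<in> U n \<longrightarrow> (b \<otimes> g \<otimes> c \<in> P \<longleftrightarrow> b = p)))"
    using realized[OF K, of n0] by (elim exE conjE)
  obtain g where g: "g \<in> carrier G" "g \<in> \<xi> (m n)" using odometer_ex[OF \<xi>] by blast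
  obtain c where c: "c \<in> \<Gamma> (m n)" "\<forall>b\<in>K. b \<otimes> g \<in> U n \<longrightarrow> (b \<otimes> g \<otimes> c \<in> P \<longleftrightarrow> b \<otimes> g \<in> W j)"
    by (rule bexE[OF bspec[OF n(2) g(1), THEN conjunct1, rule_format, OF j]])
  have cG: "c \<in> carrier G" using Gam_carrier[OF c(1)] .
  have gc: "g \<otimes> c \<in> \<xi> (m n)" using odometer_mem(2)[OF \<xi> g(2)] coset_mult[OF g(1) c(1)] by simp
  have g0: "g \<in> \<xi> (m 0)" using odometer_antimono[OF \<xi> m_le, of 0 n] g(2) by blast
  have "b \<otimes> (g \<otimes> c) \<in> P \<longleftrightarrow> b \<in> marks j \<xi>" if b: "b \<in> K \<inter> aper \<xi>" for b
  proof -
    have bG: "b \<in> carrier G" using b K by blast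
    have "b \<otimes> g \<in> U n" using b hole_iff[OF \<xi> bG g(2)] unfolding aper_def by blast
    then have "b \<otimes> g \<otimes> c \<in> P \<longleftrightarrow> b \<otimes> g \<in> W j" using c(2) b by blast
    then show ?thesis
      using act_clo_iff[OF W_periodic[OF j] \<xi> bG g0] bG g(1) cG by (simp add: marks_def m_assoc)
  qed
  then show "\<exists>n\<ge>n0. \<exists>g\<in>\<xi> (m n). \<forall>b\<in>K \<inter> aper \<xi>. b \<otimes> g \<in> P \<longleftrightarrow> b \<in> marks j \<xi>"
    using n(1) gc by blast
qed

lemma pat_single_in:
  assumes \<xi>: "\<xi> \<in> Y" and p: "p \<in> aper \<xi>"
  shows "pat \<xi> {p} \<in> X \<and> \<beta> (pat \<xi> {p}) = \<xi>"
proof (rule pat_in[OF \<xi>])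
  fix K0 n0 assume K0: "finite K0" "K0 \<subseteq> carrier G"
  define K where "K = insert p K0"
  have K: "finite K" "K \<subseteq> carrier G" "p \<in> K" "K0 \<subseteq> K" using K0 p by (auto simp: K_def aper_def)
  obtain n where n: "n \<ge> n0" "\<forall>g\<in>carrier G.
        (\<forall>j<k. \<exists>c\<in>\<Gamma> (m n). \<forall>b\<in>K. b \<otimes> g \<in> U n \<longrightarrow> (b \<otimes> g \<otimes> c \<in> P \<longleftrightarrow> b \<otimes> g \<in> W j)) \<and>
        (\<forall>p\<in>K. p \<otimes> g \<in> U n \<longrightarrow>
          (\<exists>c\<in>\<Gamma> (m n). \<forall>b\<in>K. b \<otimes> g \<in> U n \<longrightarrow> (b \<otimes> g \<otimes> c \<in> P \<longleftrightarrow> b = p)))"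
    using realized[OF K(1,2), of n0] by (elim exE conjE)
  obtain g where g: "g \<in> carrier G" "g \<in> \<xi> (m n)" using odometer_ex[OF \<xi>] by blast
  have inU: "b \<otimes> g \<in> U n" if b: "b \<in> K \<inter> aper \<xi>" for b
  proof -
    have bG: "b \<in> carrier G" using b K by blast
    show ?thesis using b hole_iff[OF \<xi> bG g(2)] unfolding aper_def by blast
  qed
  have pU: "p \<otimes> g \<in> U n" using inU[of p] p K(3) by blast
  obtain c where c: "c \<in> \<Gamma> (m n)" "\<forall>b\<in>K. b \<otimes> g \<in> U n \<longrightarrow> (b \<otimes> g \<otimes> c \<in> P \<longleftrightarrow> b = p)"
    by (rule bexE[OF bspec[OF n(2) g(1), THEN conjunct2, rule_format, OF K(3) pU]])
  have cG: "c \<in> carrier G" using Gam_carrier[OF c(1)] .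
  have gc: "g \<otimes> c \<in> \<xi> (m n)" using odometer_mem(2)[OF \<xi> g(2)] coset_mult[OF g(1) c(1)] by simp
  have "b \<otimes> (g \<otimes> c) \<in> P \<longleftrightarrow> b \<in> {p}" if b: "b \<in> K0 \<inter> aper \<xi>" for b
  proof -
    have bG: "b \<in> carrier G" using b K0 by blast
    have "b \<otimes> g \<otimes> c \<in> P \<longleftrightarrow> b = p" using c(2) b K(4) inU[of b] by blast
    then show ?thesis using bG g(1) cG by (simp add: m_assoc)
  qed
  then show "\<exists>n\<ge>n0. \<exists>g\<in>\<xi> (m n). \<forall>b\<in>K0 \<inter> aper \<xi>. b \<otimes> g \<in> P \<longleftrightarrow> b \<in> {p}"
    using n(1) gc by blast
qed

lemma fiber_eq:
  assumes \<xi>: "\<xi> \<in> Y"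
  shows "fiber XT \<beta> \<xi> = (\<lambda>j. pat \<xi> (marks j \<xi>)) ` {..<k} \<union> (\<lambda>p. pat \<xi> {p}) ` aper \<xi>"
proof (intro equalityI subsetI)
  fix y assume "y \<in> fiber XT \<beta> \<xi>"
  then have "y \<in> X" "\<beta> y = \<xi>" by (auto simp: fiber_def topspace_XT)
  then show "y \<in> (\<lambda>j. pat \<xi> (marks j \<xi>)) ` {..<k} \<union> (\<lambda>p. pat \<xi> {p}) ` aper \<xi>" using X_cases by blast
next
  fix y assume "y \<in> (\<lambda>j. pat \<xi> (marks j \<xi>)) ` {..<k} \<union> (\<lambda>p. pat \<xi> {p}) ` aper \<xi>"
  then have "y \<in> X \<and> \<beta> y = \<xi>" using pat_marks_in[OF \<xi>] pat_single_in[OF \<xi>] by blast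
  then show "y \<in> fiber XT \<beta> \<xi>" by (simp add: fiber_def topspace_XT)
qed

lemma pat_single_inj: "inj_on (\<lambda>p. pat \<xi> {p}) (aper \<xi>)"
proof (rule inj_onI)
  fix p p' assume p: "p \<in> aper \<xi>" "p' \<in> aper \<xi>" "pat \<xi> {p} = pat \<xi> {p'}"
  have pG: "p \<in> carrier G" using p by (simp add: aper_def)
  have "pat \<xi> {p} p = 1" using pat_eq_1[OF pG, of \<xi> "{p}"] p(1) by simp
  then have "pat \<xi> {p'} p = 1" using p(3) by simp
  then show "p = p'" using pat_eq_1[OF pG, of \<xi> "{p'}"] p(1) base_aper_disjoint[of \<xi>] by blast
qed

lemma countable_fiber: "\<xi> \<in> Y \<Longrightarrow> countable (fiber XT \<beta> \<xi>)"
  unfolding fiber_eq using countable_subset[OF _ countable_carrier, of "aper \<xi>"]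
  by (auto simp: aper_def intro!: countable_Un countable_image countable_finite)

lemma infinite_fiber: "\<xi> \<in> Y \<Longrightarrow> infinite (aper \<xi>) \<Longrightarrow> infinite (fiber XT \<beta> \<xi>)"
  unfolding fiber_eq using finite_imageD[OF _ pat_single_inj] by blast

lemma singleton_fiber:
  assumes \<xi>: "\<xi> \<in> Y" and a: "aper \<xi> = {}" and y: "y \<in> X" "\<beta> y = \<xi>"
  shows "fiber XT \<beta> \<xi> = {y}"
proof -
  have "pat \<xi> C = pat \<xi> {}" for C unfolding pat_def a by simp
  then have "fiber XT \<beta> \<xi> \<subseteq> {pat \<xi> {}}" unfolding fiber_eq[OF \<xi>] a by auto
  moreover have "y \<in> fiber XT \<beta> \<xi>" using y by (simp add: fiber_def topspace_XT)
  ultimately show ?thesis by blast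
qed

lemma aper_act:
  assumes g: "g \<in> carrier G" and \<xi>: "\<xi> \<in> Y" and h: "h \<in> carrier G"
  shows "h \<in> aper (act g \<xi>) \<longleftrightarrow> h \<otimes> g \<in> aper \<xi>"
  unfolding aper_def using act_act[OF h g \<xi>] h g by simp

lemma \<beta>_x0: "\<beta> x0 = point \<one>"
proof
  fix n
  have "\<forall>b\<in>code_window n. x0 b = 1 \<longleftrightarrow> b \<otimes> \<one> \<in> P"
    using code_window(2)[of n] by (auto simp: x0_def array_of_def subset_iff)
  then show "\<beta> x0 n = point \<one> n" using \<beta>_eq[of \<one> n x0] by (simp add: point_def)
qed

text \<open>The base point has no free position since every position of the array is closed eventually. Its
orbit provides the dense set of singleton fibers.\<close>

lemma aper_one: "aper (point \<one>) = {}"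
proof -
  have p: "point \<one> \<in> Y" using point_in by simp
  have "h \<notin> aper (point \<one>)" if h: "h \<in> carrier G" for h
  proof -
    obtain n where n: "h \<notin> U n" using U_vanish[OF h] by blast
    have "\<one> \<in> point \<one> (m n)" by (simp add: point_def)
    then have "act h (point \<one>) \<notin> clo (U n)" using hole_iff[OF p h, of \<one> n] n h by simp
    then show ?thesis by (auto simp: aper_def)
  qed
  then show ?thesis by (auto simp: aper_def)
qed

lemma almost_one_to_one_\<beta>: "almost_one_to_one XT \<beta>"
  unfolding almost_one_to_one_def
proof (rule antisym)
  show "XT closure_of {x \<in> topspace XT. fiber XT \<beta> (\<beta> x) = {x}} \<subseteq> topspace XT" by (rule closure_of_subset_topspace)
  have orbit: "sh g x0 \<in> {x \<in> topspace XT. fiber XT \<beta> (\<beta> x) = {x}}" if g: "g \<in> carrier G" for g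
  proof -
    have p: "point \<one> \<in> Y" using point_in by simp
    have X: "sh g x0 \<in> X" using X_sh[OF g x0_X] .
    have b: "\<beta> (sh g x0) = act g (point \<one>)" using \<beta>_sh[OF g x0_X] \<beta>_x0 by simp
    have "h \<notin> aper (act g (point \<one>))" for h
    proof
      assume h: "h \<in> aper (act g (point \<one>))"
      then have "h \<in> carrier G" by (simp add: aper_def)
      then have "h \<otimes> g \<in> aper (point \<one>)" using aper_act[OF g p] h by blast
      then show False using aper_one by simp
    qed
    then have "aper (act g (point \<one>)) = {}" by blast
    then have "fiber XT \<beta> (\<beta> (sh g x0)) = {sh g x0}"
      using singleton_fiber[OF \<beta>_in[OF X] _ X refl] b by simp
    then show ?thesis using X by (simp add: topspace_XT)
  qed
  show "topspace XT \<subseteq> XT closure_of {x \<in> topspace XT. fiber XT \<beta> (\<beta> x) = {x}}"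
  proof
    fix y assume "y \<in> topspace XT"
    then have y: "y \<in> X" by (simp add: topspace_XT)
    show "y \<in> XT closure_of {x \<in> topspace XT. fiber XT \<beta> (\<beta> x) = {x}}"
      unfolding in_closure_of
    proof (intro conjI allI impI)
      show "y \<in> topspace XT" by fact
      fix T assume T: "y \<in> T \<and> openin XT T"
      then obtain T' where T': "openin FS T'" "T = T' \<inter> X" unfolding orbit_closure_top_def openin_subtopology by blast
      then obtain g where g: "g \<in> carrier G" "sh g x0 \<in> T'"
        using y T unfolding X_closure[of y] by blast
      then have "sh g x0 \<in> T" using T'(2) X_sh[OF g(1) x0_X] by blast
      then show "\<exists>z. z \<in> {x \<in> topspace XT. fiber XT \<beta> (\<beta> x) = {x}} \<and> z \<in> T" using orbit[OF g(1)] by blast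
    qed
  qed
qed

lemma factor_\<beta>: "factor_map G XT sh YT act \<beta>"
  unfolding factor_map_def topspace_XT topspace_YT
proof (intro conjI ballI)
  show "continuous_map XT YT \<beta>" by (rule continuous_\<beta>)
  have "0 < k" using k_ge_2 by simp
  then show "\<beta> ` X = Y" using \<beta>_in pat_marks_in by force
  show "\<beta> (sh g y) = act g (\<beta> y)" if "g \<in> carrier G" "y \<in> X" for g y using \<beta>_sh[OF that] .
qed

end

section \<open>Toeplitz points and the maximal equicontinuous factor\<close>

lemma (in free_odometer) finite_index_Gam: "finite_index_subgroup G (\<Gamma> n)"
  using odometer_seq by (simp add: odometer_sequence_def)

text \<open>The products \<open>H \<Gamma> n\<close> decrease with \<open>n\<close>, and they are unions of cosets of \<open>H\<close>, of which there are only finitely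
many. Hence they are eventually constant, and \<open>\<Gamma> n1\<close> is contained in all of them.\<close>

lemma (in free_odometer) finite_index_absorbs:
  assumes H: "finite_index_subgroup G H"
  shows "\<exists>n1. \<forall>g\<in>\<Gamma> n1. \<forall>n. \<exists>c\<in>\<Gamma> n. g \<otimes> c \<in> H"
proof -
  have sub: "subgroup H G" and fin: "finite (rcosets H)"
    using H by (simp_all add: finite_index_subgroup_def)
  define good where "good = (\<lambda>n C. \<exists>a\<in>C. \<exists>c\<in>\<Gamma> n. a \<otimes> c \<in> H)"
  have good_mono: "good n C" if "good n' C" "n \<le> n'" for n n' C
    using that Gam_antimono[of n n'] unfolding good_def by blast
  define f where "f = (\<lambda>C. SOME n. \<not> good n C)"
  have f: "\<not> good (f C) C" if "\<not> good n C" for C n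
    unfolding f_def using that by (rule someI[where P="\<lambda>n. \<not> good n C"])
  define n1 where "n1 = Max (insert 0 (f ` (rcosets H)))"
  have f_le: "f C \<le> n1" if "C \<in> rcosets H" for C
    unfolding n1_def using that fin by (intro Max_ge) simp_all
  have "\<exists>c\<in>\<Gamma> n. g \<otimes> c \<in> H" if g: "g \<in> \<Gamma> n1" for g n
  proof -
    have gG: "g \<in> carrier G" using Gam_carrier[OF g] .
    define C where "C = H #> g"
    have C: "C \<in> rcosets H" unfolding C_def using rcosetsI[OF subgroup.subset[OF sub] gG] .
    have gC: "g \<in> C" unfolding C_def using rcos_self[OF gG sub] .
    have "g \<otimes> inv g \<in> H" using gG subgroup.one_closed[OF sub] by simp
    then have "good n1 C" unfolding good_def using gC Gam_inv[OF g] by blast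
    then have "good (f C) C" using good_mono f_le[OF C] by blast
    then have "good n C" using f by blast
    then obtain a c where a: "a \<in> C" "c \<in> \<Gamma> n" "a \<otimes> c \<in> H" unfolding good_def by blast
    obtain h where h: "h \<in> H" "a = h \<otimes> g" using a(1) unfolding C_def r_coset_def by blast
    have G: "h \<in> carrier G" "c \<in> carrier G" using h(1) subgroup.mem_carrier[OF sub] Gam_carrier[OF a(2)] by blast+
    have "inv h \<otimes> (a \<otimes> c) \<in> H" using subgroup.m_closed[OF sub subgroup.m_inv_closed[OF sub h(1)] a(3)] .
    moreover have "inv h \<otimes> (a \<otimes> c) = g \<otimes> c" unfolding h(2) using G gG by (simp add: m_assoc mult_inv_cancel)
    ultimately show ?thesis using a(2) by auto
  qed
  then show ?thesis by blast
qed

context layered_array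
begin

lemma toeplitz_x0: "toeplitz G x0"
  unfolding toeplitz_def
proof (intro conjI ballI)
  show "x0 \<in> topspace FS" unfolding x0_def by (rule array_of_FS)
  fix h assume h: "h \<in> carrier G"
  obtain n where n: "h \<notin> U n" using U_vanish[OF h] by blast
  have "x0 (h \<otimes> c) = x0 h" if c: "c \<in> \<Gamma> (m n)" for c
    using P_const[OF h n c] h Gam_carrier[OF c] by (simp add: x0_def array_of_def)
  then show "\<exists>H. finite_index_subgroup G H \<and> (\<forall>c\<in>H. x0 (h \<otimes> c) = x0 h)"
    using finite_index_Gam by blast
qed

text \<open>Let \<open>y\<close> be constant on \<open>h H\<close> for a subgroup \<open>H\<close> of finite index, which need not be related to the
\<open>\<Gamma> n\<close>. By \<open>finite_index_absorbs\<close> the set \<open>h H\<close> visits every small cylinder inside some cylinder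
around \<open>h \<xi>\<close>. If \<open>h\<close> is free, this cylinder contains smaller ones where the symbol is dictated to be
\<open>1\<close> and others where it is dictated to be \<open>0\<close>.\<close>

lemma toeplitz_aper_empty:
  assumes y: "y \<in> X" and T: "toeplitz G y"
  shows "aper (\<beta> y) = {}"
proof (rule ccontr)
  assume "aper (\<beta> y) \<noteq> {}"
  then obtain h where ha: "h \<in> aper (\<beta> y)" by blast
  then have h: "h \<in> carrier G" by (simp add: aper_def)
  define \<xi> where "\<xi> = \<beta> y"
  have \<xi>: "\<xi> \<in> Y" using \<beta>_in[OF y] by (simp add: \<xi>_def)
  obtain H where H: "finite_index_subgroup G H" "\<forall>g\<in>H. y (h \<otimes> g) = y h"
    using T h unfolding toeplitz_def by blast
  obtain n1 where n1: "\<forall>g\<in>\<Gamma> n1. \<forall>n. \<exists>c\<in>\<Gamma> n. g \<otimes> c \<in> H" using finite_index_absorbs[OF H(1)] by blast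
  have K: "finite {h}" "{h} \<subseteq> carrier G" using h by simp_all
  obtain n where n: "n \<ge> n1" "\<forall>g\<in>carrier G.
        (\<forall>j<k. \<exists>c\<in>\<Gamma> (m n). \<forall>b\<in>{h}. b \<otimes> g \<in> U n \<longrightarrow> (b \<otimes> g \<otimes> c \<in> P \<longleftrightarrow> b \<otimes> g \<in> W j)) \<and>
        (\<forall>p\<in>{h}. p \<otimes> g \<in> U n \<longrightarrow>
          (\<exists>c\<in>\<Gamma> (m n). \<forall>b\<in>{h}. b \<otimes> g \<in> U n \<longrightarrow> (b \<otimes> g \<otimes> c \<in> P \<longleftrightarrow> b = p)))"
    using realized[OF K, of n1] by (elim exE conjE)
  obtain g where g: "g \<in> carrier G" "g \<in> \<xi> (m n)" using odometer_ex[OF \<xi>] by blast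
  have hg: "h \<otimes> g \<in> U n" using ha hole_iff[OF \<xi> h g(2)] by (simp add: aper_def \<xi>_def)
  have hgG: "h \<otimes> g \<in> carrier G" using h g by simp
  have "\<exists>c\<in>\<Gamma> (m n). h \<otimes> g \<otimes> c \<in> P \<longleftrightarrow> \<not> y h = 1"
  proof (cases "y h = 1")
    case True
    have "0 < k" using k_ge_2 by simp
    obtain c where "c \<in> \<Gamma> (m n)" "\<forall>b\<in>{h}. b \<otimes> g \<in> U n \<longrightarrow> (b \<otimes> g \<otimes> c \<in> P \<longleftrightarrow> b \<otimes> g \<in> W 0)"
      by (rule bexE[OF bspec[OF n(2) g(1), THEN conjunct1, rule_format, OF \<open>0 < k\<close>]])
    then show ?thesis using True hg W_0 by auto
  next
    case False
    obtain c where "c \<in> \<Gamma> (m n)" "\<forall>b\<in>{h}. b \<otimes> g \<in> U n \<longrightarrow> (b \<otimes> g \<otimes> c \<in> P \<longleftrightarrow> b = h)"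
      by (rule bexE[OF bspec[OF n(2) g(1), THEN conjunct2, rule_format, OF singletonI hg]])
    then show ?thesis using False hg by auto
  qed
  then obtain c where c: "c \<in> \<Gamma> (m n)" "h \<otimes> g \<otimes> c \<in> P \<longleftrightarrow> \<not> y h = 1" by blast
  have cG: "c \<in> carrier G" using Gam_carrier[OF c(1)] .
  obtain L0 where L0: "h \<otimes> g \<otimes> c \<notin> U L0" using U_vanish[of "h \<otimes> g \<otimes> c"] hgG cG by auto
  define L where "L = max L0 n"
  have L: "h \<otimes> g \<otimes> c \<notin> U L" "n \<le> L" using L0 U_antimono[of L0 L] by (auto simp: L_def)
  obtain r where r: "r \<in> carrier G" "r \<in> \<xi> (m L)" using odometer_ex[OF \<xi>] by blast
  have "r \<in> \<xi> (m n)" using odometer_antimono[OF \<xi> m_le[OF L(2)]] r(2) by blast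
  then have "r \<in> coset (m n) g" using odometer_mem(2)[OF \<xi> g(2)] by simp
  then obtain d where d: "d \<in> \<Gamma> (m n)" "r = g \<otimes> d" unfolding l_coset_def by blast
  have dG: "d \<in> carrier G" using Gam_carrier[OF d(1)] .
  define x where "x = g \<otimes> c \<otimes> inv r"
  have xG: "x \<in> carrier G" using g cG r by (simp add: x_def)
  have xr: "x \<otimes> r = g \<otimes> c" using g cG r by (simp add: x_def m_assoc)
  have "x = g \<otimes> (c \<otimes> inv d) \<otimes> inv g"
    using g cG dG by (simp add: x_def d(2) inv_mult_group m_assoc)
  then have "x \<in> \<Gamma> (m n)" using Gam_conj[OF Gam_mult[OF c(1) Gam_inv[OF d(1)]] g(1)] by simp
  moreover have "n1 \<le> m n" using n(1) le_m[of n] by linarith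
  ultimately have "x \<in> \<Gamma> n1" using Gam_antimono by blast
  then obtain e where e: "e \<in> \<Gamma> (m L)" "x \<otimes> e \<in> H" using n1 by blast
  have eG: "e \<in> carrier G" using Gam_carrier[OF e(1)] .
  have hxG: "h \<otimes> x \<in> carrier G" and hxe: "h \<otimes> (x \<otimes> e) \<in> carrier G" using h xG eG by simp_all
  have "(h \<otimes> x) \<otimes> e \<otimes> r \<in> coset (m L) ((h \<otimes> x) \<otimes> r)" using coset_right_mem[OF hxG r(1) e(1)] .
  moreover have "(h \<otimes> x) \<otimes> r = h \<otimes> g \<otimes> c"
    using xr h xG r(1) g(1) cG by (simp add: m_assoc)
  moreover have "(h \<otimes> x) \<otimes> e \<otimes> r = h \<otimes> (x \<otimes> e) \<otimes> r" using h xG eG by (simp add: m_assoc)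
  ultimately have mem: "h \<otimes> (x \<otimes> e) \<otimes> r \<in> coset (m L) (h \<otimes> g \<otimes> c)" by simp
  then obtain u where u: "u \<in> \<Gamma> (m L)" "h \<otimes> (x \<otimes> e) \<otimes> r = h \<otimes> g \<otimes> c \<otimes> u" unfolding l_coset_def by blast
  have hgcG: "h \<otimes> g \<otimes> c \<in> carrier G" using hgG cG by simp
  have "h \<otimes> (x \<otimes> e) \<otimes> r \<notin> U L" using periodic_mem_iff[OF U_periodic hgcG mem] L(1) by simp
  then have off: "act (h \<otimes> (x \<otimes> e)) \<xi> \<notin> clo (U L)" using hole_iff[OF \<xi> hxe r(2)] by simp
  have "y (h \<otimes> (x \<otimes> e)) = 1 \<longleftrightarrow> h \<otimes> (x \<otimes> e) \<otimes> r \<in> P"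
    using off_aper[OF y hxe off[unfolded \<xi>_def]] base_iff[OF \<xi> hxe off r(2)] by (simp add: \<xi>_def)
  also have "\<dots> \<longleftrightarrow> h \<otimes> g \<otimes> c \<in> P" unfolding u(2) using P_const[OF hgcG L(1) u(1)] .
  finally have "y h = 1 \<longleftrightarrow> \<not> y h = 1" using c(2) H(2) e(2) by metis
  then show False by blast
qed

lemma agrees_with_x0:
  assumes y: "y \<in> X" and K: "K \<subseteq> carrier G" "K \<inter> U n = {}" and one: "\<one> \<in> \<beta> y (m n)"
  shows "\<forall>b\<in>K. y b = x0 b"
proof
  fix b assume b: "b \<in> K"
  have bG: "b \<in> carrier G" using b K by blast
  have Yy: "\<beta> y \<in> Y" using \<beta>_in[OF y] .
  have off: "act b (\<beta> y) \<notin> clo (U n)" using hole_iff[OF Yy bG one] b K bG by auto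
  have "y b = 1 \<longleftrightarrow> b \<in> P" using off_aper[OF y bG off] base_iff[OF Yy bG off one] bG by simp
  moreover have "y b \<in> {0, 1}" using X_FS[OF y] bG unfolding topspace_FS by (auto dest: PiE_mem)
  ultimately show "y b = x0 b" using bG by (auto simp: x0_def array_of_def)
qed

text \<open>Moving the common image of \<open>y\<close> and \<open>y'\<close> close to the base point forces both to look like the array
on \<open>K\<close>.\<close>

lemma fibres_proximal:
  assumes K: "finite K" "K \<subseteq> carrier G" and y: "y \<in> X" "y' \<in> X" "\<beta> y = \<beta> y'"
  shows "\<exists>g\<in>carrier G. \<forall>b\<in>K. sh g y b = x0 b \<and> sh g y' b = x0 b"
proof -
  have "\<forall>b. \<exists>n. b \<in> K \<longrightarrow> b \<notin> U n" using U_vanish K by blast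
  then obtain f where f: "\<And>b. b \<in> K \<Longrightarrow> b \<notin> U (f b)" by metis
  define n where "n = Max (insert 0 (f ` K))"
  have fn: "f b \<le> n" if "b \<in> K" for b unfolding n_def using K that by (intro Max_ge) simp_all
  then have KU: "K \<inter> U n = {}" using f U_antimono by blast
  have \<xi>: "\<beta> y \<in> Y" using \<beta>_in[OF y(1)] .
  obtain r where r: "r \<in> carrier G" "r \<in> \<beta> y (m n)" using odometer_ex[OF \<xi>] by blast
  have ir: "inv r \<in> carrier G" using r by simp
  have one: "\<one> \<in> act (inv r) (\<beta> y) (m n)" using act_memI[OF ir \<xi> r(2)] r(1) by simp
  have "\<forall>b\<in>K. sh (inv r) y b = x0 b"
    using agrees_with_x0[OF X_sh[OF ir y(1)] K(2) KU] \<beta>_sh[OF ir y(1)] one by simp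
  moreover have "\<forall>b\<in>K. sh (inv r) y' b = x0 b"
    using agrees_with_x0[OF X_sh[OF ir y(2)] K(2) KU] \<beta>_sh[OF ir y(2)] one y(3) by simp
  ultimately show ?thesis using ir by blast
qed

text \<open>In an equicontinuous system different points stay apart under the group, whereas \<open>y\<close> and \<open>y'\<close> are moved
close to each other.\<close>

lemma equicontinuous_collapse:
  assumes eq: "equicontinuous_system G V c" and h: "factor_map G XT sh V c h"
    and y: "y \<in> X" "y' \<in> X" "\<beta> y = \<beta> y'"
  shows "h y = h y'"
proof (rule ccontr)
  assume ne: "h y \<noteq> h y'"
  obtain d where d: "Metric_space (topspace V) d" "Metric_space.mtopology (topspace V) d = V"
    and equi: "\<forall>\<epsilon>>0. \<exists>\<delta>>0. \<forall>x\<in>topspace V. \<forall>y\<in>topspace V.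
           d x y < \<delta> \<longrightarrow> (\<forall>g\<in>carrier G. d (c g x) (c g y) < \<epsilon>)"
    using eq unfolding equicontinuous_system_def by (elim exE conjE)
  have one: "\<forall>x\<in>topspace V. c \<one> x = x"
    and comp: "\<forall>g\<in>carrier G. \<forall>h\<in>carrier G. \<forall>x\<in>topspace V. c (g \<otimes> h) x = c g (c h x)"
    using eq unfolding equicontinuous_system_def dynamical_system_def by - (elim conjE, assumption)+
  interpret M: Metric_space "topspace V" d by (rule d(1))
  have cont: "continuous_map XT V h" and onto: "h ` X = topspace V"
    and eqv: "\<forall>g\<in>carrier G. \<forall>x\<in>X. h (sh g x) = c g (h x)"
    using h unfolding factor_map_def topspace_XT by simp_all
  have hV: "h z \<in> topspace V" if "z \<in> X" for z using onto that by blast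
  have pos: "d (h y) (h y') > 0" using ne hV y M.mdist_pos_less by blast
  obtain \<delta> where \<delta>: "\<delta> > 0" "\<forall>u\<in>topspace V. \<forall>v\<in>topspace V.
           d u v < \<delta> \<longrightarrow> (\<forall>g\<in>carrier G. d (c g u) (c g v) < d (h y) (h y'))"
    using spec[OF equi, THEN mp, OF pos] by (elim exE conjE)
  define B where "B = {z \<in> topspace XT. h z \<in> M.mball (h x0) (\<delta> / 2)}"
  have "openin V (M.mball (h x0) (\<delta> / 2))" using M.openin_mball d(2) by metis
  then have B_open: "openin XT B" unfolding B_def using cont by (intro openin_continuous_map_preimage)
  have B_x0: "x0 \<in> B" using x0_X hV[OF x0_X] \<delta>(1) by (simp add: B_def topspace_XT)
  obtain K where K: "finite K" "K \<subseteq> carrier G" "\<forall>z\<in>X. (\<forall>b\<in>K. z b = x0 b) \<longrightarrow> z \<in> B"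
    using XT_window[OF B_open B_x0] by (elim exE conjE)
  obtain g where g: "g \<in> carrier G" "\<forall>b\<in>K. sh g y b = x0 b \<and> sh g y' b = x0 b"
    using fibres_proximal[OF K(1,2) y] by blast
  have in_B: "sh g y \<in> B" "sh g y' \<in> B" using K(3) g(2) X_sh[OF g(1) y(1)] X_sh[OF g(1) y(2)] by blast+
  have gV: "h (sh g y) \<in> topspace V" "h (sh g y') \<in> topspace V"
    using hV X_sh[OF g(1)] y by blast+
  have "d (h x0) (h (sh g y)) < \<delta> / 2" "d (h x0) (h (sh g y')) < \<delta> / 2"
    using in_B by (simp_all add: B_def M.mball_def)
  then have close: "d (h (sh g y)) (h (sh g y')) < \<delta>"
    using M.triangle[OF gV(1) hV[OF x0_X] gV(2)] M.commute[of "h (sh g y)" "h x0"] by linarith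
  have pull: "c (inv g) (h (sh g z)) = h z" if "z \<in> X" for z
  proof -
    have "h (sh g z) = c g (h z)" using eqv g(1) that by blast
    moreover have "c (inv g) (c g (h z)) = c (inv g \<otimes> g) (h z)"
      using comp[rule_format, OF inv_closed[OF g(1)] g(1) hV[OF that]] by simp
    ultimately show ?thesis using one g(1) hV[OF that] by simp
  qed
  have "d (c (inv g) (h (sh g y))) (c (inv g) (h (sh g y'))) < d (h y) (h y')"
    using \<delta>(2)[rule_format, OF gV close inv_closed[OF g(1)]] .
  then show False using pull y by simp
qed

lemma Hausdorff_YT: "Hausdorff_space YT"
  using Metric_space.Hausdorff_space_mtopology[OF metric_Y] mtopology_Y by simp

lemma quotient_\<beta>: "quotient_map XT YT \<beta>"
proof (rule continuous_closed_imp_quotient_map)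
  show "continuous_map XT YT \<beta>" by (rule continuous_\<beta>)
  show "closed_map XT YT \<beta>"
    using continuous_imp_closed_map_gen[OF compact_XT Hausdorff_imp_kc_space[OF Hausdorff_YT] continuous_\<beta>] .
  show "\<beta> ` topspace XT = topspace YT" using factor_\<beta> by (simp add: factor_map_def)
qed

lemma max_equicontinuous: "max_equicontinuous_factor G XT sh YT act \<beta>"
  unfolding max_equicontinuous_factor_def
proof (intro conjI allI impI)
  show "equicontinuous_system G YT act" by (rule equicontinuous_odometer)
  show "factor_map G XT sh YT act \<beta>" by (rule factor_\<beta>)
  fix V :: "('a \<Rightarrow> nat) set topology" and c h
  assume "equicontinuous_system G V c \<and> factor_map G XT sh V c h"
  then have eq: "equicontinuous_system G V c" and h: "factor_map G XT sh V c h" by simp_all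
  have onto\<beta>: "\<beta> ` X = Y" using factor_\<beta> by (simp add: factor_map_def topspace_XT topspace_YT)
  have cont: "continuous_map XT V h" and onto: "h ` X = topspace V"
    and eqv: "\<forall>g\<in>carrier G. \<forall>x\<in>X. h (sh g x) = c g (h x)"
    using h unfolding factor_map_def topspace_XT by simp_all
  define f where "f = (\<lambda>\<xi>. h (SOME y. y \<in> X \<and> \<beta> y = \<xi>))"
  have f: "f (\<beta> y) = h y" if y: "y \<in> X" for y
  proof -
    have "(SOME z. z \<in> X \<and> \<beta> z = \<beta> y) \<in> X \<and> \<beta> (SOME z. z \<in> X \<and> \<beta> z = \<beta> y) = \<beta> y"
      by (rule someI[of _ y]) (use y in simp)
    then show ?thesis unfolding f_def using equicontinuous_collapse[OF eq h _ y] by blast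
  qed
  have "continuous_map XT V (f \<circ> \<beta>)"
    by (rule continuous_map_eq[OF cont]) (simp add: f topspace_XT)
  then have "continuous_map YT V f" using continuous_compose_quotient_map[OF quotient_\<beta>] by blast
  moreover have "f ` Y = topspace V" unfolding onto\<beta>[symmetric] onto[symmetric] image_image using f by simp
  moreover have "f (act g \<xi>) = c g (f \<xi>)" if g: "g \<in> carrier G" and \<xi>: "\<xi> \<in> Y" for g \<xi>
  proof -
    have "\<xi> \<in> \<beta> ` X" using \<xi> onto\<beta> by simp
    then obtain y where y: "y \<in> X" "\<beta> y = \<xi>" by auto
    have "f (act g \<xi>) = f (\<beta> (sh g y))" using \<beta>_sh[OF g y(1)] y(2) by simp
    also have "\<dots> = c g (h y)" using f[OF X_sh[OF g y(1)]] eqv g y(1) by simp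
    finally show ?thesis using f[OF y(1)] y(2) by simp
  qed
  ultimately have "factor_map G YT act V c f" unfolding factor_map_def topspace_YT by simp
  then show "\<exists>f. factor_map G YT act V c f \<and> (\<forall>x\<in>topspace XT. h x = f (\<beta> x))"
    using f by (intro exI[of _ f]) (simp add: topspace_XT)
qed

end

section \<open>The ergodic measures\<close>

context layered_array
begin

abbreviation BX :: "('a \<Rightarrow> nat) measure" where "BX \<equiv> sigma X {T. openin XT T}"

lemma open_subset_X: "{T. openin XT T} \<subseteq> Pow X"
  using openin_subset[of XT] topspace_XT by auto

lemma sets_BX: "sets BX = borel_sets XT"
  using open_subset_X by (simp add: borel_sets_def topspace_XT)

lemma space_X: "sets M = borel_sets XT \<Longrightarrow> space M = X"
  by (metis sets_BX sets_eq_imp_space_eq space_measure_of_conv)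

lemma X_value: "y \<in> X \<Longrightarrow> b \<in> carrier G \<Longrightarrow> y b = 0 \<or> y b = 1"
  using X_FS[of y] unfolding topspace_FS by (auto dest: PiE_mem)

lemma coord_sets_X:
  assumes "sets M = borel_sets XT" "b \<in> carrier G"
  shows "{y \<in> X. y b = 1} \<in> sets M"
proof -
  have "openin XT {y \<in> X. \<forall>c\<in>{b}. y c = (\<lambda>_. 1) c}" using assms(2) by (intro openin_XT_window) simp_all
  then have "openin XT {y \<in> X. y b = 1}" by simp
  then show ?thesis unfolding assms(1) borel_sets_def by (intro sigma_sets.Basic) simp
qed

text \<open>Countably many windows generate the topology, so Borel measurability into the subshift can be
tested on coordinates.\<close>

definition window :: "'a set \<Rightarrow> 'a set \<Rightarrow> ('a \<Rightarrow> nat) set" where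
  "window K A = {z \<in> X. \<forall>b\<in>K. z b = 1 \<longleftrightarrow> b \<in> A}"

definition windows :: "('a \<Rightarrow> nat) set set" where
  "windows = (\<lambda>(K, A). window K A) ` ({K. finite K \<and> K \<subseteq> carrier G} \<times> {A. finite A \<and> A \<subseteq> carrier G})"

lemma countable_windows: "countable windows"
  unfolding windows_def
  by (intro countable_image countable_SIGMA countable_Collect_finite_subset countable_carrier)

lemma open_eq_windows:
  assumes "openin XT T"
  shows "T = \<Union>{C \<in> windows. C \<subseteq> T}"
proof (intro equalityI subsetI)
  fix y assume y: "y \<in> T"
  then have yX: "y \<in> X" using open_subset_X assms by blast
  obtain K where K: "finite K" "K \<subseteq> carrier G" "\<forall>z\<in>X. (\<forall>b\<in>K. z b = y b) \<longrightarrow> z \<in> T"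
    using XT_window[OF assms y] by (elim exE conjE)
  define A where "A = {b \<in> K. y b = 1}"
  have "window K A \<subseteq> T"
  proof
    fix z assume z: "z \<in> window K A"
    then have zX: "z \<in> X" by (simp add: window_def)
    have "z b = y b" if b: "b \<in> K" for b
    proof -
      have bG: "b \<in> carrier G" using b K by blast
      have "z b = 1 \<longleftrightarrow> y b = 1" using z b unfolding window_def A_def by blast
      then show ?thesis using X_value[OF zX bG] X_value[OF yX bG] by auto
    qed
    then show "z \<in> T" using K(3) zX by blast
  qed
  moreover have "finite A" "A \<subseteq> carrier G" using K by (auto simp: A_def)
  then have "window K A \<in> windows" unfolding windows_def using K by (intro rev_image_eqI[of "(K, A)"]) simp_all
  moreover have "y \<in> window K A" using yX by (simp add: window_def A_def)
  ultimately show "y \<in> \<Union>{C \<in> windows. C \<subseteq> T}" by blast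
qed blast

lemma measurable_to_X:
  assumes N: "sets N = borel_sets XT" and f: "f \<in> space M \<rightarrow> X"
    and coord: "\<And>b. b \<in> carrier G \<Longrightarrow> {x \<in> space M. f x b = 1} \<in> sets M"
  shows "f \<in> measurable M N"
proof (rule measurable_sigma_sets[where \<Omega>=X and A="{T. openin XT T}"])
  show "sets N = sigma_sets X {T. openin XT T}" using N by (simp add: borel_sets_def topspace_XT)
  show "{T. openin XT T} \<subseteq> Pow X" by (rule open_subset_X)
  show "f \<in> space M \<rightarrow> X" by (rule f)
  have win_meas: "f -` C \<inter> space M \<in> sets M" if C: "C \<in> windows" for C
  proof -
    obtain K A where K: "finite K" "K \<subseteq> carrier G" "C = window K A"
      using C by (auto simp: windows_def)
    have "{x \<in> space M. f x b = 1 \<longleftrightarrow> b \<in> A} \<in> sets M" if b: "b \<in> K" for b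
    proof -
      have "{x \<in> space M. f x b = 1} \<in> sets M" using coord b K by blast
      then show ?thesis by (cases "b \<in> A") (simp_all add: sets.sets_Collect_neg)
    qed
    then have "{x \<in> space M. \<forall>b\<in>K. f x b = 1 \<longleftrightarrow> b \<in> A} \<in> sets M"
      using K(1) by (intro sets.sets_Collect_finite_All)
    moreover have "f -` C \<inter> space M = {x \<in> space M. \<forall>b\<in>K. f x b = 1 \<longleftrightarrow> b \<in> A}"
      using f by (auto simp: K(3) window_def Pi_iff)
    ultimately show ?thesis by simp
  qed
  fix T assume "T \<in> {T. openin XT T}"
  then have "openin XT T" by simp
  define D where "D = {C \<in> windows. C \<subseteq> T}"
  have T: "T = \<Union>D" unfolding D_def by (rule open_eq_windows) fact
  have D: "D \<subseteq> windows" by (auto simp: D_def)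
  have "f -` T \<inter> space M = (\<Union>C\<in>D. f -` C \<inter> space M)"
    unfolding T by blast
  also have "\<dots> \<in> sets M"
    using countable_subset[OF D countable_windows] win_meas D by (intro sets.countable_UN') auto
  finally show "f -` T \<inter> space M \<in> sets M" .
qed

lemma measurable_\<beta>:
  assumes M: "sets M = borel_sets XT"
  shows "\<beta> \<in> measurable M \<nu>"
proof (rule measurable_sigma_sets[where \<Omega>=Y and A="{U. openin YT U}"])
  show "sets \<nu> = sigma_sets Y {U. openin YT U}" using sets_nu by (simp add: borel_sets_def topspace_YT)
  show "{U. openin YT U} \<subseteq> Pow Y" using openin_YT_iff by auto
  show "\<beta> \<in> space M \<rightarrow> Y" using \<beta>_in space_X[OF M] by simp
  fix T assume "T \<in> {U. openin YT U}"
  then have "openin XT {x \<in> topspace XT. \<beta> x \<in> T}"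
    using continuous_\<beta> openin_continuous_map_preimage by blast
  moreover have "\<beta> -` T \<inter> space M = {x \<in> topspace XT. \<beta> x \<in> T}"
    using space_X[OF M] by (auto simp: topspace_XT)
  ultimately show "\<beta> -` T \<inter> space M \<in> sets M"
    unfolding M by (simp add: borel_sets_def sigma_sets.Basic)
qed

lemma measurable_sh:
  assumes M: "sets M = borel_sets XT" and g: "g \<in> carrier G"
  shows "sh g \<in> measurable M M"
proof (rule measurable_to_X[OF M])
  show "sh g \<in> space M \<rightarrow> X" using X_sh[OF g] space_X[OF M] by simp
  fix b assume b: "b \<in> carrier G"
  have "{y \<in> X. y (b \<otimes> g) = 1} \<in> sets M" using b g by (intro coord_sets_X[OF M]) simp
  then show "{y \<in> space M. sh g y b = 1} \<in> sets M" using sh_apply[OF b] space_X[OF M] by simp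
qed

lemma sh_inverse: "g \<in> carrier G \<Longrightarrow> y \<in> X \<Longrightarrow> sh (inv g) (sh g y) = y"
  "g \<in> carrier G \<Longrightarrow> y \<in> X \<Longrightarrow> sh g (sh (inv g) y) = y"
  using sh_sh[of "inv g" g y] sh_sh[of g "inv g" y] sh_one[OF X_FS, of y] by simp_all

lemma pat_act:
  assumes g: "g \<in> carrier G" and \<xi>: "\<xi> \<in> Y"
    and C: "\<And>h. h \<in> carrier G \<Longrightarrow> h \<in> C' \<longleftrightarrow> h \<otimes> g \<in> C"
  shows "pat (act g \<xi>) C' = sh g (pat \<xi> C)"
proof (rule FS_eqI[OF pat_FS sh_FS[OF g pat_FS]])
  fix h assume h: "h \<in> carrier G"
  have hg: "h \<otimes> g \<in> carrier G" using h g by simp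
  have eq: "act h (act g \<xi>) = act (h \<otimes> g) \<xi>" using act_act[OF h g \<xi>] by simp
  have base: "h \<in> base (act g \<xi>) \<longleftrightarrow> h \<otimes> g \<in> base \<xi>"
  proof (cases "\<exists>n. act h (act g \<xi>) \<notin> clo (U n)")
    case False
    then have "act h (act g \<xi>) \<in> clo (U n)" "act (h \<otimes> g) \<xi> \<in> clo (U n)" for n using eq by simp_all
    then show ?thesis by (simp add: base_def)
  next
    case True
    then obtain n where n: "act h (act g \<xi>) \<notin> clo (U n)" by blast
    obtain r where r: "r \<in> carrier G" "r \<in> \<xi> (m n)" using odometer_ex[OF \<xi>] by blast
    show ?thesis
      using base_iff[OF act_in[OF g \<xi>] h n act_memI[OF g \<xi> r(2)]] base_iff[OF \<xi> hg n[unfolded eq] r(2)]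
        h g r(1) by (simp add: m_assoc)
  qed
  show "pat (act g \<xi>) C' h = 1 \<longleftrightarrow> sh g (pat \<xi> C) h = 1"
    using pat_eq_1[OF h, of "act g \<xi>" C'] pat_eq_1[OF hg, of \<xi> C] sh_apply[OF h, of g "pat \<xi> C"]
      base aper_act[OF g \<xi> h] C[OF h] by simp
qed

text \<open>The \<open>k\<close> equivariant sections of the factor map.\<close>

definition filling :: "nat \<Rightarrow> (nat \<Rightarrow> 'a set) \<Rightarrow> 'a \<Rightarrow> nat" where
  "filling j \<xi> = pat \<xi> (marks j \<xi>)"

lemma filling_X: "\<xi> \<in> Y \<Longrightarrow> j < k \<Longrightarrow> filling j \<xi> \<in> X" and \<beta>_filling: "\<xi> \<in> Y \<Longrightarrow> j < k \<Longrightarrow> \<beta> (filling j \<xi>) = \<xi>"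
  unfolding filling_def using pat_marks_in by simp_all

lemma filling_act:
  assumes g: "g \<in> carrier G" and \<xi>: "\<xi> \<in> Y"
  shows "filling j (act g \<xi>) = sh g (filling j \<xi>)"
  unfolding filling_def
proof (rule pat_act[OF g \<xi>])
  fix h assume h: "h \<in> carrier G"
  show "h \<in> marks j (act g \<xi>) \<longleftrightarrow> h \<otimes> g \<in> marks j \<xi>"
    unfolding marks_def using act_act[OF h g \<xi>] h g by simp
qed

lemma act_sets: "h \<in> carrier G \<Longrightarrow> {\<xi> \<in> Y. act h \<xi> \<in> clo A} \<in> sets \<nu>"
  using translate_sets[OF _ clo_sets] .

lemma Y_Collect_neg: "{\<xi> \<in> Y. Q \<xi>} \<in> sets \<nu> \<Longrightarrow> {\<xi> \<in> Y. \<not> Q \<xi>} \<in> sets \<nu>"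
  using sets.sets_Collect_neg[of \<nu> Q] space_nu by simp

lemma Y_Collect_conj: "{\<xi> \<in> Y. Q \<xi>} \<in> sets \<nu> \<Longrightarrow> {\<xi> \<in> Y. R \<xi>} \<in> sets \<nu> \<Longrightarrow> {\<xi> \<in> Y. Q \<xi> \<and> R \<xi>} \<in> sets \<nu>"
  using sets.sets_Collect_conj[of \<nu> R Q] space_nu by simp

lemma Y_Collect_disj: "{\<xi> \<in> Y. Q \<xi>} \<in> sets \<nu> \<Longrightarrow> {\<xi> \<in> Y. R \<xi>} \<in> sets \<nu> \<Longrightarrow> {\<xi> \<in> Y. Q \<xi> \<or> R \<xi>} \<in> sets \<nu>"
  using sets.sets_Collect_disj[of \<nu> R Q] space_nu by simp

lemma aper_sets:
  assumes h: "h \<in> carrier G"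
  shows "{\<xi> \<in> Y. h \<in> aper \<xi>} \<in> sets \<nu>"
proof -
  have "{\<xi> \<in> space \<nu>. \<forall>n. act h \<xi> \<in> clo (U n)} \<in> sets \<nu>"
    using act_sets[OF h] space_nu by (intro sets.sets_Collect_countable_All) simp
  then show ?thesis using h by (simp add: aper_def space_nu)
qed

lemma base_sets:
  assumes h: "h \<in> carrier G"
  shows "{\<xi> \<in> Y. h \<in> base \<xi>} \<in> sets \<nu>"
proof -
  have "{\<xi> \<in> Y. act h \<xi> \<notin> clo (U n) \<and> (\<exists>r\<in>\<xi> (m n). h \<otimes> r \<in> P)} \<in> sets \<nu>" for n
    using coord_sets[of "\<lambda>c. \<exists>r\<in>c. h \<otimes> r \<in> P" "m n"]
    by (intro Y_Collect_conj Y_Collect_neg act_sets h) (simp add: sets_nu)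
  then have "{\<xi> \<in> space \<nu>. \<exists>n. act h \<xi> \<notin> clo (U n) \<and> (\<exists>r\<in>\<xi> (m n). h \<otimes> r \<in> P)} \<in> sets \<nu>"
    using space_nu by (intro sets.sets_Collect_countable_Ex) simp
  then show ?thesis using h by (simp add: base_def space_nu)
qed

lemma pat_sets:
  assumes h: "h \<in> carrier G" and C: "{\<xi> \<in> Y. h \<in> C \<xi>} \<in> sets \<nu>"
  shows "{\<xi> \<in> Y. pat \<xi> (C \<xi>) h = 1} \<in> sets \<nu>"
  unfolding pat_eq_1[OF h] by (intro Y_Collect_disj Y_Collect_conj base_sets aper_sets h C)

lemma marks_sets: "h \<in> carrier G \<Longrightarrow> {\<xi> \<in> Y. h \<in> marks j \<xi>} \<in> sets \<nu>"
  using act_sets[of h "W j"] by (simp add: marks_def)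

lemma single_sets: "{\<xi> \<in> Y. h \<in> {p}} \<in> sets \<nu>"
proof -
  have "Y \<in> sets \<nu>" using sets.top[of \<nu>] space_nu by simp
  then show ?thesis by (cases "h = p") simp_all
qed

lemma measurable_filling:
  assumes N: "sets N = borel_sets XT" and j: "j < k"
  shows "filling j \<in> measurable \<nu> N"
proof (rule measurable_to_X[OF N])
  show "filling j \<in> space \<nu> \<rightarrow> X" using filling_X[OF _ j] space_nu by simp
  fix b assume "b \<in> carrier G"
  then show "{\<xi> \<in> space \<nu>. filling j \<xi> b = 1} \<in> sets \<nu>"
    unfolding space_nu filling_def using pat_sets marks_sets by blast
qed

text \<open>An array is given by countably many coordinates, and each coordinate of the pattern is a Borel function
  of the image of the array in the odometer.\<close>

lemma graph_sets:
  assumes M: "sets M = borel_sets XT"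
    and C: "\<And>h. h \<in> carrier G \<Longrightarrow> {\<xi> \<in> Y. h \<in> C \<xi>} \<in> sets \<nu>"
  shows "{y \<in> X. y = pat (\<beta> y) (C (\<beta> y))} \<in> sets M"
proof -
  have "{y \<in> X. y h = 1 \<longleftrightarrow> pat (\<beta> y) (C (\<beta> y)) h = 1} \<in> sets M" if h: "h \<in> carrier G" for h
  proof -
    have A: "{y \<in> space M. y h = 1} \<in> sets M" using coord_sets_X[OF M h] space_X[OF M] by simp
    have "\<beta> -` {\<xi> \<in> Y. pat \<xi> (C \<xi>) h = 1} \<inter> space M \<in> sets M"
      using measurable_\<beta>[OF M] pat_sets[OF h C[OF h]] by (rule measurable_sets)
    moreover have "\<beta> -` {\<xi> \<in> Y. pat \<xi> (C \<xi>) h = 1} \<inter> space M = {y \<in> space M. pat (\<beta> y) (C (\<beta> y)) h = 1}"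
      using \<beta>_in space_X[OF M] by auto
    ultimately have B: "{y \<in> space M. pat (\<beta> y) (C (\<beta> y)) h = 1} \<in> sets M" by simp
    have "{y \<in> space M. (y h = 1 \<longrightarrow> pat (\<beta> y) (C (\<beta> y)) h = 1) \<and> (pat (\<beta> y) (C (\<beta> y)) h = 1 \<longrightarrow> y h = 1)} \<in> sets M"
      using A B by (intro sets.sets_Collect_conj sets.sets_Collect_imp)
    then show ?thesis unfolding space_X[OF M] iff_conv_conj_imp .
  qed
  then have "(\<Inter>h\<in>carrier G. {y \<in> X. y h = 1 \<longleftrightarrow> pat (\<beta> y) (C (\<beta> y)) h = 1}) \<in> sets M"
    using countable_carrier carrier_not_empty by (intro sets.countable_INT') auto
  moreover have "{y \<in> X. y = pat (\<beta> y) (C (\<beta> y))}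
      = (\<Inter>h\<in>carrier G. {y \<in> X. y h = 1 \<longleftrightarrow> pat (\<beta> y) (C (\<beta> y)) h = 1})"
  proof (intro equalityI subsetI)
    fix y assume y: "y \<in> (\<Inter>h\<in>carrier G. {y \<in> X. y h = 1 \<longleftrightarrow> pat (\<beta> y) (C (\<beta> y)) h = 1})"
    then have yX: "y \<in> X" using carrier_not_empty by blast
    have "y = pat (\<beta> y) (C (\<beta> y))"
      by (rule FS_eqI[OF X_FS[OF yX] pat_FS]) (use y in blast)
    then show "y \<in> {y \<in> X. y = pat (\<beta> y) (C (\<beta> y))}" using yX by blast
  qed auto
  ultimately show ?thesis by simp
qed

text \<open>The ranges of the sections. Together with the sets \<open>marked_once p\<close> below they exhaust the subshift.\<close>

definition filled :: "nat \<Rightarrow> ('a \<Rightarrow> nat) set" where "filled j = {y \<in> X. y = filling j (\<beta> y)}"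

definition marked_once :: "'a \<Rightarrow> ('a \<Rightarrow> nat) set" where
  "marked_once p = {y \<in> X. p \<in> aper (\<beta> y) \<and> y = pat (\<beta> y) {p}}"

lemma filled_sets: "sets M = borel_sets XT \<Longrightarrow> filled j \<in> sets M"
  unfolding filled_def filling_def by (rule graph_sets[OF _ marks_sets])

lemma marked_once_sets:
  assumes M: "sets M = borel_sets XT" and p: "p \<in> carrier G"
  shows "marked_once p \<in> sets M"
proof -
  have "\<beta> -` {\<xi> \<in> Y. p \<in> aper \<xi>} \<inter> space M \<in> sets M"
    using measurable_\<beta>[OF M] aper_sets[OF p] by (rule measurable_sets)
  moreover have "{y \<in> X. y = pat (\<beta> y) {p}} \<in> sets M" by (rule graph_sets[OF M single_sets])
  moreover have "marked_once p = (\<beta> -` {\<xi> \<in> Y. p \<in> aper \<xi>} \<inter> space M) \<inter> {y \<in> X. y = pat (\<beta> y) {p}}"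
    unfolding marked_once_def using \<beta>_in space_X[OF M] by auto
  ultimately show ?thesis by (simp add: sets.Int)
qed

lemma filling_filled: "\<xi> \<in> Y \<Longrightarrow> j < k \<Longrightarrow> filling j \<xi> \<in> filled j"
  by (simp add: filled_def filling_X \<beta>_filling)

lemma sh_filled: "g \<in> carrier G \<Longrightarrow> y \<in> filled j \<Longrightarrow> sh g y \<in> filled j"
  unfolding filled_def using X_sh[of g y] \<beta>_sh[of g y] filling_act[of g "\<beta> y" j] \<beta>_in[of y] by simp

lemma sh_filled_iff:
  assumes "g \<in> carrier G" "y \<in> X"
  shows "sh g y \<in> filled j \<longleftrightarrow> y \<in> filled j"
  using sh_filled[of g y j] sh_filled[of "inv g" "sh g y" j] sh_inverse(1)[OF assms] assms by auto

lemma sh_marked_once_iff: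
  assumes g: "g \<in> carrier G" and y: "y \<in> X" and p: "p \<in> carrier G"
  shows "sh g y \<in> marked_once p \<longleftrightarrow> y \<in> marked_once (p \<otimes> g)"
proof -
  have \<xi>: "\<beta> y \<in> Y" using \<beta>_in[OF y] .
  have "pat (act g (\<beta> y)) {p} = sh g (pat (\<beta> y) {p \<otimes> g})"
    by (rule pat_act[OF g \<xi>]) (use g p in simp)
  moreover have "sh g y = sh g z \<longleftrightarrow> y = z" if z: "z \<in> topspace FS" for z
  proof
    assume "sh g y = sh g z"
    then have "sh (inv g) (sh g y) = sh (inv g) (sh g z)" by simp
    then show "y = z" using sh_sh[of "inv g" g y] sh_sh[of "inv g" g z] g sh_one[OF X_FS[OF y]] sh_one[OF z] by simp
  qed simp
  ultimately have "sh g y = pat (\<beta> (sh g y)) {p} \<longleftrightarrow> y = pat (\<beta> y) {p \<otimes> g}"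
    using \<beta>_sh[OF g y] pat_FS by simp
  then show ?thesis unfolding marked_once_def using X_sh[OF g y] y \<beta>_sh[OF g y] aper_act[OF g \<xi> p] by simp
qed

lemma marked_once_disjoint:
  assumes "p \<noteq> p'"
  shows "marked_once p \<inter> marked_once p' = {}"
proof -
  have "p = p'" if "y \<in> marked_once p" "y \<in> marked_once p'" for y
    using inj_onD[OF pat_single_inj[of "\<beta> y"], of p p'] that unfolding marked_once_def by auto
  then show ?thesis using assms by blast
qed

lemma X_partition: "X = (\<Union>j\<in>{..<k}. filled j) \<union> (\<Union>p\<in>carrier G. marked_once p)"
proof (intro equalityI subsetI)
  fix y assume y: "y \<in> X"
  from X_cases[OF y] show "y \<in> (\<Union>j\<in>{..<k}. filled j) \<union> (\<Union>p\<in>carrier G. marked_once p)"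
  proof
    assume "\<exists>j<k. y = pat (\<beta> y) (marks j (\<beta> y))"
    then show ?thesis using y unfolding filled_def filling_def by blast
  next
    assume "\<exists>p\<in>aper (\<beta> y). y = pat (\<beta> y) {p}"
    then show ?thesis using y unfolding marked_once_def aper_def by blast
  qed
qed (auto simp: filled_def marked_once_def)

text \<open>At most \<open>1 / c\<close> disjoint sets can have measure \<open>c\<close>, whereas the group is infinite.\<close>

lemma null_if_disjoint_translates:
  assumes M: "prob_space M" and S: "\<And>p. p \<in> carrier G \<Longrightarrow> A p \<in> sets M"
    and disj: "\<And>p p'. p \<noteq> p' \<Longrightarrow> A p \<inter> A p' = {}"
    and same: "\<And>p. p \<in> carrier G \<Longrightarrow> emeasure M (A p) = emeasure M (A \<one>)"
    and p: "p \<in> carrier G"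
  shows "emeasure M (A p) = 0"
proof -
  interpret M: prob_space M by (rule M)
  define c where "c = M.prob (A \<one>)"
  have c: "M.prob (A p) = c" if "p \<in> carrier G" for p
    using same[OF that] by (simp add: c_def Sigma_Algebra.measure_def)
  have bound: "real n * c \<le> 1" for n
  proof -
    obtain E where E: "finite E" "card E = n" "E \<subseteq> carrier G"
      using infinite_arbitrarily_large[OF infinite_carrier] by blast
    have "real n * c = (\<Sum>p\<in>E. M.prob (A p))" using c E by (simp add: subset_iff)
    also have "\<dots> = M.prob (\<Union>p\<in>E. A p)"
      using E S disj by (intro M.finite_measure_finite_Union[symmetric]) (auto simp: disjoint_family_on_def)
    also have "\<dots> \<le> 1" by simp
    finally show ?thesis .
  qed
  have "c \<le> 0"
  proof (rule ccontr)
    assume "\<not> c \<le> 0"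
    then obtain n where "1 < real n * c" using reals_Archimedean3[of c] by auto
    then show False using bound[of n] by simp
  qed
  then have "M.prob (A p) = 0" using c[OF p] measure_nonneg[of M "A p"] by linarith
  then show ?thesis by (simp add: M.emeasure_eq_measure)
qed

definition filling_measure :: "nat \<Rightarrow> ('a \<Rightarrow> nat) measure" where "filling_measure j = distr \<nu> BX (filling j)"

lemma sets_filling_measure: "sets (filling_measure j) = borel_sets XT"
  using sets_BX by (simp add: filling_measure_def)

lemma emeasure_filling_measure:
  assumes "j < k" "A \<in> borel_sets XT"
  shows "emeasure (filling_measure j) A = emeasure \<nu> {\<xi> \<in> Y. filling j \<xi> \<in> A}"
proof -
  have "emeasure (filling_measure j) A = emeasure \<nu> (filling j -` A \<inter> space \<nu>)"
    unfolding filling_measure_def using measurable_filling[OF sets_BX assms(1)] assms(2) sets_BX by (intro emeasure_distr) simp_all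
  also have "filling j -` A \<inter> space \<nu> = {\<xi> \<in> Y. filling j \<xi> \<in> A}" using space_nu by auto
  finally show ?thesis .
qed

lemma filling_preimage_sets: "j < k \<Longrightarrow> A \<in> borel_sets XT \<Longrightarrow> {\<xi> \<in> Y. filling j \<xi> \<in> A} \<in> sets \<nu>"
  using measurable_sets[OF measurable_filling[OF sets_BX], of j A] sets_BX space_nu
  by (simp add: vimage_def Int_def conj_commute)

lemma ergodic_filling_measure:
  assumes j: "j < k"
  shows "ergodic_probability G XT sh (filling_measure j)"
proof -
  have S: "sets (filling_measure j) = borel_sets XT" by (rule sets_filling_measure)
  have inv: "invariant_probability G XT sh (filling_measure j)"
    unfolding invariant_probability_def borel_probability_def
  proof (intro conjI ballI)
    show "prob_space (filling_measure j)" unfolding filling_measure_def by (rule prob_space_distr[OF measurable_filling[OF sets_BX j]])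
    show "sets (filling_measure j) = borel_sets XT" by (rule S)
    fix g assume g: "g \<in> carrier G"
    show "distr (filling_measure j) (filling_measure j) (sh g) = filling_measure j"
    proof (rule measure_eqI)
      show "sets (distr (filling_measure j) (filling_measure j) (sh g)) = sets (filling_measure j)" by simp
      fix A assume "A \<in> sets (distr (filling_measure j) (filling_measure j) (sh g))"
      then have A: "A \<in> sets (filling_measure j)" "A \<in> borel_sets XT" using S by simp_all
      have "emeasure (distr (filling_measure j) (filling_measure j) (sh g)) A = emeasure (filling_measure j) (sh g -` A \<inter> space (filling_measure j))"
        using measurable_sh[OF S g] A(1) by (rule emeasure_distr)
      also have "\<dots> = emeasure \<nu> {\<xi> \<in> Y. filling j \<xi> \<in> sh g -` A \<inter> space (filling_measure j)}"
        using measurable_sets[OF measurable_sh[OF S g] A(1)] S by (intro emeasure_filling_measure[OF j]) simp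
      also have "{\<xi> \<in> Y. filling j \<xi> \<in> sh g -` A \<inter> space (filling_measure j)} = {\<xi> \<in> Y. act g \<xi> \<in> {\<xi> \<in> Y. filling j \<xi> \<in> A}}"
        using filling_act[OF g] act_in[OF g] filling_X[OF _ j] space_X[OF S] by auto
      also have "emeasure \<nu> \<dots> = emeasure \<nu> {\<xi> \<in> Y. filling j \<xi> \<in> A}"
        using emeasure_translate[OF g filling_preimage_sets[OF j A(2)]] .
      finally show "emeasure (distr (filling_measure j) (filling_measure j) (sh g)) A = emeasure (filling_measure j) A"
        using emeasure_filling_measure[OF j A(2)] by simp
    qed
  qed
  moreover have "emeasure (filling_measure j) A = 0 \<or> emeasure (filling_measure j) A = 1"
    if A: "A \<in> sets (filling_measure j)" and invA: "\<forall>g\<in>carrier G. {x \<in> space (filling_measure j). sh g x \<in> A} = A" for A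
  proof -
    have A': "A \<in> borel_sets XT" using A S by simp
    have "{\<xi> \<in> Y. act g \<xi> \<in> {\<xi> \<in> Y. filling j \<xi> \<in> A}} = {\<xi> \<in> Y. filling j \<xi> \<in> A}" if g: "g \<in> carrier G" for g
    proof -
      have "sh g (filling j \<xi>) \<in> A \<longleftrightarrow> filling j \<xi> \<in> A" if "\<xi> \<in> Y" for \<xi>
      proof -
        have "filling j \<xi> \<in> {x \<in> space (filling_measure j). sh g x \<in> A} \<longleftrightarrow> filling j \<xi> \<in> A" using invA g by simp
        then show ?thesis using filling_X[OF that j] space_X[OF S] by simp
      qed
      then show ?thesis using filling_act[OF g] act_in[OF g] by auto
    qed
    then show ?thesis
      using ergodic_nu[OF filling_preimage_sets[OF j A']] emeasure_filling_measure[OF j A'] by simp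
  qed
  ultimately show ?thesis unfolding ergodic_probability_def by blast
qed

text \<open>The odometer is uniquely ergodic.\<close>

lemma push_forward_\<beta>:
  assumes M: "invariant_probability G XT sh M"
  shows "distr M \<nu> \<beta> = \<nu>"
proof -
  have S: "sets M = borel_sets XT" and P: "prob_space M" and d: "\<And>g. g \<in> carrier G \<Longrightarrow> distr M M (sh g) = M"
    using M by (auto simp: invariant_probability_def borel_probability_def)
  let ?L = "distr M \<nu> \<beta>"
  have SL: "sets ?L = borel_sets YT" using sets_nu by simp
  have "invariant_probability G YT act ?L"
    unfolding invariant_probability_def borel_probability_def
  proof (intro conjI ballI)
    show "prob_space ?L" using prob_space.prob_space_distr[OF P measurable_\<beta>[OF S]] .
    show "sets ?L = borel_sets YT" by (rule SL)
    fix g assume g: "g \<in> carrier G"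
    have mact: "act g \<in> measurable \<nu> \<nu>" using measurable_act[OF sets_nu g] .
    have "distr ?L ?L (act g) = distr ?L \<nu> (act g)" by (rule distr_cong) simp_all
    also have "\<dots> = distr M \<nu> (act g \<circ> \<beta>)" using distr_distr[OF mact measurable_\<beta>[OF S]] .
    also have "\<dots> = distr M \<nu> (\<beta> \<circ> sh g)"
      using \<beta>_sh[OF g] space_X[OF S] by (intro distr_cong) simp_all
    also have "\<dots> = distr (distr M M (sh g)) \<nu> \<beta>"
      using distr_distr[OF measurable_\<beta>[OF S] measurable_sh[OF S g]] by simp
    also have "\<dots> = ?L" using d[OF g] by simp
    finally show "distr ?L ?L (act g) = ?L" .
  qed
  then show ?thesis using invariant_unique[OF _ inv_nu] by blast
qed

text \<open>The single marks are null, so the range of some section has positive measure. It is invariant, so it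
has full measure, and there the measure is determined by its image in the odometer.\<close>

lemma ergodic_is_filling_measure:
  assumes M: "ergodic_probability G XT sh M"
  shows "\<exists>j<k. M = filling_measure j"
proof -
  have inv: "invariant_probability G XT sh M"
    and erg: "\<And>A. A \<in> sets M \<Longrightarrow> (\<And>g. g \<in> carrier G \<Longrightarrow> {x \<in> space M. sh g x \<in> A} = A)
        \<Longrightarrow> emeasure M A = 0 \<or> emeasure M A = 1"
    using M by (auto simp: ergodic_probability_def)
  have S: "sets M = borel_sets XT" and P: "prob_space M" and d: "\<And>g. g \<in> carrier G \<Longrightarrow> distr M M (sh g) = M"
    using inv by (auto simp: invariant_probability_def borel_probability_def)
  interpret M: prob_space M by (rule P)
  have sp: "space M = X" using space_X[OF S] .
  have marked_once_null: "emeasure M (marked_once p) = 0" if p: "p \<in> carrier G" for p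
  proof (rule null_if_disjoint_translates[OF P marked_once_sets[OF S] marked_once_disjoint _ p])
    fix g assume g: "g \<in> carrier G"
    have "emeasure M (marked_once \<one>) = emeasure (distr M M (sh g)) (marked_once \<one>)" using d[OF g] by simp
    also have "\<dots> = emeasure M (sh g -` marked_once \<one> \<inter> space M)"
      using measurable_sh[OF S g] marked_once_sets[OF S one_closed] by (rule emeasure_distr)
    also have "sh g -` marked_once \<one> \<inter> space M = marked_once g"
      using sh_marked_once_iff[OF g _ one_closed] g unfolding sp by (auto simp: marked_once_def)
    finally show "emeasure M (marked_once g) = emeasure M (marked_once \<one>)" by simp
  qed
  have "\<exists>j<k. emeasure M (filled j) \<noteq> 0"
  proof (rule ccontr)
    assume "\<not> ?thesis"
    then have "(\<Union>j\<in>{..<k}. filled j) \<in> null_sets M"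
      using filled_sets[OF S] by (intro null_sets_UN') (auto simp: null_sets_def)
    moreover have "(\<Union>p\<in>carrier G. marked_once p) \<in> null_sets M"
      using marked_once_null marked_once_sets[OF S] countable_carrier by (intro null_sets_UN') (auto simp: null_sets_def)
    ultimately have "X \<in> null_sets M" unfolding X_partition by (rule null_sets.Un)
    then show False using M.emeasure_space_1 sp by (auto simp: null_sets_def)
  qed
  then obtain j where j: "j < k" "emeasure M (filled j) \<noteq> 0" by blast
  have "{x \<in> space M. sh g x \<in> filled j} = filled j" if "g \<in> carrier G" for g
    unfolding sp using sh_filled_iff[OF that] by (auto simp: filled_def)
  then have full: "emeasure M (filled j) = 1" using erg[OF filled_sets[OF S]] j(2) by blast
  have "M = filling_measure j"
  proof (rule measure_eqI)
    show "sets M = sets (filling_measure j)" using S sets_filling_measure by simp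
    fix A assume A: "A \<in> sets M"
    then have A': "A \<in> borel_sets XT" using S by simp
    have filled_set: "filled j \<in> sets M" using filled_sets[OF S] .
    have AE_filled: "AE x in M. x \<in> filled j" using full M.AE_in_set_eq_1[OF filled_set] by (simp add: M.emeasure_eq_measure)
    have pre: "{\<xi> \<in> Y. filling j \<xi> \<in> A} \<in> sets \<nu>" using filling_preimage_sets[OF j(1) A'] .
    have "emeasure M A = emeasure M (\<beta> -` {\<xi> \<in> Y. filling j \<xi> \<in> A} \<inter> space M)"
    proof (rule emeasure_eq_AE)
      show "AE x in M. x \<in> A \<longleftrightarrow> x \<in> \<beta> -` {\<xi> \<in> Y. filling j \<xi> \<in> A} \<inter> space M"
        using AE_filled
      proof (rule AE_mp, intro AE_I2 impI)
        fix x assume "x \<in> filled j"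
        then have x: "x \<in> X" "filling j (\<beta> x) = x" by (simp_all add: filled_def)
        then show "x \<in> A \<longleftrightarrow> x \<in> \<beta> -` {\<xi> \<in> Y. filling j \<xi> \<in> A} \<inter> space M" using \<beta>_in sp by simp
      qed
      show "A \<in> sets M" by (rule A)
      show "\<beta> -` {\<xi> \<in> Y. filling j \<xi> \<in> A} \<inter> space M \<in> sets M"
        using measurable_\<beta>[OF S] pre by (rule measurable_sets)
    qed
    also have "\<dots> = emeasure (distr M \<nu> \<beta>) {\<xi> \<in> Y. filling j \<xi> \<in> A}"
      using measurable_\<beta>[OF S] pre by (rule emeasure_distr[symmetric])
    also have "\<dots> = emeasure (filling_measure j) A" using push_forward_\<beta>[OF inv] emeasure_filling_measure[OF j(1) A'] by simp
    finally show "emeasure M A = emeasure (filling_measure j) A" .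
  qed
  then show ?thesis using j(1) by blast
qed

text \<open>The inverse of \<open>\<beta>\<close> on the range of the section is the section, which is defined on the entire odometer.\<close>

lemma isomorphic_filling_measure:
  assumes j: "j < k"
  shows "isomorphic_via G (filling_measure j) sh \<nu> act \<beta>"
  unfolding isomorphic_via_def
proof (intro conjI)
  have S: "sets (filling_measure j) = borel_sets XT" by (rule sets_filling_measure)
  have inv: "invariant_probability G XT sh (filling_measure j)" using ergodic_filling_measure[OF j] by (simp add: ergodic_probability_def)
  show m\<beta>: "\<beta> \<in> measurable (filling_measure j) \<nu>" by (rule measurable_\<beta>[OF S])
  show "distr (filling_measure j) \<nu> \<beta> = \<nu>" by (rule push_forward_\<beta>[OF inv])
  have filled_X: "filled j \<subseteq> X" by (auto simp: filled_def)
  have Ys: "Y \<in> sets \<nu>" using sets.top[of \<nu>] space_nu by simp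
  have filling_image: "filling j ` Y = filled j"
  proof (intro equalityI subsetI)
    fix y assume "y \<in> filled j"
    then have "y = filling j (\<beta> y)" "\<beta> y \<in> Y" using \<beta>_in by (auto simp: filled_def)
    then show "y \<in> filling j ` Y" by (rule image_eqI)
  qed (use filling_filled[OF _ j] in blast)
  have bij: "bij_betw \<beta> (filled j) Y"
  proof (rule bij_betw_byWitness[where f' = "filling j"])
    show "\<forall>y\<in>filled j. filling j (\<beta> y) = y" by (simp add: filled_def)
    show "\<forall>\<xi>\<in>Y. \<beta> (filling j \<xi>) = \<xi>" using \<beta>_filling[OF _ j] by blast
    show "\<beta> ` filled j \<subseteq> Y" using \<beta>_in filled_X by blast
    show "filling j ` Y \<subseteq> filled j" using filling_image by simp
  qed
  have inv_filling: "the_inv_into (filled j) \<beta> \<xi> = filling j \<xi>" if "\<xi> \<in> Y" for \<xi>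
    using the_inv_into_f_eq[OF bij_betw_imp_inj_on[OF bij] \<beta>_filling[OF that j] filling_filled[OF that j]] .
  show "\<exists>X0\<in>sets (filling_measure j). \<exists>Y0\<in>sets \<nu>.
        emeasure (filling_measure j) X0 = 1 \<and> emeasure \<nu> Y0 = 1 \<and>
        (\<forall>g\<in>carrier G. sh g ` X0 = X0 \<and> act g ` Y0 = Y0) \<and>
        bij_betw \<beta> X0 Y0 \<and>
        \<beta> \<in> measurable (restrict_space (filling_measure j) X0) (restrict_space \<nu> Y0) \<and>
        the_inv_into X0 \<beta> \<in> measurable (restrict_space \<nu> Y0) (restrict_space (filling_measure j) X0) \<and>
        (\<forall>g\<in>carrier G. \<forall>x\<in>X0. \<beta> (sh g x) = act g (\<beta> x))"
  proof (intro bexI[of _ "filled j"] bexI[of _ Y] conjI ballI)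
    show "filled j \<in> sets (filling_measure j)" by (rule filled_sets[OF S])
    show "Y \<in> sets \<nu>" by (rule Ys)
    show nuY: "emeasure \<nu> Y = 1" using emeasure_space_1 space_nu by simp
    have "{\<xi> \<in> Y. filling j \<xi> \<in> filled j} = Y" using filling_filled[OF _ j] by blast
    then show "emeasure (filling_measure j) (filled j) = 1"
      using emeasure_filling_measure[OF j, of "filled j"] filled_sets[OF S, of j] S nuY by simp
    show "bij_betw \<beta> (filled j) Y" by (rule bij)
    show "\<beta> (sh g x) = act g (\<beta> x)" if "g \<in> carrier G" "x \<in> filled j" for g x
      using \<beta>_sh[OF that(1)] that(2) filled_X by blast
    show "\<beta> \<in> measurable (restrict_space (filling_measure j) (filled j)) (restrict_space \<nu> Y)"
      using m\<beta> by (rule measurable_restrict_space3) (use \<beta>_in filled_X in blast)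
    have "filling j \<in> measurable (restrict_space \<nu> Y) (restrict_space (filling_measure j) (filled j))"
      using measurable_filling[OF S j] by (rule measurable_restrict_space3) (use filling_filled[OF _ j] in blast)
    moreover have "the_inv_into (filled j) \<beta> \<in> measurable (restrict_space \<nu> Y) (restrict_space (filling_measure j) (filled j))
        \<longleftrightarrow> filling j \<in> measurable (restrict_space \<nu> Y) (restrict_space (filling_measure j) (filled j))"
      by (rule measurable_cong) (use inv_filling in \<open>simp add: space_restrict_space space_nu\<close>)
    ultimately show "the_inv_into (filled j) \<beta> \<in> measurable (restrict_space \<nu> Y) (restrict_space (filling_measure j) (filled j))"
      by simp
    fix g assume g: "g \<in> carrier G"
    show "sh g ` filled j = filled j"
    proof (intro equalityI subsetI)
      fix y assume y: "y \<in> filled j"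
      have "y = sh g (sh (inv g) y)" using sh_inverse(2)[OF g] y filled_X by auto
      moreover have "sh (inv g) y \<in> filled j" using sh_filled[OF inv_closed[OF g] y] .
      ultimately show "y \<in> sh g ` filled j" by (rule image_eqI)
    qed (use sh_filled[OF g] in blast)
    show "act g ` Y = Y"
    proof (intro equalityI subsetI)
      fix \<xi> assume \<xi>: "\<xi> \<in> Y"
      have "\<xi> = act g (act (inv g) \<xi>)" using act_inv(2)[OF g \<xi>] by simp
      moreover have "act (inv g) \<xi> \<in> Y" using act_in[OF inv_closed[OF g] \<xi>] .
      ultimately show "\<xi> \<in> act g ` Y" by (rule image_eqI)
    qed (use act_in[OF g] in blast)
  qed
qed

section \<open>Size of the set of free positions\<close>

text \<open>The set of points \<open>\<xi>\<close> for which the position \<open>\<one>\<close> is free and visits \<open>W j\<close>. Its positive measure makes the \<open>k\<close>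
measures different and the set of free positions nonempty.\<close>

definition free_marks :: "nat \<Rightarrow> (nat \<Rightarrow> 'a set) set" where "free_marks j = (\<Inter>n. clo (U n \<inter> W j))"

lemma free_marks_pos:
  assumes j: "0 < j" "j < k"
  shows "prob (free_marks j) > 0"
proof -
  obtain \<delta> where \<delta>: "\<delta> > 0" "\<forall>n j. 0 < j \<longrightarrow> j < k \<longrightarrow> \<delta> \<le> prob (clo (U n \<inter> W j))"
    using U_dense by blast
  have "decseq (\<lambda>n. clo (U n \<inter> W j))"
    using U_Suc unfolding decseq_Suc_iff clo_def by blast
  then have "(\<lambda>n. prob (clo (U n \<inter> W j))) \<longlonglongrightarrow> prob (\<Inter>n. clo (U n \<inter> W j))"
    using clo_sets by (intro finite_Lim_measure_decseq) auto
  moreover have "\<forall>n. \<delta> \<le> prob (clo (U n \<inter> W j))" using \<delta>(2) j by blast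
  ultimately have "\<delta> \<le> prob (free_marks j)" unfolding free_marks_def by (intro Lim_bounded2) auto
  then show ?thesis using \<delta>(1) by linarith
qed

lemma free_marks_sets: "free_marks j \<in> sets \<nu>"
  unfolding free_marks_def using clo_sets by (intro sets.countable_INT) auto

lemma free_marks_subset: "\<xi> \<in> free_marks j \<Longrightarrow> \<xi> \<in> Y \<and> \<one> \<in> aper \<xi> \<and> \<one> \<in> marks j \<xi>"
proof -
  assume \<xi>: "\<xi> \<in> free_marks j"
  then have Y: "\<xi> \<in> Y" and in_all: "\<xi> \<in> clo (U n)" "\<xi> \<in> clo (W j)" for n by (auto simp: free_marks_def clo_def)
  then show ?thesis using act_one[OF Y] by (simp add: aper_def marks_def)
qed

lemma marks_disjoint:
  assumes "i < k" "j < k" "i \<noteq> j" "\<xi> \<in> Y"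
  shows "marks i \<xi> \<inter> marks j \<xi> = {}"
proof -
  have False if h: "h \<in> marks i \<xi>" "h \<in> marks j \<xi>" for h
  proof -
    have hG: "h \<in> carrier G" using h by (simp add: marks_def)
    obtain r where r: "r \<in> \<xi> (m 0)" using odometer_ex[OF assms(4)] by blast
    have "h \<otimes> r \<in> W i" "h \<otimes> r \<in> W j"
      using h act_clo_iff[OF W_periodic assms(4) hG r] assms(1,2) unfolding marks_def by blast+
    then show False using W_disjoint[OF assms(1,2,3)] by blast
  qed
  then show ?thesis by blast
qed

lemma filling_measure_inj: "inj_on filling_measure {..<k}"
proof -
  have ne: "filling_measure i \<noteq> filling_measure j" if ij: "i < k" "j < k" "0 < j" "i \<noteq> j" for i j
  proof
    assume eq: "filling_measure i = filling_measure j"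
    define A where "A = \<beta> -` free_marks j \<inter> {y \<in> X. y \<one> = 1}"
    have "\<beta> -` free_marks j \<inter> space BX \<in> sets BX" using measurable_\<beta>[OF sets_BX] free_marks_sets by (rule measurable_sets)
    moreover have "{y \<in> X. y \<one> = 1} \<in> sets BX" by (rule coord_sets_X[OF sets_BX]) simp
    ultimately have "(\<beta> -` free_marks j \<inter> space BX) \<inter> {y \<in> X. y \<one> = 1} \<in> sets BX" by (rule sets.Int)
    moreover have "(\<beta> -` free_marks j \<inter> space BX) \<inter> {y \<in> X. y \<one> = 1} = A"
      unfolding A_def using space_X[OF sets_BX] by blast
    ultimately have A: "A \<in> borel_sets XT" using sets_BX by simp
    have val: "filling l \<xi> \<in> A \<longleftrightarrow> \<xi> \<in> free_marks j \<and> \<one> \<in> marks l \<xi>" if "\<xi> \<in> Y" "l < k" for \<xi> l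
    proof -
      have "\<one> \<notin> base \<xi>" if "\<xi> \<in> free_marks j" using free_marks_subset[OF that] base_aper_disjoint by blast
      then show ?thesis
        unfolding A_def using filling_X[OF that] \<beta>_filling[OF that] free_marks_subset[of \<xi> j] pat_eq_1[OF one_closed, of \<xi> "marks l \<xi>"]
        by (auto simp: filling_def)
    qed
    have "{\<xi> \<in> Y. filling j \<xi> \<in> A} = free_marks j" using val[OF _ ij(2)] free_marks_subset by blast
    then have "emeasure (filling_measure j) A = emeasure \<nu> (free_marks j)" using emeasure_filling_measure[OF ij(2) A] by simp
    moreover have none: "{\<xi> \<in> Y. filling i \<xi> \<in> A} = {}"
      using val[OF _ ij(1)] free_marks_subset marks_disjoint[OF ij(1,2,4)] by blast
    have "emeasure (filling_measure i) A = 0" unfolding emeasure_filling_measure[OF ij(1) A] none by simp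
    ultimately have "emeasure \<nu> (free_marks j) = 0" using eq by simp
    then show False using free_marks_pos[OF ij(3,2)] by (simp add: emeasure_eq_measure)
  qed
  show ?thesis
  proof (rule inj_onI, rule ccontr)
    fix i j assume ij: "i \<in> {..<k}" "j \<in> {..<k}" "filling_measure i = filling_measure j" "i \<noteq> j"
    then consider "0 < i" | "0 < j" by linarith
    then show False using ne[of i j] ne[of j i] ij by cases simp_all
  qed
qed

lemma ergodic_measures: "{M. ergodic_probability G XT sh M} = filling_measure ` {..<k}"
  using ergodic_is_filling_measure ergodic_filling_measure by blast

lemma card_aper_sets: "{\<xi> \<in> Y. finite (aper \<xi>) \<and> card (aper \<xi>) = n} \<in> sets \<nu>"
proof -
  let ?E = "{E. finite E \<and> E \<subseteq> carrier G} \<inter> {E. card E = n}"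
  have cE: "countable ?E"
    by (rule countable_subset[OF _ countable_Collect_finite_subset[OF countable_carrier]]) blast
  have one: "{\<xi> \<in> Y. aper \<xi> = E} \<in> sets \<nu>" if E: "E \<subseteq> carrier G" for E
  proof -
    have "{\<xi> \<in> Y. h \<in> aper \<xi> \<longleftrightarrow> h \<in> E} \<in> sets \<nu>" if "h \<in> carrier G" for h
      using aper_sets[OF that] Y_Collect_neg[OF aper_sets[OF that]] by (cases "h \<in> E") simp_all
    then have "(\<Inter>h\<in>carrier G. {\<xi> \<in> Y. h \<in> aper \<xi> \<longleftrightarrow> h \<in> E}) \<in> sets \<nu>"
      using countable_carrier carrier_not_empty by (intro sets.countable_INT') auto
    moreover have "(\<Inter>h\<in>carrier G. {\<xi> \<in> Y. h \<in> aper \<xi> \<longleftrightarrow> h \<in> E}) = {\<xi> \<in> Y. aper \<xi> = E}"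
    proof (intro equalityI subsetI)
      fix \<xi> assume \<xi>: "\<xi> \<in> (\<Inter>h\<in>carrier G. {\<xi> \<in> Y. h \<in> aper \<xi> \<longleftrightarrow> h \<in> E})"
      then have "\<xi> \<in> Y" using carrier_not_empty by blast
      moreover have "h \<in> aper \<xi> \<longleftrightarrow> h \<in> E" for h
        using \<xi> E by (cases "h \<in> carrier G") (auto simp: aper_def)
      ultimately show "\<xi> \<in> {\<xi> \<in> Y. aper \<xi> = E}" by blast
    qed blast
    ultimately show ?thesis by simp
  qed
  have "{\<xi> \<in> Y. finite (aper \<xi>) \<and> card (aper \<xi>) = n} = (\<Union>E\<in>?E. {\<xi> \<in> Y. aper \<xi> = E})"
    by (auto simp: aper_def)
  also have "\<dots> \<in> sets \<nu>" using cE one by (intro sets.countable_UN') auto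
  finally show ?thesis .
qed

text \<open>The number of free positions is invariant, hence constant; a finite constant is excluded,
  since each of the infinitely many positions of the group is free with the same positive
  probability.\<close>

lemma AE_infinite_aper: "AE \<xi> in \<nu>. infinite (aper \<xi>)"
proof -
  define A where "A = (\<lambda>h. {\<xi> \<in> Y. h \<in> aper \<xi>})"
  define c where "c = prob (A \<one>)"
  have As: "A h \<in> sets \<nu>" if "h \<in> carrier G" for h using aper_sets[OF that] by (simp add: A_def)
  have one_lt: "1 < k" using k_ge_2 by simp
  have "free_marks 1 \<subseteq> A \<one>" using free_marks_subset by (auto simp: A_def)
  then have "prob (free_marks 1) \<le> c" unfolding c_def using As by (intro finite_measure_mono) simp_all
  then have c: "c > 0" using free_marks_pos[of 1] one_lt by linarith
  have Ac: "emeasure \<nu> (A h) = ennreal c" if h: "h \<in> carrier G" for h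
  proof -
    have "A h = {\<xi> \<in> Y. act h \<xi> \<in> A \<one>}"
      using aper_act[OF h _ one_closed] act_in[OF h] h by (auto simp: A_def)
    then show ?thesis using emeasure_translate[OF h As[OF one_closed]] by (simp add: emeasure_eq_measure c_def)
  qed
  have null: "emeasure \<nu> {\<xi> \<in> Y. finite (aper \<xi>) \<and> card (aper \<xi>) = n} = 0" (is "emeasure \<nu> ?F = 0") for n
  proof (rule ccontr)
    assume nz: "emeasure \<nu> ?F \<noteq> 0"
    have Fs: "?F \<in> sets \<nu>" by (rule card_aper_sets)
    have "{\<xi> \<in> Y. act g \<xi> \<in> ?F} = ?F" if g: "g \<in> carrier G" for g
    proof -
      have bij: "bij_betw (\<lambda>h. h \<otimes> g) (aper (act g \<xi>)) (aper \<xi>)" if \<xi>: "\<xi> \<in> Y" for \<xi>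
      proof (rule bij_betw_byWitness[where f' = "\<lambda>h. h \<otimes> inv g"])
        have G: "h \<in> carrier G" if "h \<in> aper \<eta>" for h \<eta> using that by (simp add: aper_def)
        show "\<forall>h\<in>aper (act g \<xi>). h \<otimes> g \<otimes> inv g = h" using G g by (simp add: m_assoc)
        show "\<forall>h\<in>aper \<xi>. h \<otimes> inv g \<otimes> g = h" using G g by (simp add: m_assoc)
        show "(\<lambda>h. h \<otimes> g) ` aper (act g \<xi>) \<subseteq> aper \<xi>" using aper_act[OF g \<xi>] G by blast
        show "(\<lambda>h. h \<otimes> inv g) ` aper \<xi> \<subseteq> aper (act g \<xi>)"
        proof
          fix x assume "x \<in> (\<lambda>h. h \<otimes> inv g) ` aper \<xi>"
          then obtain h where h: "h \<in> aper \<xi>" "x = h \<otimes> inv g" by blast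
          then have "x \<in> carrier G" "x \<otimes> g = h" using G[OF h(1)] g by (simp_all add: m_assoc)
          then show "x \<in> aper (act g \<xi>)" using aper_act[OF g \<xi>] h(1) by blast
        qed
      qed
      show ?thesis using bij_betw_finite[OF bij] bij_betw_same_card[OF bij] act_in[OF g] by auto
    qed
    then have full: "emeasure \<nu> ?F = 1" using ergodic_nu[OF Fs] nz by blast
    \<comment> \<open>Among \<open>s\<close> positions \<open>s * c\<close> are free on average, too many for at most \<open>n\<close> free positions.\<close>
    obtain s where s: "real n < real s * c" using reals_Archimedean3[OF c] by blast
    obtain E where E: "finite E" "card E = s" "E \<subseteq> carrier G"
      using infinite_arbitrarily_large[OF infinite_carrier] by blast
    have AE_F: "AE \<xi> in \<nu>. \<xi> \<in> ?F" using full AE_in_set_eq_1[OF Fs] by (simp add: emeasure_eq_measure)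
    have "ennreal (real s * c) = (\<Sum>h\<in>E. emeasure \<nu> (A h))"
      using Ac E c by (simp add: subset_iff ennreal_mult ennreal_of_nat_eq_real_of_nat)
    also have "\<dots> = (\<Sum>h\<in>E. \<integral>\<^sup>+\<xi>. indicator (A h) \<xi> \<partial>\<nu>)"
      using As E by (intro sum.cong refl) (auto simp: subset_iff)
    also have "\<dots> = (\<integral>\<^sup>+\<xi>. (\<Sum>h\<in>E. indicator (A h) \<xi>) \<partial>\<nu>)"
      using As E by (intro nn_integral_sum[symmetric]) auto
    also have "\<dots> \<le> (\<integral>\<^sup>+\<xi>. of_nat n \<partial>\<nu>)"
    proof (rule nn_integral_mono_AE, rule AE_mp[OF AE_F], intro AE_I2 impI)
      fix \<xi> assume \<xi>: "\<xi> \<in> ?F"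
      have "(\<Sum>h\<in>E. indicator (A h) \<xi> :: ennreal) = (\<Sum>h\<in>E. of_bool (h \<in> aper \<xi>))"
        using \<xi> by (intro sum.cong refl) (simp add: indicator_def A_def)
      also have "\<dots> = of_nat (card (E \<inter> aper \<xi>))" using E(1) by simp
      also have "\<dots> \<le> of_nat n"
        using \<xi> card_mono[of "aper \<xi>" "E \<inter> aper \<xi>"] by (intro of_nat_mono) auto
      finally show "(\<Sum>h\<in>E. indicator (A h) \<xi>) \<le> (of_nat n :: ennreal)" .
    qed
    also have "\<dots> = ennreal (real n)" using emeasure_space_1 by (simp add: ennreal_of_nat_eq_real_of_nat)
    finally have "real s * c \<le> real n" using c by (simp add: ennreal_le_iff)
    then show False using s by simp
  qed
  have "AE \<xi> in \<nu>. \<forall>n. \<not> (finite (aper \<xi>) \<and> card (aper \<xi>) = n)"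
    unfolding AE_all_countable
  proof
    fix n
    show "AE \<xi> in \<nu>. \<not> (finite (aper \<xi>) \<and> card (aper \<xi>) = n)"
      by (rule AE_I[OF _ null card_aper_sets[of n]]) (auto simp: space_nu)
  qed
  then show ?thesis by (rule AE_mp) (intro AE_I2 impI, blast)
qed

end

section \<open>Irregularity and rank\<close>

context layered_array
begin

lemma irregular_x0: "irregular_toeplitz G x0"
  unfolding irregular_toeplitz_def
proof
  show "toeplitz G x0" by (rule toeplitz_x0)
  show "\<not> regular_toeplitz G x0"
  proof
    assume "regular_toeplitz G x0"
    then have "emeasure \<nu> (\<beta> ` {y \<in> X. toeplitz G y}) = 1"
      using odometer_seq max_equicontinuous inv_nu unfolding regular_toeplitz_def by blast
    moreover have "emeasure \<nu> (\<beta> ` {y \<in> X. toeplitz G y})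
        \<le> emeasure \<nu> {\<xi> \<in> Y. finite (aper \<xi>) \<and> card (aper \<xi>) = 0}"
      using toeplitz_aper_empty \<beta>_in card_aper_sets by (intro emeasure_mono) auto
    moreover have "emeasure \<nu> {\<xi> \<in> Y. finite (aper \<xi>) \<and> card (aper \<xi>) = 0} = 0"
    proof -
      have "AE \<xi> in \<nu>. \<xi> \<notin> {\<xi> \<in> Y. finite (aper \<xi>) \<and> card (aper \<xi>) = 0}"
        using AE_infinite_aper by (rule AE_mp) (intro AE_I2 impI, blast)
      then show ?thesis using AE_iff_measurable[OF card_aper_sets[of 0], of "\<lambda>\<xi>. \<xi> \<notin> {\<xi> \<in> Y. finite (aper \<xi>) \<and> card (aper \<xi>) = 0}"]
        by (auto simp: space_nu)
    qed
    ultimately show False by simp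
  qed
qed

lemma AE_fiber: "AE \<xi> in \<nu>. infinite (fiber XT \<beta> \<xi>) \<and> countable (fiber XT \<beta> \<xi>)"
  using AE_infinite_aper
proof (rule AE_mp, intro AE_I2 impI)
  fix \<xi> assume "\<xi> \<in> space \<nu>" "infinite (aper \<xi>)"
  then show "infinite (fiber XT \<beta> \<xi>) \<and> countable (fiber XT \<beta> \<xi>)"
    using infinite_fiber countable_fiber space_nu by simp
qed

lemma infinite_rank: "countably_infinite_maximal_rank XT YT \<beta>"
  unfolding countably_infinite_maximal_rank_def
proof
  show "\<forall>\<xi>\<in>topspace YT. countable (fiber XT \<beta> \<xi>)" using countable_fiber topspace_YT by simp
  have "\<exists>\<xi>\<in>Y. infinite (fiber XT \<beta> \<xi>)"
  proof (rule ccontr)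
    assume none: "\<not> ?thesis"
    have "AE \<xi> in \<nu>. False"
      by (rule AE_mp[OF AE_fiber], intro AE_I2 impI) (use none space_nu in blast)
    then show False by (simp add: AE_False)
  qed
  then obtain \<xi> where \<xi>: "\<xi> \<in> topspace YT" "infinite (fiber XT \<beta> \<xi>)" using topspace_YT by auto
  then have "\<infinity> \<le> maximal_rank XT YT \<beta>"
    unfolding maximal_rank_def by (intro SUP_upper2[OF \<xi>(1)]) simp
  then show "maximal_rank XT YT \<beta> = \<infinity>" by simp
qed

end

theorem theorem1p4:
  fixes G :: "('a, 'b) monoid_scheme"
    and \<Gamma> :: "nat \<Rightarrow> 'a set"
    and \<nu> :: "(nat \<Rightarrow> 'a set) measure"
    and k :: nat
  assumes "group G"
    and "countable (carrier G)" and "infinite (carrier G)"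
    and "amenable G"
    and "residually_finite G"
    and "odometer_sequence G \<Gamma>"
    and "\<And>n. \<Gamma> n \<lhd> G"
    and "(\<Inter>n. \<Gamma> n) = {\<one>\<^bsub>G\<^esub>}"
    and "normalized_haar (odometer_group G \<Gamma>) (odometer_top G \<Gamma>) \<nu>"
    and "k \<ge> 2"
  shows "\<exists>x0 \<beta>.
    irregular_toeplitz G x0 \<and>
    factor_map G (orbit_closure_top G x0) (shift_action G)
      (odometer_top G \<Gamma>) (odometer_action G) \<beta> \<and>
    almost_one_to_one (orbit_closure_top G x0) \<beta> \<and>
    finite {\<mu>. ergodic_probability G (orbit_closure_top G x0) (shift_action G) \<mu>} \<and>
    card {\<mu>. ergodic_probability G (orbit_closure_top G x0) (shift_action G) \<mu>} = k \<and>
    (\<forall>\<mu>. ergodic_probability G (orbit_closure_top G x0) (shift_action G) \<mu> \<longrightarrow>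
      isomorphic_via G \<mu> (shift_action G) \<nu> (odometer_action G) \<beta>) \<and>
    countably_infinite_maximal_rank (orbit_closure_top G x0) (odometer_top G \<Gamma>) \<beta> \<and>
    (AE \<xi> in \<nu>. infinite (fiber (orbit_closure_top G x0) \<beta> \<xi>) \<and>
      countable (fiber (orbit_closure_top G x0) \<beta> \<xi>))"
proof -
  interpret group G by fact
  interpret free_odometer G \<Gamma>
    by (intro free_odometer.intro free_odometer_axioms.intro) fact+
  interpret haar_odometer G \<Gamma> \<nu>
    by (intro haar_odometer.intro haar_odometer_axioms.intro haar_invariant free_odometer_axioms) fact
  obtain P m U W where "layered_array G \<Gamma> \<nu> P m U W k"
    using layered_array_exists \<open>k \<ge> 2\<close> by blast
  then interpret layered_array G \<Gamma> \<nu> P m U W k .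
  show ?thesis
  proof (intro exI[of _ x0] exI[of _ \<beta>] conjI allI impI)
    show "irregular_toeplitz G x0" by (rule irregular_x0)
    show "factor_map G XT sh YT act \<beta>" by (rule factor_\<beta>)
    show "almost_one_to_one XT \<beta>" by (rule almost_one_to_one_\<beta>)
    show "finite {\<mu>. ergodic_probability G XT sh \<mu>}"
      unfolding ergodic_measures by simp
    show "card {\<mu>. ergodic_probability G XT sh \<mu>} = k"
      unfolding ergodic_measures card_image[OF filling_measure_inj] by simp
    show "isomorphic_via G \<mu> sh \<nu> act \<beta>" if "ergodic_probability G XT sh \<mu>" for \<mu>
      using ergodic_is_filling_measure[OF that] isomorphic_filling_measure by blast
    show "countably_infinite_maximal_rank XT YT \<beta>" by (rule infinite_rank)
    show "AE \<xi> in \<nu>. infinite (fiber XT \<beta> \<xi>) \<and> countable (fiber XT \<beta> \<xi>)" by (rule AE_fiber)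
  qed
qed

end
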